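(* Let $n\geq 3$ and let $A_1,\ldots,A_n$ be positive definite matrices on a $d$-dimensional Hilbert space $\mathcal{H}$ with fixed orthonormal basis $\{|l\rangle\}_{l=1}^d$. Set $n':=\lceil \log_2(n-2)\rceil$ and $\rho:=2^{n'}-(n-2)$. Then $$ \operatorname{Tr}_{\mathcal{H}}\Big[\exp\Big(\sum_{k=1}^n \log A_k\Big)\Big] \leq \operatorname{Tr}_{\mathcal{H}^{\otimes 2^{n'}}}\Big[P_{2^{n'-1}}\, T_{\mathcal{A}}\Big(A_1\otimes \overline{A_n}\otimes \bigotimes_{j=0}^{n'-2} P_{2^j}\Big)\Big], $$ where $\mathcal{A}:=\Big(\bigotimes_{k=2}^{n-1} C^{\alpha_k}A_k^{-1}C^{\alpha_k}\Big)\otimes I_{\mathcal{H}}^{\otimes\rho}$ is a positive definite matrix on $\mathcal{H}^{\otimes 2^{n'}}$ (the tensor factors of $\mathcal{A}$ and of the argument of $T_{\mathcal{A}}$ are both identified with $\mathcal{H}^{\otimes 2^{n'}}$ in the order written), and the empty tensor product (when $n'=1$) is omitted.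
   Context: For $x\in\mathbb{R}$, $\lceil x\rceil$ denotes the smallest positive integer greater than or equal to $x$; in particular $\lceil 0\rceil=1$. The Thue–Morse sequence $\{\alpha_k\}_{k\geq 2}$ is defined by $\alpha_{j+2}:=\beta_j$ for $j\geq 0$, where $\beta_0=0$, $\beta_{2j}=\beta_j$, $\beta_{2j+1}=1-\beta_j$ (so $(\alpha_2,\alpha_3,\alpha_4,\alpha_5)=(0,1,1,0)$). For a matrix $X$ on $\mathcal{H}$, $\overline{X}$ denotes its entrywise complex conjugate in the fixed basis $\{|l\rangle\}$, and $C^{\alpha}XC^{\alpha}$ means $X$ if $\alpha=0$ and $\overline{X}$ if $\alpha=1$. For $m\geq1$, $|\Omega_m\rangle:=\sum_{l_1,\ldots,l_m=1}^d |l_1\otimes\cdots\otimes l_m\rangle\otimes|l_1\otimes\cdots\otimes l_m\rangle\in \mathcal{H}^{\otimes m}\otimes\mathcal{H}^{\otimes m}$ (not normalized), and $P_m:=|\Omega_m\rangle\langle\Omega_m|$, an operator on $\mathcal{H}^{\otimes 2m}$. For positive definite $X$ and any matrix $Y$ of the same size, $T_X(Y):=\frac{d}{dr}\big|_{r=0}\log(X+rY)=\int_0^\infty (X+\tau)^{-1}Y(X+\tau)^{-1}\,d\tau$, where $\tau$ stands for $\tau$ times the identity. *)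

theory Defs
  imports "HOL-Analysis.Analysis" "Jordan_Normal_Form.Matrix"
begin

text \<open>Matrices on H^{tensor m} are complex square matrices of size d^m (Jordan_Normal_Form mat),
  written in the product basis |l1 ... lm> with lexicographic (big-endian) index order.\<close>

definition mconj :: "complex mat \<Rightarrow> complex mat" where
  "mconj A = map_mat cnj A"

definition madj :: "complex mat \<Rightarrow> complex mat" where
  "madj A = transpose_mat (mconj A)"

definition hermitian_mat :: "complex mat \<Rightarrow> bool" where
  "hermitian_mat A \<longleftrightarrow> square_mat A \<and> madj A = A"

definition pos_def_mat :: "complex mat \<Rightarrow> bool" where
  "pos_def_mat A \<longleftrightarrow> hermitian_mat A \<and>
     (\<forall>v \<in> carrier_vec (dim_row A). v \<noteq> 0\<^sub>v (dim_row A) \<longrightarrow>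
        0 < map_vec cnj v \<bullet> (A *\<^sub>v v))"

definition minv :: "complex mat \<Rightarrow> complex mat" where
  "minv A = (THE B. B \<in> carrier_mat (dim_row A) (dim_row A) \<and>
                    A * B = 1\<^sub>m (dim_row A) \<and> B * A = 1\<^sub>m (dim_row A))"

definition mexp :: "complex mat \<Rightarrow> complex mat" where
  "mexp A = mat (dim_row A) (dim_row A)
     (\<lambda>(i,j). \<Sum>k. (A ^\<^sub>m k) $$ (i,j) / of_nat (fact k))"

definition mlog :: "complex mat \<Rightarrow> complex mat" where
  "mlog A = (THE L. L \<in> carrier_mat (dim_row A) (dim_row A) \<and> hermitian_mat L \<and> mexp L = A)"

definition Tder :: "complex mat \<Rightarrow> complex mat \<Rightarrow> complex mat" where
  "Tder X Y = mat (dim_row X) (dim_row X)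
     (\<lambda>(i,j). integral {0::real..}
        (\<lambda>\<tau>. (minv (X + of_real \<tau> \<cdot>\<^sub>m 1\<^sub>m (dim_row X)) * Y *
              minv (X + of_real \<tau> \<cdot>\<^sub>m 1\<^sub>m (dim_row X))) $$ (i,j)))"

definition kron :: "complex mat \<Rightarrow> complex mat \<Rightarrow> complex mat" where
  "kron A B = mat (dim_row A * dim_row B) (dim_col A * dim_col B)
     (\<lambda>(i,j). A $$ (i div dim_row B, j div dim_col B) * B $$ (i mod dim_row B, j mod dim_col B))"

fun kron_list :: "complex mat list \<Rightarrow> complex mat" where
  "kron_list [] = 1\<^sub>m 1"
| "kron_list (A # As) = kron A (kron_list As)"

text \<open>|Omega_m> in H^{(x)m} (x) H^{(x)m}, and P_m = |Omega_m><Omega_m|.\<close>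
definition Omega_vec :: "nat \<Rightarrow> nat \<Rightarrow> complex vec" where
  "Omega_vec d m = vec (d ^ (2 * m)) (\<lambda>i. if i div d ^ m = i mod d ^ m then 1 else 0)"

definition Pproj :: "nat \<Rightarrow> nat \<Rightarrow> complex mat" where
  "Pproj d m = mat (d ^ (2 * m)) (d ^ (2 * m))
     (\<lambda>(i,j). Omega_vec d m $ i * cnj (Omega_vec d m $ j))"

text \<open>Thue--Morse: beta_0 = 0, beta_{2j} = beta_j, beta_{2j+1} = 1 - beta_j; alpha_{j+2} = beta_j.\<close>
function tm_beta :: "nat \<Rightarrow> nat" where
  "tm_beta 0 = 0"
| "tm_beta (Suc m) = (if even (Suc m) then tm_beta (Suc m div 2) else 1 - tm_beta (Suc m div 2))"
  by pat_completeness auto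
termination by (relation "Wellfounded.measure id") (auto elim!: oddE)

definition tm_alpha :: "nat \<Rightarrow> nat" where
  "tm_alpha k = tm_beta (k - 2)"

definition Calpha :: "nat \<Rightarrow> complex mat \<Rightarrow> complex mat" where
  "Calpha a X = (if a = 1 then mconj X else X)"

text \<open>Ceiling with the convention ceil 0 = 1 (smallest positive integer >= x).\<close>
definition pceil :: "real \<Rightarrow> nat" where
  "pceil x = max 1 (nat \<lceil>x\<rceil>)"

definition mtrace :: "complex mat \<Rightarrow> complex" where
  "mtrace A = (\<Sum>i<dim_row A. A $$ (i,i))"

definition msum_list :: "nat \<Rightarrow> complex mat list \<Rightarrow> complex mat" where
  "msum_list N Ms = foldr (+) Ms (0\<^sub>m N N)"

end

theory Submission
  imports Defs "HOL-Complex_Analysis.Complex_Analysis" "HOL-Real_Asymp.Real_Asymp"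
    "Jordan_Normal_Form.Spectral_Radius" "Jordan_Normal_Form.Schur_Decomposition"
begin

text \<open>
  Write \<open>X\<^sub>k(z) = exp (z/2 log A\<^sub>k)\<close>. Since \<open>T\<close> acts in an eigenbasis of \<open>\<A>\<close> by the kernel
  \<open>(ln a - ln b) / (a - b)\<close>, and \<open>x / sinh x\<close> is the Fourier transform of
  \<open>\<beta>\<^sub>0(t) = \<pi> / (2 (cosh (\<pi> t) + 1))\<close>, one has
  \<open>T\<^sub>\<A>(Y) = \<integral> \<beta>\<^sub>0(t) \<A>\<^bsup>-(1+it)/2\<^esup> Y \<A>\<^bsup>-(1-it)/2\<^esup> dt\<close>. The tensor network then contracts to the
  squared Frobenius norm of a product \<open>G(1+it)\<close> of all the \<open>X\<^sub>k(1+it)\<close>, in some order: along the path of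
  contractions the Thue--Morse bits alternate, so the complex conjugations undo the transposes.
  It remains to see \<open>Tr exp (\<Sum> log A\<^sub>k) \<le> \<integral> \<beta>\<^sub>0(t) \<parallel>G(1+it)\<parallel>\<^sup>2 dt\<close> for every order of the factors. With
  \<open>S = \<Sum> log A\<^sub>k\<close>, \<open>Z = Tr e\<^sup>S\<close> and \<open>f(z) = Tr (G(z) (e\<^sup>S / Z)\<^bsup>1-z/2\<^esup>)\<close>, the function \<open>g(z) = f(z)\<^sup>2 Z\<^bsup>-z\<^esup>\<close>
  satisfies \<open>g(0) = 1\<close>, \<open>g'(0) = 0\<close>, \<open>|g(it)| \<le> 1\<close> and \<open>|g(1+it)| \<le> \<parallel>G(1+it)\<parallel>\<^sup>2 / Z\<close>. Integrating
  \<open>(g(z) - 1) \<pi> / (2 (1 - cos (\<pi> z)))\<close>, which is regular at \<open>0\<close>, around the strip \<open>0 \<le> Re z \<le> 1\<close> gives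
  \<open>1 \<le> \<integral> \<beta>\<^sub>0(t) |g(1+it)| dt\<close>.
\<close>

section \<open>Complex analysis on the strip\<close>

text \<open>The factors do not commute, whereas the left side knows only the sum of their
  logarithms. Any order is acceptable because the interpolation uses only G(0) = 1 and G'(0) = S/2
  at the corner 0, and both are blind to the order; hence only the multiset of factors has to be
  followed through the network. The classical route applies Hirschman's form of the three lines
  theorem at an interior point \<theta> and lets \<theta> tend to 0, where its weights tend to
  \<open>\<beta>\<^sub>0\<close>. The double pole of the kernel performs this limit in advance: it
  asks for a double zero of g - 1 at 0, which is what g(0) = 1 and g'(0) = 0 say. The inequality
  then comes from the left edge, where the kernel is negative and Re (g - 1) \<le> 0. The same
  contour identity, applied to exp (y z) - y z, also yields the Fourier transform of
  \<open>\<beta>\<^sub>0\<close>. Integrals over the line against \<open>\<beta>\<^sub>0\<close> are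
  read as limits over [-R, R], so that each integrand is just a continuous function on a compact
  interval.\<close>

definition \<beta>\<^sub>0 :: "real \<Rightarrow> real" where
  "\<beta>\<^sub>0 t = pi / (2 * (cosh (pi * t) + 1))"

text \<open>Grows like 1 / (\<pi> t^2) at 0, so it is not integrable by itself; the double zero of 1
  - g compensates. At t = 0 the division by zero gives the value 0.\<close>

definition \<kappa> :: "real \<Rightarrow> real" where
  "\<kappa> t = pi / (2 * (cosh (pi * t) - 1))"

lemma cos_pi_imag: "cos (of_real pi * (\<i> * of_real t)) = complex_of_real (cosh (pi * t))"
proof -
  have "\<i> * (of_real pi * (\<i> * of_real t)) = complex_of_real (- (pi * t))"
    by (simp add: complex_eq_iff)
  then show ?thesis unfolding cos_exp_eq
    by (simp only: exp_of_real minus_mult_left[symmetric] of_real_minus[symmetric] minus_minus)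
       (simp add: cosh_field_def add.commute)
qed

lemma cosh_gt_1: "x \<noteq> 0 \<Longrightarrow> cosh (x::real) > 1"
  using cosh_real_ge_1[of x] cosh_real_one_iff[of x] by linarith

text \<open>The modulus is explicit: |1 - cos (\<pi> z)| = 2 |sin (\<pi> z / 2)|^2 = cosh (\<pi> Im
  z) - cos (\<pi> Re z).\<close>

lemma strip_kernel_bound:
  assumes "R > 0" "\<bar>Im z\<bar> = R"
  shows "norm (1 / (1 - cos (of_real pi * z))) \<le> 1 / (cosh (pi * R) - 1)"
proof -
  have "cosh (pi * R) > 1" using assms by (intro cosh_gt_1) auto 
  have s: "1 - cos (of_real pi * z) = 2 * (sin (of_real pi * z / 2))^2"
    using cos_double_sin[of "of_real pi * z / 2"] by simp
  have "norm (sin (of_real pi * z / 2))^2 = (exp (pi * Im z) + inverse (exp (pi * Im z)) - 2 * cos (pi * Re z)) / 4"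
    by (subst norm_sin_squared) (simp)
  also have "exp (pi * Im z) + inverse (exp (pi * Im z)) = 2 * cosh (pi * R)"
    using assms by (auto simp: cosh_def exp_minus abs_if field_simps split: if_splits)
  finally have "norm (1 - cos (of_real pi * z)) = cosh (pi * R) - cos (pi * Re z)"
    by (simp add: s norm_mult norm_power)
  then have "norm (1 - cos (of_real pi * z)) \<ge> cosh (pi * R) - 1" by simp
  then show ?thesis using \<open>cosh (pi * R) > 1\<close> by (simp add: norm_divide frac_le)
qed

text \<open>The difference quotient at 0 of an entire function is entire; it is taken twice.\<close>

lemma double_zero_factor:
  fixes g :: "complex \<Rightarrow> complex"
  assumes "g holomorphic_on UNIV" "g 0 = 1" "deriv g 0 = 0"
  obtains r where "r holomorphic_on UNIV" "\<And>z. g z - 1 = z^2 * r z"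
proof -
  define g1 where "g1 = (\<lambda>z. if z = 0 then deriv g 0 else (g z - g 0) / (z - 0))"
  define g2 where "g2 = (\<lambda>z. if z = 0 then deriv g1 0 else (g1 z - g1 0) / (z - 0))"
  have h1: "g1 holomorphic_on UNIV" unfolding g1_def
    by (rule pole_lemma_open) (use assms in auto)
  have h2: "g2 holomorphic_on UNIV" unfolding g2_def
    by (rule pole_lemma_open) (use h1 in auto)
  have "g z - 1 = z^2 * g2 z" for z
    using assms by (auto simp: g1_def g2_def field_simps power2_eq_square)
  with h2 show thesis using that by blast
qed

text \<open>Since 1 - cos (\<pi> z) = 2 sin^2 (\<pi> z / 2), this isolates the double zero of the
  denominator. The zeros of the sine are the even integers, and 0 is the only one with -1 < Re z <
  2.\<close>

lemma sin_half_factor: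
  obtains s :: "complex \<Rightarrow> complex" where "s holomorphic_on UNIV"
    "\<And>z. sin (of_real pi * z / 2) = z * s z"
    "\<And>z. -1 < Re z \<Longrightarrow> Re z < 2 \<Longrightarrow> s z \<noteq> 0"
proof -
  define f where "f = (\<lambda>z::complex. sin (of_real pi * z / 2))"
  define s where "s = (\<lambda>z. if z = 0 then deriv f 0 else (f z - f 0) / (z - 0))"
  have hf: "f holomorphic_on UNIV" unfolding f_def by (intro holomorphic_intros) auto
  have h: "s holomorphic_on UNIV" unfolding s_def
    by (rule pole_lemma_open) (use hf in auto)
  have d: "deriv f 0 = of_real pi / 2"
  proof -
    have "(f has_field_derivative of_real pi / 2) (at 0)"
      unfolding f_def by (auto intro!: derivative_eq_intros)
    then show ?thesis by (rule DERIV_imp_deriv)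
  qed
  have f0: "f 0 = 0" by (simp add: f_def)
  have e: "f z = z * s z" for z by (auto simp: s_def f0)
  have "s z \<noteq> 0" if z: "-1 < Re z" "Re z < 2" for z
  proof (cases "z = 0")
    case True then show ?thesis by (simp add: s_def d)
  next
    case False
    have "f z \<noteq> 0"
    proof
      assume "f z = 0"
      then obtain n :: int where "of_real pi * z / 2 = of_real (of_int n * pi)"
        unfolding f_def sin_eq_0 by (auto simp: mult_ac)
      then have "z = of_int (2 * n)" by (auto simp: field_simps)
      then have "Re z = of_int (2*n)" by (metis Re_complex_of_real of_real_of_int_eq)
      then have "n = 0" using z by linarith
      with \<open>z = of_int (2 * n)\<close> False show False by simp
    qed
    then show ?thesis by (auto simp: e)
  qed
  then show thesis using that h e by (simp add: f_def)
qed

text \<open>The kernel \<open>\<pi> / (2 (1 - cos (\<pi> z)))\<close> equals \<open>\<beta>\<^sub>0\<close> on \<open>Re z = 1\<close> and \<open>-\<kappa>\<close> on \<open>Re z = 0\<close>; its double pole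
  at \<open>0\<close> is cancelled by \<open>g - 1\<close>, so Cauchy's theorem applies to the rectangle \<open>[0,1] \<times> [-R,R]\<close>.\<close>

lemma strip_integral_identity:
  fixes g :: "complex \<Rightarrow> complex"
  assumes hol: "g holomorphic_on UNIV" and g0: "g 0 = 1" "deriv g 0 = 0"
    and bnd: "\<And>z. 0 \<le> Re z \<Longrightarrow> Re z \<le> 1 \<Longrightarrow> norm (g z) \<le> C * (1 + \<bar>Im z\<bar>)"
  shows "((\<lambda>R. integral {-R..R} (\<lambda>t. (g (1 + \<i> * of_real t) - 1) * of_real (\<beta>\<^sub>0 t))
             - integral {-R..R} (\<lambda>t. (1 - g (\<i> * of_real t)) * of_real (\<kappa> t))) \<longlongrightarrow> 0) at_top"
    and "(\<lambda>t. (1 - g (\<i> * of_real t)) * of_real (\<kappa> t)) integrable_on {-R..R}"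
proof -
  obtain r where r: "r holomorphic_on UNIV" "\<And>z. g z - 1 = z^2 * r z"
    using double_zero_factor[OF hol g0] by blast
  obtain s where s: "s holomorphic_on UNIV" "\<And>z. sin (of_real pi * z / 2) = z * s z"
    "\<And>z. -1 < Re z \<Longrightarrow> Re z < 2 \<Longrightarrow> s z \<noteq> 0"
    using sin_half_factor by blast
  \<comment> \<open>The continuation of (g z - 1) \<pi> / (2 (1 - cos (\<pi> z))) across 0: the
    denominator is 2 * 2 * (z * s z)^2, and z^2 cancels against the numerator.\<close>
  define q where "q z = of_real pi * r z / (4 * (s z)^2)" for z
  define S where "S = {z. -1 < Re z} \<inter> {z. Re z < 2}"
  have convS: "convex S" unfolding S_def
    by (intro convex_Int convex_halfspace_Re_gt convex_halfspace_Re_lt)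
  have holq: "q holomorphic_on S" unfolding q_def
    by (intro holomorphic_intros holomorphic_on_subset[OF r(1)] holomorphic_on_subset[OF s(1)])
       (auto simp: S_def s(3))
  have qeq: "q z = (g z - 1) * (of_real pi / 2) * (1 / (1 - cos (of_real pi * z)))" if "z \<noteq> 0" for z
  proof -
    have c: "1 - cos (of_real pi * z) = 2 * (z * s z)^2"
      using cos_double_sin[of "of_real pi * z / 2"] s(2)[of z] by simp
    show ?thesis using that unfolding q_def c r(2) by (cases "s z = 0") (simp_all add: field_simps)
  qed
  have right: "q (Complex 1 t) = (g (1 + \<i> * of_real t) - 1) * of_real (\<beta>\<^sub>0 t)" for t
  proof -
    have z: "Complex 1 t = 1 + \<i> * of_real t" by (simp add: complex_eq_iff)
    have "cos (of_real pi * (1 + \<i> * of_real t)) = - cos (of_real pi * (\<i> * of_real t))"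
      by (simp add: distrib_left cos_add flip: cos_of_real sin_of_real)
    then have c: "cos (of_real pi * (1 + \<i> * of_real t)) = - of_real (cosh (pi * t))"
      by (simp only: cos_pi_imag)
    have "1 + \<i> * of_real t \<noteq> 0" by (simp add: complex_eq_iff)
    from qeq[OF this] show ?thesis unfolding z c \<beta>\<^sub>0_def by (simp add: add.commute)
  qed
  have left: "q (Complex 0 t) = (1 - g (\<i> * of_real t)) * of_real (\<kappa> t)" if "t \<noteq> 0" for t
  proof -
    have z: "Complex 0 t = \<i> * of_real t" by (simp add: complex_eq_iff)
    have "\<i> * of_real t \<noteq> 0" using that by simp
    from qeq[OF this] show ?thesis unfolding z cos_pi_imag \<kappa>_def
      using cosh_gt_1[of "pi * t"] that by (simp add: divide_simps) (simp add: algebra_simps)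
  qed
  have contq: "continuous_on S q" by (rule holomorphic_on_imp_continuous_on[OF holq])
  have intl: "(\<lambda>t. q (Complex c t)) integrable_on {a..b}" if "0 \<le> c" "c \<le> 1" for a b c
    by (intro integrable_continuous_interval continuous_on_compose2[OF contq])
       (use that in \<open>auto intro!: continuous_intros simp: S_def Complex_eq\<close>)
  \<comment> \<open>At t = 0 the default value 0 of \<open>\<kappa>\<close> replaces the value of
    \<open>q\<close>; a single point does not affect the integral.\<close>
  have spike: "((\<lambda>t. (1 - g (\<i> * of_real t)) * of_real (\<kappa> t)) has_integral integral {a..b} (\<lambda>t. q (Complex 0 t))) {a..b}" for a b
    by (rule has_integral_spike_finite[of "{0}" _ _ "\<lambda>t. q (Complex 0 t)"])
       (use left intl[of 0 a b] in \<open>auto simp: has_integral_integrable_integral\<close>)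
  then show "(\<lambda>t. (1 - g (\<i> * of_real t)) * of_real (\<kappa> t)) integrable_on {-R..R}"
    by (meson integrable_on_def)
  have main: "norm (integral {-R..R} (\<lambda>t. (g (1 + \<i> * of_real t) - 1) * of_real (\<beta>\<^sub>0 t))
             - integral {-R..R} (\<lambda>t. (1 - g (\<i> * of_real t)) * of_real (\<kappa> t)))
       \<le> pi * (C * (1 + R) + 1) / (cosh (pi * R) - 1)" if R: "R > 0" for R
  proof -
    define B where "B = pi * (C * (1 + R) + 1) / (2 * (cosh (pi * R) - 1))"
    have ch: "cosh (pi * R) > 1" using R by (intro cosh_gt_1) auto 
    have bq: "norm (q z) \<le> B" if z: "0 \<le> Re z" "Re z \<le> 1" "\<bar>Im z\<bar> = R" for z
    proof -
      have "z \<noteq> 0" using z R by auto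
      then have "norm (q z) = norm (g z - 1) * norm (complex_of_real pi / 2) * norm (1 / (1 - cos (of_real pi * z)))"
        by (subst qeq) (simp_all only: norm_mult not_False_eq_True)
      moreover have "norm (complex_of_real pi / 2) = pi / 2" by (simp add: norm_divide)
      ultimately have "norm (q z) = norm (g z - 1) * (pi / 2) * norm (1 / (1 - cos (of_real pi * z)))"
        by (simp only:)
      also have "\<dots> \<le> (C * (1 + R) + 1) * (pi / 2) * (1 / (cosh (pi * R) - 1))"
      proof (intro mult_mono[OF mult_right_mono])
        show gn: "norm (g z - 1) \<le> C * (1 + R) + 1" 
          using bnd[OF z(1,2)] z(3) norm_triangle_ineq4[of "g z" 1] by simp
        show "0 \<le> (C * (1 + R) + 1) * (pi / 2)"
          using order_trans[OF norm_ge_zero gn] by simp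
        show "norm (1 / (1 - cos (of_real pi * z))) \<le> 1 / (cosh (pi * R) - 1)"
          by (rule strip_kernel_bound[OF R z(3)])
      qed (simp_all only: norm_ge_zero pi_half_ge_zero)
      finally show ?thesis by (simp add: B_def field_simps)
    qed
    have B0: "B \<ge> 0" using bq[of "Complex 0 R"] R norm_ge_zero[of "q (Complex 0 R)"] by (simp del: norm_ge_zero)
    let ?a = "Complex 0 (-R)" and ?b = "Complex 1 (-R)" and ?c = "Complex 1 R" and ?d = "Complex 0 R"
    have seg: "closed_segment u v \<subseteq> S" if "u \<in> S" "v \<in> S" for u v
      using closed_segment_subset[OF that convS] .
    have inS: "?a \<in> S" "?b \<in> S" "?c \<in> S" "?d \<in> S" by (auto simp: S_def)
    have pi: "path_image (rectpath ?a ?c) \<subseteq> S"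
      by (rule order_trans[OF path_image_rectpath_subset_cbox]) (use R in \<open>auto simp: S_def in_cbox_complex_iff\<close>)
    have "(q has_contour_integral 0) (rectpath ?a ?c)"
      by (rule Cauchy_theorem_convex_simple[OF holq convS _ pi]) auto
    then have z: "contour_integral (rectpath ?a ?c) q = 0" by (rule contour_integral_unique)
    have ci: "q contour_integrable_on linepath u v" if "u \<in> S" "v \<in> S" for u v
      by (rule contour_integrable_continuous_linepath)
         (rule continuous_on_subset[OF contq seg[OF that]])
    have "contour_integral (rectpath ?a ?c) q = contour_integral (linepath ?a ?b) q + 
        (contour_integral (linepath ?b ?c) q + (contour_integral (linepath ?c ?d) q + contour_integral (linepath ?d ?a) q))"
      unfolding rectpath_def Let_def using ci inS
      by (simp add: contour_integral_join)
    moreover have "contour_integral (linepath ?b ?c) q = \<i> * integral {-R..R} (\<lambda>t. q (Complex 1 t))"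
      by (rule contour_integral_linepath_same_Re) (use R in auto)
    moreover have "contour_integral (linepath ?d ?a) q = - contour_integral (linepath ?a ?d) q"
      using contour_integral_reversepath[of "linepath ?a ?d" q] by simp
    moreover have "contour_integral (linepath ?a ?d) q = \<i> * integral {-R..R} (\<lambda>t. q (Complex 0 t))"
      by (rule contour_integral_linepath_same_Re) (use R in auto)
    ultimately have e: "\<i> * (integral {-R..R} (\<lambda>t. q (Complex 1 t)) - integral {-R..R} (\<lambda>t. q (Complex 0 t)))
       = - (contour_integral (linepath ?a ?b) q + contour_integral (linepath ?c ?d) q)"
      using z by (simp add: algebra_simps)
    have hor: "norm (contour_integral (linepath u v) q) \<le> B" 
      if "u \<in> S" "v \<in> S" "norm (v - u) = 1" "\<And>x. x \<in> closed_segment u v \<Longrightarrow> 0 \<le> Re x \<and> Re x \<le> 1 \<and> \<bar>Im x\<bar> = R" for u v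
      using contour_integral_bound_linepath[OF ci[OF that(1,2)] B0] bq that(3,4) by fastforce
    have "norm (integral {-R..R} (\<lambda>t. q (Complex 1 t)) - integral {-R..R} (\<lambda>t. q (Complex 0 t)))
       = norm (\<i> * (integral {-R..R} (\<lambda>t. q (Complex 1 t)) - integral {-R..R} (\<lambda>t. q (Complex 0 t))))"
      by (simp add: norm_mult)
    also have "\<dots> \<le> B + B"
      unfolding e norm_minus_cancel
    proof (rule norm_triangle_mono[OF hor hor])
      show "norm (?b - ?a) = 1" "norm (?d - ?c) = 1" by (simp_all add: norm_complex_def)
      show "0 \<le> Re x \<and> Re x \<le> 1 \<and> \<bar>Im x\<bar> = R" if "x \<in> closed_segment ?a ?b" for x
        using that R by (auto simp: closed_segment_same_Im closed_segment_eq_real_ivl)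
      show "0 \<le> Re x \<and> Re x \<le> 1 \<and> \<bar>Im x\<bar> = R" if "x \<in> closed_segment ?c ?d" for x
        using that R by (auto simp: closed_segment_same_Im closed_segment_eq_real_ivl)
    qed (use inS in auto)
    moreover have "B + B = pi * (C * (1 + R) + 1) / (cosh (pi * R) - 1)"
      using ch by (simp add: B_def divide_simps)
    ultimately show ?thesis using integral_unique[OF spike, of "-R" R] by (simp add: right)
  qed
  show "((\<lambda>R. integral {-R..R} (\<lambda>t. (g (1 + \<i> * of_real t) - 1) * of_real (\<beta>\<^sub>0 t))
             - integral {-R..R} (\<lambda>t. (1 - g (\<i> * of_real t)) * of_real (\<kappa> t))) \<longlongrightarrow> 0) at_top"
  proof (rule Lim_null_comparison)
    show "\<forall>\<^sub>F R in at_top. norm (integral {-R..R} (\<lambda>t. (g (1 + \<i> * of_real t) - 1) * of_real (\<beta>\<^sub>0 t))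
             - integral {-R..R} (\<lambda>t. (1 - g (\<i> * of_real t)) * of_real (\<kappa> t)))
       \<le> pi * (C * (1 + R) + 1) / (cosh (pi * R) - 1)"
      using eventually_gt_at_top[of 0] by eventually_elim (rule main)
    show "((\<lambda>R. pi * (C * (1 + R) + 1) / (cosh (pi * R) - 1)) \<longlongrightarrow> 0) at_top"
      unfolding cosh_field_def by real_asymp
  qed
qed

section \<open>Mass and Fourier transform of the weight\<close>

lemma \<beta>\<^sub>0_pos: "\<beta>\<^sub>0 t > 0"
  using cosh_real_pos[of "pi * t"] unfolding \<beta>\<^sub>0_def
  by (intro divide_pos_pos) (auto simp del: cosh_real_pos)

lemma \<kappa>_nonneg: "\<kappa> t \<ge> 0"
  using cosh_real_ge_1[of "pi * t"] by (auto simp: \<kappa>_def)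

lemma continuous_on_\<beta>\<^sub>0 [continuous_intros]:
  "continuous_on S f \<Longrightarrow> continuous_on S (\<lambda>x. \<beta>\<^sub>0 (f x))"
  unfolding \<beta>\<^sub>0_def
proof (intro continuous_intros ballI)
  fix x
  have "0 < 2 * (cosh (pi * f x) + 1)"
    by (intro mult_pos_pos add_pos_pos cosh_real_pos) simp_all
  then show "2 * (cosh (pi * f x) + 1) \<noteq> 0" by (rule less_imp_neq[THEN not_sym])
qed

lemma \<beta>\<^sub>0_minus [simp]: "\<beta>\<^sub>0 (- t) = \<beta>\<^sub>0 t"
  by (simp add: \<beta>\<^sub>0_def)

text \<open>By the double angle formula the weight is \<pi> / (4 cosh^2 (\<pi> t / 2)), the
  derivative of tanh (\<pi> t / 2) / 2.\<close>

lemma integral_\<beta>\<^sub>0: "R \<ge> 0 \<Longrightarrow> integral {-R..R} \<beta>\<^sub>0 = tanh (pi * R / 2)"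
proof -
  assume R: "R \<ge> 0"
  have "((\<lambda>t. tanh (pi * t / 2) / 2) has_real_derivative \<beta>\<^sub>0 t) (at t within {-R..R})" for t
  proof -
    have "((\<lambda>t. tanh (pi * t / 2) / 2) has_real_derivative (1 - tanh (pi * t / 2)^2) * (pi / 2) / 2) (at t within {-R..R})"
      by (auto intro!: derivative_eq_intros)
    moreover have "cosh (pi * t) = 2 * (cosh (pi * t / 2))^2 - 1"
      using cosh_double_cosh[of "pi * t / 2"] by simp
    then have "(1 - tanh (pi * t / 2)^2) * (pi / 2) / 2 = \<beta>\<^sub>0 t"
      using sinh_square_eq[of "pi * t / 2"] cosh_real_nonzero[of "pi * t / 2"]
      by (simp add: \<beta>\<^sub>0_def tanh_def power_divide divide_simps) 
    ultimately show ?thesis by simp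
  qed
  then have "(\<beta>\<^sub>0 has_integral (tanh (pi * R / 2) / 2 - tanh (pi * (-R) / 2) / 2)) {-R..R}"
    by (intro fundamental_theorem_of_calculus) (use R in \<open>auto simp: has_real_derivative_iff_has_vector_derivative\<close>)
  then show ?thesis by (simp add: integral_unique)
qed

lemma integral_\<beta>\<^sub>0_tendsto: "((\<lambda>R. integral {-R..R} \<beta>\<^sub>0) \<longlongrightarrow> 1) at_top"
proof (rule Lim_transform_eventually)
  show "((\<lambda>R. tanh (pi * R / 2)) \<longlongrightarrow> (1::real)) at_top"
    unfolding tanh_def sinh_field_def cosh_field_def by real_asymp
  show "\<forall>\<^sub>F R in at_top. tanh (pi * R / 2) = integral {-R..R} \<beta>\<^sub>0"
    using eventually_ge_at_top[of 0] by eventually_elim (simp add: integral_\<beta>\<^sub>0)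
qed

lemma Re_Im_integral:
  fixes f :: "real \<Rightarrow> complex"
  assumes "f integrable_on S"
  shows "Re (integral S f) = integral S (\<lambda>t. Re (f t))" "Im (integral S f) = integral S (\<lambda>t. Im (f t))"
    "(\<lambda>t. Re (f t)) integrable_on S"
  using integral_linear[OF assms bounded_linear_Re] integral_linear[OF assms bounded_linear_Im]
    integrable_linear[OF assms bounded_linear_Re] by (simp_all add: o_def)

lemma integral_odd_symmetric:
  fixes f :: "real \<Rightarrow> real"
  assumes "\<And>t. f (- t) = - f t"
  shows "integral {-R..R} f = 0"
proof -
  have "integral {-R..R} f = integral {-R..R} (\<lambda>t. f (- t))"
    using Henstock_Kurzweil_Integration.integral_reflect_real[of R "-R" f] by simp
  then show ?thesis by (simp add: assms)
qed

text \<open>The strip identity is used for exp (y z) - y z with y = x and y = -x; the linear term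
  removes the derivative at 0. On the left edge the real part of 1 - g is 1 - cos (y t), even in y,
  so it drops out of the difference of the two identities. The right edges leave 2 sinh x times the
  cosine integral minus 2 x times the mass of the weight.\<close>

lemma \<beta>\<^sub>0_cos_tendsto:
  assumes "x \<noteq> 0"
  shows "((\<lambda>R. integral {-R..R} (\<lambda>t. cos (x * t) * \<beta>\<^sub>0 t)) \<longlongrightarrow> x / sinh x) at_top"
proof -
  define g where "g y z = exp (of_real y * z) - of_real y * z" for y :: real and z :: complex
  define J where "J R y = integral {-R..R} (\<lambda>t. (g y (1 + \<i> * of_real t) - 1) * of_real (\<beta>\<^sub>0 t))" for R y
  define L where "L R y = integral {-R..R} (\<lambda>t. (1 - g y (\<i> * of_real t)) * of_real (\<kappa> t))" for R y
  have hol: "g y holomorphic_on UNIV" for y unfolding g_def by (intro holomorphic_intros)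
  have g0: "g y 0 = 1" for y by (simp add: g_def)
  have g1: "deriv (g y) 0 = 0" for y
  proof -
    have "(g y has_field_derivative 0) (at 0)"
      unfolding g_def by (auto intro!: derivative_eq_intros)
    then show ?thesis by (rule DERIV_imp_deriv)
  qed
  have bnd: "norm (g y z) \<le> (exp \<bar>y\<bar> + \<bar>y\<bar>) * (1 + \<bar>Im z\<bar>)" if "0 \<le> Re z" "Re z \<le> 1" for y z
  proof -
    have "y * Re z \<le> \<bar>y\<bar> * Re z" using that by (intro mult_right_mono) auto
    also have "\<dots> \<le> \<bar>y\<bar>" using that by (intro mult_left_le) auto
    finally have "y * Re z \<le> \<bar>y\<bar>" .
    then have "norm (exp (of_real y * z)) \<le> exp \<bar>y\<bar>" by simp
    moreover have "norm (of_real y * z) \<le> \<bar>y\<bar> * (1 + \<bar>Im z\<bar>)"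
      using cmod_le[of z] that by (auto simp: norm_mult intro!: mult_left_mono)
    ultimately have "norm (g y z) \<le> exp \<bar>y\<bar> + \<bar>y\<bar> * (1 + \<bar>Im z\<bar>)"
      unfolding g_def using norm_triangle_ineq4[of "exp (of_real y * z)" "of_real y * z"] by linarith
    also have "\<dots> \<le> (exp \<bar>y\<bar> + \<bar>y\<bar>) * (1 + \<bar>Im z\<bar>)" by (simp add: algebra_simps)
    finally show ?thesis .
  qed
  have lim: "((\<lambda>R. J R y - L R y) \<longlongrightarrow> 0) at_top" for y
    unfolding J_def L_def by (rule strip_integral_identity(1)[OF hol g0 g1 bnd])
  have intL: "(\<lambda>t. (1 - g y (\<i> * of_real t)) * of_real (\<kappa> t)) integrable_on {-R..R}" for R y
    by (rule strip_integral_identity(2)[OF hol g0 g1 bnd])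
  have ReL: "Re (L R (- x)) = Re (L R x)" for R
    unfolding L_def using intL[of x R] intL[of "-x" R]
    by (simp add: Re_Im_integral g_def Re_exp)
  have contJ: "(\<lambda>t. (g y (1 + \<i> * of_real t) - 1) * of_real (\<beta>\<^sub>0 t)) integrable_on {-R..R}" for R y
    unfolding g_def by (intro integrable_continuous_interval continuous_intros)
  have ic: "(\<lambda>t. cos (x * t) * \<beta>\<^sub>0 t) integrable_on {-R..R}" "\<beta>\<^sub>0 integrable_on {-R..R}" for R
    by (intro integrable_continuous_interval continuous_intros)+
  have ReJ: "Re (J R y) = integral {-R..R} (\<lambda>t. exp y * (cos (y * t) * \<beta>\<^sub>0 t) - (y + 1) * \<beta>\<^sub>0 t)" for R y
    unfolding J_def using contJ[of y R]
    by (simp add: Re_Im_integral g_def Re_exp algebra_simps)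
  have Jx: "Re (J R x) - Re (J R (-x)) = 2 * sinh x * integral {-R..R} (\<lambda>t. cos (x * t) * \<beta>\<^sub>0 t) - 2 * x * integral {-R..R} \<beta>\<^sub>0" for R
  proof -
    have "Re (J R y) = exp y * integral {-R..R} (\<lambda>t. cos (x * t) * \<beta>\<^sub>0 t) - (y + 1) * integral {-R..R} \<beta>\<^sub>0" if "y = x \<or> y = -x" for y
      unfolding ReJ using that ic[of R]
      by (subst integral_diff) (auto intro!: integrable_on_mult_right)
    from this[of x] this[of "-x"] show ?thesis by (simp add: sinh_field_def algebra_simps)
  qed
  have "((\<lambda>R. Re (J R y - L R y)) \<longlongrightarrow> 0) at_top" for y
    using tendsto_Re[OF lim[of y]] by (simp only: zero_complex.sel)
  from tendsto_diff[OF this[of x] this[of "-x"]]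
  have "((\<lambda>R. Re (J R x - L R x) - Re (J R (-x) - L R (-x))) \<longlongrightarrow> 0 - 0) at_top" .
  then have "((\<lambda>R. Re (J R x) - Re (J R (-x))) \<longlongrightarrow> 0) at_top" by (simp add: ReL)
  then have "((\<lambda>R. (2 * sinh x * integral {-R..R} (\<lambda>t. cos (x * t) * \<beta>\<^sub>0 t) - 2 * x * integral {-R..R} \<beta>\<^sub>0) + 2 * x * integral {-R..R} \<beta>\<^sub>0) \<longlongrightarrow> 0 + 2 * x * 1) at_top"
    unfolding Jx by (intro tendsto_intros integral_\<beta>\<^sub>0_tendsto)
  then have "((\<lambda>R. (2 * sinh x * integral {-R..R} (\<lambda>t. cos (x * t) * \<beta>\<^sub>0 t)) / (2 * sinh x)) \<longlongrightarrow> 2 * x / (2 * sinh x)) at_top"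
    using assms by (intro tendsto_divide tendsto_const) auto
  then show ?thesis using assms by simp
qed

lemma \<beta>\<^sub>0_fourier:
  "((\<lambda>R. integral {-R..R} (\<lambda>t. exp (\<i> * of_real (x * t)) * of_real (\<beta>\<^sub>0 t))) \<longlongrightarrow>
      of_real (if x = 0 then 1 else x / sinh x)) at_top"
proof -
  have i: "(\<lambda>t. exp (\<i> * of_real (x * t)) * of_real (\<beta>\<^sub>0 t)) integrable_on {-R..R}" for R
    by (intro integrable_continuous_interval continuous_intros)
  have "integral {-R..R} (\<lambda>t. exp (\<i> * of_real (x * t)) * of_real (\<beta>\<^sub>0 t)) =
      of_real (integral {-R..R} (\<lambda>t. cos (x * t) * \<beta>\<^sub>0 t))" for R
    using i[of R] integral_odd_symmetric[of "\<lambda>t. sin (x * t) * \<beta>\<^sub>0 t" R]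
    by (auto simp: complex_eq_iff Re_Im_integral Re_exp Im_exp)
  moreover have "((\<lambda>R. integral {-R..R} (\<lambda>t. cos (x * t) * \<beta>\<^sub>0 t)) \<longlongrightarrow> (if x = 0 then 1 else x / sinh x)) at_top"
    using integral_\<beta>\<^sub>0_tendsto \<beta>\<^sub>0_cos_tendsto by auto
  ultimately show ?thesis by (simp only: tendsto_of_real)
qed

text \<open>Real parts of the strip identity: the left edge contributes Re (1 - g) * \<kappa> \<ge>
  0, so in the limit the weighted average of Re g - 1 over the right edge cannot be negative. The
  weight has mass 1, and \<open>N\<close> dominates Re g there.\<close>

lemma strip_average_ge_1:
  fixes g :: "complex \<Rightarrow> complex" and N :: "real \<Rightarrow> real"
  assumes hol: "g holomorphic_on UNIV" and g0: "g 0 = 1" "deriv g 0 = 0"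
    and bnd: "\<And>z. 0 \<le> Re z \<Longrightarrow> Re z \<le> 1 \<Longrightarrow> norm (g z) \<le> C"
    and left: "\<And>t. norm (g (\<i> * of_real t)) \<le> 1"
    and right: "\<And>t. norm (g (1 + \<i> * of_real t)) \<le> N t"
    and N: "continuous_on UNIV N"
    and lim: "((\<lambda>R. integral {-R..R} (\<lambda>t. N t * \<beta>\<^sub>0 t)) \<longlongrightarrow> r) at_top"
  shows "1 \<le> r"
proof -
  have C0: "C \<ge> 0" using bnd[of 0] norm_ge_zero[of "g 0"] by (simp del: norm_ge_zero)
  have bnd': "norm (g z) \<le> C * (1 + \<bar>Im z\<bar>)" if "0 \<le> Re z" "Re z \<le> 1" for z
    using bnd[OF that] mult_nonneg_nonneg[OF C0, of "\<bar>Im z\<bar>"] unfolding distrib_left by linarith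
  define J where "J R = integral {-R..R} (\<lambda>t. (g (1 + \<i> * of_real t) - 1) * of_real (\<beta>\<^sub>0 t))" for R
  define L where "L R = integral {-R..R} (\<lambda>t. (1 - g (\<i> * of_real t)) * of_real (\<kappa> t))" for R
  have l0: "((\<lambda>R. J R - L R) \<longlongrightarrow> 0) at_top"
    unfolding J_def L_def by (rule strip_integral_identity(1)[OF hol g0 bnd'])
  have intL: "(\<lambda>t. (1 - g (\<i> * of_real t)) * of_real (\<kappa> t)) integrable_on {-R..R}" for R
    by (rule strip_integral_identity(2)[OF hol g0 bnd'])
  have "continuous_on UNIV g" using hol by (rule holomorphic_on_imp_continuous_on)
  then have cg: "continuous_on S (\<lambda>t. g (1 + \<i> * of_real t))" for S :: "real set"
    by (rule continuous_on_compose2) (auto intro!: continuous_intros)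
  have cN: "continuous_on S N" for S by (rule continuous_on_subset[OF N]) auto
  have intJ: "(\<lambda>t. (g (1 + \<i> * of_real t) - 1) * of_real (\<beta>\<^sub>0 t)) integrable_on {-R..R}" for R
    by (intro integrable_continuous_interval continuous_intros cg)
  have intN: "(\<lambda>t. N t * \<beta>\<^sub>0 t) integrable_on {-R..R}" "\<beta>\<^sub>0 integrable_on {-R..R}" for R
    by (intro integrable_continuous_interval continuous_intros cN)+
  have Lpos: "Re (L R) \<ge> 0" for R
  proof -
    have "Re (L R) = integral {-R..R} (\<lambda>t. (1 - Re (g (\<i> * of_real t))) * \<kappa> t)"
      using intL[of R] unfolding L_def by (simp add: Re_Im_integral)
    also have "\<dots> \<ge> 0"
    proof (rule integral_nonneg)
      show "(\<lambda>t. (1 - Re (g (\<i> * of_real t))) * \<kappa> t) integrable_on {-R..R}"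
        using Re_Im_integral(3)[OF intL[of R]] by simp
      show "0 \<le> (1 - Re (g (\<i> * of_real t))) * \<kappa> t" for t
        using complex_Re_le_cmod[of "g (\<i> * of_real t)"] left[of t] \<kappa>_nonneg[of t] by simp
    qed
    finally show ?thesis .
  qed
  have Jle: "Re (J R) \<le> integral {-R..R} (\<lambda>t. N t * \<beta>\<^sub>0 t) - integral {-R..R} \<beta>\<^sub>0" for R
  proof -
    have "Re (J R) = integral {-R..R} (\<lambda>t. (Re (g (1 + \<i> * of_real t)) - 1) * \<beta>\<^sub>0 t)"
      using intJ[of R] unfolding J_def by (simp add: Re_Im_integral)
    also have "\<dots> \<le> integral {-R..R} (\<lambda>t. N t * \<beta>\<^sub>0 t - \<beta>\<^sub>0 t)"
    proof (rule integral_le)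
      show "(\<lambda>t. (Re (g (1 + \<i> * of_real t)) - 1) * \<beta>\<^sub>0 t) integrable_on {-R..R}"
        using Re_Im_integral(3)[OF intJ[of R]] by simp
      show "(\<lambda>t. N t * \<beta>\<^sub>0 t - \<beta>\<^sub>0 t) integrable_on {-R..R}" by (intro integrable_diff intN)
      show "(Re (g (1 + \<i> * of_real t)) - 1) * \<beta>\<^sub>0 t \<le> N t * \<beta>\<^sub>0 t - \<beta>\<^sub>0 t" for t
        using complex_Re_le_cmod[of "g (1 + \<i> * of_real t)"] right[of t] \<beta>\<^sub>0_pos[of t]
        by (simp add: left_diff_distrib)
    qed
    also have "\<dots> = integral {-R..R} (\<lambda>t. N t * \<beta>\<^sub>0 t) - integral {-R..R} \<beta>\<^sub>0"
      by (rule integral_diff[OF intN])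
    finally show ?thesis .
  qed
  have "((\<lambda>R. integral {-R..R} (\<lambda>t. N t * \<beta>\<^sub>0 t) - integral {-R..R} \<beta>\<^sub>0) \<longlongrightarrow> r - 1) at_top"
    by (intro tendsto_intros lim integral_\<beta>\<^sub>0_tendsto)
  moreover have "((\<lambda>R. Re (J R - L R)) \<longlongrightarrow> 0) at_top" using tendsto_Re[OF l0] by simp
  moreover have "Re (J R - L R) \<le> integral {-R..R} (\<lambda>t. N t * \<beta>\<^sub>0 t) - integral {-R..R} \<beta>\<^sub>0" for R
    using Jle[of R] Lpos[of R] by simp
  ultimately have "0 \<le> r - 1"
    by (intro tendsto_le[of at_top]) auto
  then show ?thesis by simp
qed

text \<open>The first divided difference of ln, that is, the reciprocal of the logarithmic mean: the
  multiplier by which the derivative of the matrix logarithm acts in an eigenbasis.\<close>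

definition log_mean_inv :: "real \<Rightarrow> real \<Rightarrow> real" where
  "log_mean_inv a b = (if a = b then 1 / a else (ln a - ln b) / (a - b))"

text \<open>Partial fractions give an antiderivative vanishing at infinity, so the integral is minus
  its value at 0.\<close>

lemma resolvent_integral:
  assumes "a > 0" "b > 0"
  shows "((\<lambda>\<tau>. 1 / ((a + \<tau>) * (b + \<tau>))) has_integral log_mean_inv a b) {0..}"
proof -
  define F where "F \<tau> = (if a = b then - 1 / (a + \<tau>) else (ln (b + \<tau>) - ln (a + \<tau>)) / (a - b))" for \<tau>
  have F: "(F has_real_derivative 1 / ((a + \<tau>) * (b + \<tau>))) (at \<tau>)" if "\<tau> \<ge> 0" for \<tau>
  proof (cases "a = b")
    case True
    then show ?thesis unfolding F_def using that assms
      by (auto intro!: derivative_eq_intros simp: power2_eq_square)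
  next
    case False
    have "((\<lambda>\<tau>. (ln (b + \<tau>) - ln (a + \<tau>)) / (a - b)) has_real_derivative (1 / (b + \<tau>) - 1 / (a + \<tau>)) / (a - b)) (at \<tau>)"
      using that assms False by (auto intro!: derivative_eq_intros)
    moreover have "(1 / (b + \<tau>) - 1 / (a + \<tau>)) / (a - b) = 1 / ((a + \<tau>) * (b + \<tau>))"
      using that assms False by (simp add: divide_simps)
    ultimately show ?thesis using False by (simp add: F_def[abs_def])
  qed
  have lim: "(F \<longlongrightarrow> 0) at_top"
  proof (cases "a = b")
    case True then show ?thesis unfolding F_def by simp real_asymp
  next
    case False 
    have "((\<lambda>\<tau>. ln (b + \<tau>) - ln (a + \<tau>)) \<longlongrightarrow> 0) at_top" by real_asymp
    then have "((\<lambda>\<tau>. (ln (b + \<tau>) - ln (a + \<tau>)) / (a - b)) \<longlongrightarrow> 0) at_top"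
      by (rule tendsto_divide_zero)
    then show ?thesis using False by (simp add: F_def[abs_def])
  qed
  have F0: "- F 0 = log_mean_inv a b"
    by (auto simp: F_def log_mean_inv_def divide_simps)
  \<comment> \<open>The integrand is nonnegative, so the Lebesgue form of the fundamental theorem on
    a half-line yields integrability and value together.\<close>
  have nn: "(\<integral>\<^sup>+\<tau>. ennreal (1 / ((a + \<tau>) * (b + \<tau>))) * indicator {0..} \<tau> \<partial>lborel) = ennreal (0 - F 0)"
    by (rule nn_integral_FTC_atLeast[OF _ F]) (use lim assms in auto)
  have "((\<lambda>\<tau>. 1 / ((a + \<tau>) * (b + \<tau>)) * indicator {0..} \<tau>) has_integral (0 - F 0)) UNIV"
  proof (rule nn_integral_has_integral)
    show "(\<integral>\<^sup>+\<tau>. ennreal (1 / ((a + \<tau>) * (b + \<tau>)) * indicator {0..} \<tau>) \<partial>lborel) = ennreal (0 - F 0)"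
      unfolding nn[symmetric] by (intro nn_integral_cong) (simp split: split_indicator)
    show "0 \<le> 0 - F 0" using assms by (auto simp: F_def divide_simps)
  qed (use assms in \<open>auto split: split_indicator\<close>)
  then have "((\<lambda>\<tau>. if \<tau> \<in> {0..} then 1 / ((a + \<tau>) * (b + \<tau>)) else 0) has_integral (0 - F 0)) UNIV"
    by (rule has_integral_eq[rotated]) auto
  then show ?thesis by (simp only: has_integral_restrict_UNIV F0 diff_0)
qed

section \<open>Spectral calculus for Hermitian matrices\<close>

lemma mconj_dim [simp]: "dim_row (mconj A) = dim_row A" "dim_col (mconj A) = dim_col A"
  by (auto simp: mconj_def)

lemma madj_dim [simp]: "dim_row (madj A) = dim_col A" "dim_col (madj A) = dim_row A"
  by (auto simp: madj_def)

lemma mconj_carrier [simp, intro]: "A \<in> carrier_mat m n \<Longrightarrow> mconj A \<in> carrier_mat m n"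
  by (auto simp: mconj_def)

lemma madj_carrier [simp, intro]: "A \<in> carrier_mat m n \<Longrightarrow> madj A \<in> carrier_mat n m"
  by (auto simp: madj_def)

lemma mconj_index [simp]: "i < dim_row A \<Longrightarrow> j < dim_col A \<Longrightarrow> mconj A $$ (i,j) = cnj (A $$ (i,j))"
  by (simp add: mconj_def)

lemma madj_index [simp]: "i < dim_col A \<Longrightarrow> j < dim_row A \<Longrightarrow> madj A $$ (i,j) = cnj (A $$ (j,i))"
  by (simp add: madj_def)

lemma mult_index:
  assumes "A \<in> carrier_mat m k" "B \<in> carrier_mat k n" "i < m" "j < n"
  shows "(A * B) $$ (i,j) = (\<Sum>l<k. A $$ (i,l) * B $$ (l,j))"
  using assms by (auto simp: scalar_prod_def lessThan_atLeast0 intro!: sum.cong)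

lemma mult_square_carrier:
  "A \<in> carrier_mat n n \<Longrightarrow> B \<in> carrier_mat n n \<Longrightarrow> A * B \<in> carrier_mat n n"
  by auto

lemma madj_madj [simp]: "madj (madj A) = A"
  by (rule eq_matI) auto

lemma madj_mult:
  assumes "A \<in> carrier_mat m k" "B \<in> carrier_mat k n"
  shows "madj (A * B) = madj B * madj A"
proof (rule eq_matI)
  fix i j assume ij: "i < dim_row (madj B * madj A)" "j < dim_col (madj B * madj A)"
  then have "madj (A * B) $$ (i,j) = cnj ((A * B) $$ (j,i))" using assms by simp
  also have "\<dots> = (madj B * madj A) $$ (i,j)" using ij assms
    by (simp add: mult_index[OF assms] mult_index[OF madj_carrier[OF assms(2)] madj_carrier[OF assms(1)]] mult.commute
        del: index_mult_mat(1))
  finally show "madj (A * B) $$ (i,j) = (madj B * madj A) $$ (i,j)" .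
qed (use assms in auto)

lemma madj_one [simp]: "madj (1\<^sub>m n) = 1\<^sub>m n"
  by (rule eq_matI) auto

lemma cnj_mult_self: "cnj z * z = of_real ((cmod z)\<^sup>2)"
  using complex_norm_square[of z] by (simp add: mult.commute)

definition unitary_mat :: "nat \<Rightarrow> complex mat \<Rightarrow> bool" where
  "unitary_mat n U \<longleftrightarrow> U \<in> carrier_mat n n \<and> madj U * U = 1\<^sub>m n"

lemma unitary_matD:
  assumes "unitary_mat n U"
  shows "U \<in> carrier_mat n n" "madj U * U = 1\<^sub>m n" "U * madj U = 1\<^sub>m n"
  using assms mat_mult_left_right_inverse[of "madj U" n U] by (auto simp: unitary_mat_def)

lemma unitary_mat_one [simp]: "unitary_mat n (1\<^sub>m n)"
  by (simp add: unitary_mat_def)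

lemma unitary_mat_mult:
  assumes "unitary_mat n U" "unitary_mat n V"
  shows "unitary_mat n (U * V)"
proof -
  note U = unitary_matD[OF assms(1)] and V = unitary_matD[OF assms(2)]
  have "madj (U * V) * (U * V) = madj V * (madj U * U) * V"
    unfolding madj_mult[OF U(1) V(1)]
    using U(1) V(1) madj_carrier[OF U(1)] madj_carrier[OF V(1)]
    by (simp add: assoc_mult_mat[of _ n n _ n _ n] mult_square_carrier)
  then show ?thesis using U V by (auto simp: unitary_mat_def)
qed

lemma unitary_mat_adj: "unitary_mat n U \<Longrightarrow> unitary_mat n (madj U)"
  by (simp add: unitary_mat_def[of n "madj U"] unitary_matD)

definition diagm :: "nat \<Rightarrow> (nat \<Rightarrow> complex) \<Rightarrow> complex mat" where
  "diagm n c = mat n n (\<lambda>(i,j). if i = j then c i else 0)"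

lemma diagm_carrier [simp, intro]: "diagm n c \<in> carrier_mat n n"
  by (simp add: diagm_def)

lemma diagm_dim [simp]: "dim_row (diagm n c) = n" "dim_col (diagm n c) = n"
  by (simp_all add: diagm_def)

lemma diagm_index [simp]: "i < n \<Longrightarrow> j < n \<Longrightarrow> diagm n c $$ (i,j) = (if i = j then c i else 0)"
  by (simp add: diagm_def)

lemma diagm_mult: "diagm n c * diagm n c' = diagm n (\<lambda>i. c i * c' i)"
proof (rule eq_matI)
  fix i j assume "i < dim_row (diagm n (\<lambda>i. c i * c' i))" "j < dim_col (diagm n (\<lambda>i. c i * c' i))"
  then have ij: "i < n" "j < n" by auto
  have "(diagm n c * diagm n c') $$ (i,j) = (\<Sum>l<n. diagm n c $$ (i,l) * diagm n c' $$ (l,j))"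
    by (rule mult_index) (use ij in auto)
  also have "\<dots> = (\<Sum>l<n. if l = i then (if i = j then c i * c' i else 0) else 0)"
    using ij by (intro sum.cong) auto
  finally show "(diagm n c * diagm n c') $$ (i,j) = diagm n (\<lambda>i. c i * c' i) $$ (i,j)"
    using ij by simp
qed auto

lemma diagm_one: "diagm n (\<lambda>_. 1) = 1\<^sub>m n"
  by (rule eq_matI) auto

text \<open>Functional calculus with the eigenbasis \<open>U\<close> held fixed: products, adjoints,
  powers, inverses and exponentials become pointwise operations on \<open>c\<close>. The diagonal is
  complex so that complex powers fit in.\<close>

definition spec :: "nat \<Rightarrow> complex mat \<Rightarrow> (nat \<Rightarrow> complex) \<Rightarrow> complex mat" where
  "spec n U c = U * diagm n c * madj U"

lemma spec_carrier [simp, intro]: "U \<in> carrier_mat n n \<Longrightarrow> spec n U c \<in> carrier_mat n n"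
  by (auto simp: spec_def)

lemma spec_dim [simp]: "dim_row (spec n U c) = dim_row U" "dim_col (spec n U c) = dim_row U"
  by (auto simp: spec_def)

lemma spec_index:
  assumes "U \<in> carrier_mat n n" "i < n" "j < n"
  shows "spec n U c $$ (i,j) = (\<Sum>k<n. U $$ (i,k) * c k * cnj (U $$ (j,k)))"
proof -
  have UD: "(U * diagm n c) $$ (i,k) = U $$ (i,k) * c k" if "k < n" for k
  proof -
    have "(U * diagm n c) $$ (i,k) = (\<Sum>l<n. U $$ (i,l) * diagm n c $$ (l,k))"
      by (rule mult_index) (use assms that in auto)
    also have "\<dots> = (\<Sum>l<n. if l = k then U $$ (i,k) * c k else 0)"
      using that by (intro sum.cong) auto
    finally show ?thesis using that by simp
  qed
  have "spec n U c $$ (i,j) = (\<Sum>k<n. (U * diagm n c) $$ (i,k) * madj U $$ (k,j))"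
    unfolding spec_def by (rule mult_index) (use assms in auto)
  then show ?thesis using assms by (simp add: UD del: index_mult_mat(1))
qed

lemma spec_cong: "(\<And>i. i < n \<Longrightarrow> c i = c' i) \<Longrightarrow> spec n U c = spec n U c'"
  unfolding spec_def by (rule arg_cong[of _ _ "\<lambda>D. U * D * madj U"]) (auto simp: diagm_def)

lemma spec_mult:
  assumes "unitary_mat n U"
  shows "spec n U c * spec n U c' = spec n U (\<lambda>i. c i * c' i)"
proof -
  note U = unitary_matD[OF assms]
  note a = assoc_mult_mat[of _ n n _ n _ n]
  have "spec n U c * spec n U c' = U * diagm n c * (madj U * U) * diagm n c' * madj U"
    unfolding spec_def using U(1) madj_carrier[OF U(1)] diagm_carrier[of n c] diagm_carrier[of n c']
    by (simp add: a mult_square_carrier)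
  also have "\<dots> = U * (diagm n c * diagm n c') * madj U"
    unfolding U(2) using U(1) madj_carrier[OF U(1)] diagm_carrier[of n c] diagm_carrier[of n c']
    by (simp add: a mult_square_carrier)
  finally show ?thesis by (simp add: spec_def diagm_mult)
qed

lemma spec_one: "unitary_mat n U \<Longrightarrow> spec n U (\<lambda>_. 1) = 1\<^sub>m n"
  using unitary_matD[of n U] by (simp add: spec_def diagm_one)

lemma spec_adj:
  assumes "U \<in> carrier_mat n n"
  shows "madj (spec n U c) = spec n U (\<lambda>i. cnj (c i))"
  by (rule eq_matI) (use assms in \<open>auto simp: spec_index spec_carrier[THEN carrier_matD(1)] spec_carrier[THEN carrier_matD(2)] mult_ac\<close>)

lemma spec_unitary:
  assumes "unitary_mat n U" "\<And>i. i < n \<Longrightarrow> norm (c i) = 1"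
  shows "unitary_mat n (spec n U c)"
proof -
  note U = unitary_matD[OF assms(1)]
  have "spec n U (\<lambda>i. cnj (c i) * c i) = spec n U (\<lambda>_. 1)"
    by (rule spec_cong) (simp add: cnj_mult_self assms(2))
  then show ?thesis unfolding unitary_mat_def
    using U spec_one[OF assms(1)] by (simp add: spec_adj spec_mult[OF assms(1)])
qed

text \<open>Complete \<open>v\<close> to a basis and orthogonalise with \<open>v\<close> in first
  place, so that \<open>v\<close> itself survives; then divide each column by its length. The factor
  \<open>c\<close> is the inverse length of \<open>v\<close>.\<close>

lemma unitary_extension_of_unit_vector:
  fixes v :: "complex vec"
  assumes v: "v \<in> carrier_vec n" "v \<noteq> 0\<^sub>v n"
  obtains U c where "unitary_mat n U" "\<And>i. i < n \<Longrightarrow> U $$ (i,0) = c * v $ i"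
proof -
  interpret cof_vec_space n "TYPE(complex)" .
  define b where "b = basis_completion v"
  define ws where "ws = gram_schmidt n b"
  have n: "n \<noteq> 0" using v by (metis carrier_vecD eq_vecI index_zero_vec(2) not_less_zero zero_carrier_vec)
  from basis_completion[OF v, folded b_def]
  have span_b: "span (set b) = carrier_vec n" and dist_b: "distinct b" 
    and indep: "\<not> lin_dep (set b)" and b: "set b \<subseteq> carrier_vec n" and hdb: "hd b = v" 
    and len_b: "length b = n" by auto
  from hdb len_b n obtain vs where bv: "b = v # vs" by (cases b) auto
  from gram_schmidt_result[OF b dist_b indep refl, folded ws_def]
  have ws: "set ws \<subseteq> carrier_vec n" "corthogonal ws" "length ws = n" 
    by (auto simp: len_b)
  from gram_schmidt_hd[OF v(1), of vs, folded bv] have hdws: "hd ws = v" unfolding ws_def .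
  have ws0: "ws ! 0 = v" using hdws n ws(3) by (cases ws) auto
  have carr: "ws ! j \<in> carrier_vec n" if "j < n" for j using ws that by (metis nth_mem subsetD)
  define r where "r j = (\<Sum>i<n. (cmod (ws ! j $ i))^2)" for j
  have ip: "(\<Sum>l<n. cnj (ws ! i $ l) * ws ! j $ l) = (if i = j then of_real (r i) else 0)"
    and rpos: "r i > 0" if ij: "i < n" "j < n" for i j
  proof -
    have e: "ws ! j \<bullet>c ws ! i = (\<Sum>l<n. cnj (ws ! i $ l) * ws ! j $ l)" if "i < n" "j < n" for i j
      using carr[OF that(1)] carr[OF that(2)] 
      by (simp add: scalar_prod_def lessThan_atLeast0) (simp add: mult.commute)
    have s: "(\<Sum>l<n. cnj (ws ! i $ l) * ws ! i $ l) = of_real (r i)" for i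
      by (simp only: r_def of_real_sum cnj_mult_self)
    have "ws ! j \<bullet>c ws ! i = 0 \<longleftrightarrow> j \<noteq> i"
      using corthogonalD[OF ws(2)] ij ws(3) by simp
    then show "(\<Sum>l<n. cnj (ws ! i $ l) * ws ! j $ l) = (if i = j then of_real (r i) else 0)"
      using e[OF ij] s[of i] by (cases "i = j") simp_all
    have "ws ! i \<bullet>c ws ! i \<noteq> 0" using corthogonalD[OF ws(2)] ij ws(3) by simp
    then have "r i \<noteq> 0" unfolding e[OF ij(1) ij(1)] s[of i] by simp
    moreover have "r i \<ge> 0" by (simp add: r_def sum_nonneg)
    ultimately show "r i > 0" by simp
  qed
  define U where "U = mat n n (\<lambda>(i,j). ws ! j $ i / of_real (sqrt (r j)))"
  have U: "U \<in> carrier_mat n n" by (simp add: U_def)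
  have "madj U * U = 1\<^sub>m n"
  proof (rule eq_matI)
    fix i j assume "i < dim_row (1\<^sub>m n :: complex mat)" "j < dim_col (1\<^sub>m n :: complex mat)"
    then have ij: "i < n" "j < n" by auto
    have "(madj U * U) $$ (i,j) = (\<Sum>l<n. madj U $$ (i,l) * U $$ (l,j))"
      by (rule mult_index) (use U ij in auto)
    also have "\<dots> = (\<Sum>l<n. cnj (ws ! i $ l) * ws ! j $ l / (of_real (sqrt (r i)) * of_real (sqrt (r j))))"
      using U ij by (intro sum.cong) (auto simp: U_def)
    also have "\<dots> = (if i = j then of_real (r i) else 0) / (of_real (sqrt (r i)) * of_real (sqrt (r j)))"
      by (simp add: sum_divide_distrib[symmetric] ip[OF ij])
    also have "\<dots> = 1\<^sub>m n $$ (i,j)"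
      using ij rpos[OF ij] by (auto simp flip: of_real_mult)
    finally show "(madj U * U) $$ (i,j) = 1\<^sub>m n $$ (i,j)" .
  qed (use U in auto)
  then have "unitary_mat n U" using U by (simp add: unitary_mat_def)
  moreover have "U $$ (i,0) = 1 / of_real (sqrt (r 0)) * v $ i" if "i < n" for i
    using that n by (simp add: U_def ws0)
  ultimately show thesis using that by blast
qed

lemma four_block_carrier:
  assumes "A \<in> carrier_mat n1 n1" "D \<in> carrier_mat n2 n2"
  shows "four_block_mat A B C D \<in> carrier_mat (n1 + n2) (n1 + n2)"
  using assms by auto

lemma madj_four_block_diag:
  assumes "A \<in> carrier_mat n1 n1" "D \<in> carrier_mat n2 n2"
  shows "madj (four_block_mat A (0\<^sub>m n1 n2) (0\<^sub>m n2 n1) D) = four_block_mat (madj A) (0\<^sub>m n1 n2) (0\<^sub>m n2 n1) (madj D)"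
  by (rule eq_matI) (use assms in \<open>auto simp: four_block_mat_def Let_def\<close>)

lemma mult_four_block_diag:
  fixes A :: "complex mat"
  assumes "A \<in> carrier_mat n1 n1" "D \<in> carrier_mat n2 n2" "A' \<in> carrier_mat n1 n1" "D' \<in> carrier_mat n2 n2"
  shows "four_block_mat A (0\<^sub>m n1 n2) (0\<^sub>m n2 n1) D * four_block_mat A' (0\<^sub>m n1 n2) (0\<^sub>m n2 n1) D'
     = four_block_mat (A * A') (0\<^sub>m n1 n2) (0\<^sub>m n2 n1) (D * D')"
  by (subst mult_four_block_mat[OF assms(1) _ _ assms(2) assms(3) _ _ assms(4)]) (use assms in auto)

lemma one_four_block: "four_block_mat (1\<^sub>m n1) (0\<^sub>m n1 n2) (0\<^sub>m n2 n1) (1\<^sub>m n2) = (1\<^sub>m (n1 + n2) :: complex mat)"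
  by (rule eq_matI) (auto simp: four_block_mat_def Let_def)

lemma spec_conj:
  assumes "U \<in> carrier_mat n n" "V \<in> carrier_mat n n"
  shows "U * spec n V c * madj U = spec n (U * V) c"
  unfolding spec_def madj_mult[OF assms]
  using assms madj_carrier[OF assms(1)] madj_carrier[OF assms(2)] diagm_carrier[of n c]
  by (simp add: assoc_mult_mat[of _ n n _ n _ n] mult_square_carrier)

text \<open>Deflation by induction on the size. In a unitary basis starting with an eigenvector the
  first column is e times the first unit vector; Hermitian symmetry clears the first row too and
  makes e real, leaving a smaller Hermitian block.\<close>

theorem hermitian_spectral:
  assumes "A \<in> carrier_mat n n" "madj A = A"
  obtains U a where "unitary_mat n U" "A = spec n U (\<lambda>i. complex_of_real (a i))"
proof -
  have "\<exists>U a. unitary_mat n U \<and> A = spec n U (\<lambda>i. complex_of_real (a i))"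
    using assms
  proof (induction n arbitrary: A)
    case 0
    then have "A = spec 0 (1\<^sub>m 0) (\<lambda>i. complex_of_real 0)"
      by (intro eq_matI) (auto simp: spec_def)
    then show ?case by (intro exI[of _ "1\<^sub>m 0"] exI[of _ "\<lambda>_. 0"]) auto
  next
    case (Suc m)
    let ?n = "Suc m"
    note A = Suc.prems(1)
    obtain e where "eigenvalue A e"
      using spectrum_non_empty[OF A] by (auto simp: spectrum_def)
    then obtain v where v: "v \<in> carrier_vec ?n" "v \<noteq> 0\<^sub>v ?n" "A *\<^sub>v v = e \<cdot>\<^sub>v v"
      using A by (auto simp: eigenvalue_def eigenvector_def)
    obtain U c where U: "unitary_mat ?n U" "\<And>i. i < ?n \<Longrightarrow> U $$ (i,0) = c * v $ i"
      using unitary_extension_of_unit_vector[OF v(1,2)] by blast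
    note UD = unitary_matD[OF U(1)]
    note cU = madj_carrier[OF UD(1)]
    define B where "B = madj U * A * U"
    have B: "B \<in> carrier_mat ?n ?n" using UD(1) A cU by (auto simp: B_def)
    have Bh: "madj B = B"
      unfolding B_def using UD(1) A cU Suc.prems(2)
      by (simp add: madj_mult[of _ ?n ?n _ ?n] assoc_mult_mat[of _ ?n ?n _ ?n _ ?n] mult_square_carrier)
    have AU: "(A * U) $$ (i,0) = e * U $$ (i,0)" if "i < ?n" for i
    proof -
      have "(A * U) $$ (i,0) = (\<Sum>l<?n. A $$ (i,l) * U $$ (l,0))"
        by (rule mult_index) (use A UD that in auto)
      also have "\<dots> = c * (\<Sum>l<?n. A $$ (i,l) * v $ l)"
        unfolding sum_distrib_left by (intro sum.cong) (auto simp: U(2))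
      also have "(\<Sum>l<?n. A $$ (i,l) * v $ l) = (A *\<^sub>v v) $ i"
        using A v(1) that by (auto simp: scalar_prod_def lessThan_atLeast0 intro!: sum.cong)
      finally show ?thesis using v that by (simp add: U(2))
    qed
    have B0: "B $$ (i,0) = (if i = 0 then e else 0)" if "i < ?n" for i
    proof -
      have "B = madj U * (A * U)" unfolding B_def using A UD cU by (simp add: assoc_mult_mat[of _ ?n ?n _ ?n _ ?n])
      then have "B $$ (i,0) = (\<Sum>l<?n. madj U $$ (i,l) * (A * U) $$ (l,0))"
        using mult_index[OF cU mult_square_carrier[OF A UD(1)] that, of 0] by simp
      also have "\<dots> = e * (\<Sum>l<?n. madj U $$ (i,l) * U $$ (l,0))"
        unfolding sum_distrib_left by (intro sum.cong) (auto simp: AU)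
      also have "(\<Sum>l<?n. madj U $$ (i,l) * U $$ (l,0)) = (madj U * U) $$ (i,0)"
        using mult_index[OF cU UD(1) that, of 0] by simp
      finally show ?thesis using that by (simp add: UD(2))
    qed
    have Bsym: "B $$ (i,j) = cnj (B $$ (j,i))" if "i < ?n" "j < ?n" for i j
      using arg_cong[OF Bh, of "\<lambda>M. M $$ (i,j)"] that B by simp
    have e: "e = of_real (Re e)"
      using Bsym[of 0 0] B0[of 0] by (simp add: complex_eq_iff)
    define B3 where "B3 = mat m m (\<lambda>(i,j). B $$ (Suc i, Suc j))"
    have B3: "B3 \<in> carrier_mat m m" by (simp add: B3_def)
    have B3h: "madj B3 = B3"
      by (rule eq_matI) (auto simp: B3_def Bsym[symmetric])
    obtain V a where V: "unitary_mat m V" "B3 = spec m V (\<lambda>i. complex_of_real (a i))"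
      using Suc.IH[OF B3 B3h] by blast
    note VD = unitary_matD[OF V(1)]
    define W where "W = four_block_mat (1\<^sub>m 1) (0\<^sub>m 1 m) (0\<^sub>m m 1) V"
    define b where "b i = (case i of 0 \<Rightarrow> Re e | Suc j \<Rightarrow> a j)" for i
    have W: "unitary_mat ?n W"
      unfolding unitary_mat_def W_def madj_four_block_diag[OF one_carrier_mat VD(1)]
        mult_four_block_diag[OF madj_carrier[OF one_carrier_mat] madj_carrier[OF VD(1)] one_carrier_mat VD(1)]
      using four_block_carrier[OF one_carrier_mat[of 1] VD(1)] one_four_block[of 1 m] VD(2) by simp
    have D: "diagm ?n (\<lambda>i. complex_of_real (b i)) = four_block_mat (diagm 1 (\<lambda>_. e)) (0\<^sub>m 1 m) (0\<^sub>m m 1) (diagm m (\<lambda>i. complex_of_real (a i)))"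
      by (rule eq_matI) (auto simp: four_block_mat_def Let_def b_def e[symmetric] split: nat.splits)
    have "spec ?n W (\<lambda>i. complex_of_real (b i)) = four_block_mat (diagm 1 (\<lambda>_. e)) (0\<^sub>m 1 m) (0\<^sub>m m 1) B3"
      unfolding spec_def D W_def madj_four_block_diag[OF one_carrier_mat VD(1)] V(2)
        mult_four_block_diag[OF one_carrier_mat VD(1) diagm_carrier diagm_carrier]
        mult_four_block_diag[OF mult_square_carrier[OF one_carrier_mat diagm_carrier] mult_square_carrier[OF VD(1) diagm_carrier]
          madj_carrier[OF one_carrier_mat] madj_carrier[OF VD(1)]]
      by simp
    also have "\<dots> = B"
    proof (rule eq_matI)
      fix i j assume "i < dim_row B" "j < dim_col B"
      then have ij: "i < ?n" "j < ?n" using B by auto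
      show "four_block_mat (diagm 1 (\<lambda>_. e)) (0\<^sub>m 1 m) (0\<^sub>m m 1) B3 $$ (i,j) = B $$ (i,j)"
        using ij B0[of i] B0[of j] Bsym[of 0 j] B0[of 0]
        by (cases i; cases j) (auto simp: four_block_mat_def Let_def B3_def)
    qed (use B B3 in \<open>auto simp: four_block_mat_def Let_def\<close>)
    finally have specB: "spec ?n W (\<lambda>i. complex_of_real (b i)) = B" .
    have "A = (U * madj U) * A * (U * madj U)" using A UD by simp
    also have "\<dots> = U * B * madj U" unfolding B_def using A UD(1) cU
      by (simp add: assoc_mult_mat[of _ ?n ?n _ ?n _ ?n] mult_square_carrier)
    also have "\<dots> = spec ?n (U * W) (\<lambda>i. complex_of_real (b i))"
      unfolding specB[symmetric] by (rule spec_conj[OF UD(1) unitary_matD(1)[OF W]])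
    finally show ?case using unitary_mat_mult[OF U(1) W] by blast
  qed
  then show thesis using that by blast
qed

text \<open>The functional calculus does not depend on the diagonalisation. The change of basis W =
  U* V intertwines the two diagonals, so its entry at (i, j) vanishes unless a i = b j; wherever it
  does not vanish, a' i = b' j, and W intertwines the new diagonals as well.\<close>

lemma spec_eq_transfer:
  assumes U: "unitary_mat n U" and V: "unitary_mat n V" and eq: "spec n U a = spec n V b"
    and imp: "\<And>i j. i < n \<Longrightarrow> j < n \<Longrightarrow> a i = b j \<Longrightarrow> a' i = b' j"
  shows "spec n U a' = spec n V b'"
proof -
  note UD = unitary_matD[OF U] and VD = unitary_matD[OF V]
  note c = UD(1) VD(1) madj_carrier[OF UD(1)] madj_carrier[OF VD(1)]
  note sq = mult_square_carrier assoc_mult_mat[of _ n n _ n _ n]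
  define W where "W = madj U * V"
  have W: "W \<in> carrier_mat n n" unfolding W_def using c by (simp add: sq)
  have cancel: "madj U * (U * X) = X" "U * (madj U * X) = X" "madj V * (V * X) = X" "V * (madj V * X) = X" if "X \<in> carrier_mat n n" for X
    using that UD VD c assoc_mult_mat[of "madj U" n n U n X n] assoc_mult_mat[of U n n "madj U" n X n]
      assoc_mult_mat[of "madj V" n n V n X n] assoc_mult_mat[of V n n "madj V" n X n] by simp_all
  have "madj U * spec n U a * V = madj U * spec n V b * V" by (simp only: eq)
  then have DW: "diagm n a * W = W * diagm n b"
    unfolding spec_def W_def using c VD(2) by (simp add: sq cancel)
  have DW': "diagm n a' * W = W * diagm n b'"
  proof (rule eq_matI)
    fix i j assume "i < dim_row (W * diagm n b')" "j < dim_col (W * diagm n b')"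
    then have ij: "i < n" "j < n" using W by auto
    have l: "(diagm n x * W) $$ (i,j) = x i * W $$ (i,j)" for x
    proof -
      have "(diagm n x * W) $$ (i,j) = (\<Sum>l<n. diagm n x $$ (i,l) * W $$ (l,j))"
        by (rule mult_index) (use W ij in auto)
      also have "\<dots> = (\<Sum>l<n. if l = i then x i * W $$ (i,j) else 0)"
        using ij by (intro sum.cong) auto
      finally show ?thesis using ij by simp
    qed
    have r: "(W * diagm n x) $$ (i,j) = x j * W $$ (i,j)" for x
    proof -
      have "(W * diagm n x) $$ (i,j) = (\<Sum>l<n. W $$ (i,l) * diagm n x $$ (l,j))"
        by (rule mult_index) (use W ij in auto)
      also have "\<dots> = (\<Sum>l<n. if l = j then x j * W $$ (i,j) else 0)"
        using ij by (intro sum.cong) auto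
      finally show ?thesis using ij by simp
    qed
    have "a i * W $$ (i,j) = b j * W $$ (i,j)"
      by (rule trans[OF l[of a, symmetric, unfolded DW] r[of b]])
    then have "W $$ (i,j) = 0 \<or> a i = b j" by auto
    then show "(diagm n a' * W) $$ (i,j) = (W * diagm n b') $$ (i,j)"
      using imp[OF ij] unfolding l r by auto
  qed (use W in auto)
  have "spec n U a' = U * (diagm n a' * W) * madj V"
    unfolding spec_def W_def using c VD(3) by (simp add: sq)
  also have "\<dots> = spec n V b'"
    unfolding DW' unfolding spec_def W_def using c by (simp add: sq cancel)
  finally show ?thesis .
qed

section \<open>Exponential, logarithm and inverse in an eigenbasis\<close>

lemma spec_power:
  assumes "unitary_mat n U"
  shows "spec n U c ^\<^sub>m k = spec n U (\<lambda>i. c i ^ k)"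
proof (induction k)
  case 0
  show ?case using spec_one[OF assms] unitary_matD(1)[OF assms] by simp
next
  case (Suc k)
  then show ?case by (simp add: spec_mult[OF assms] mult.commute)
qed

lemma mexp_spec:
  assumes U: "unitary_mat n U"
  shows "mexp (spec n U c) = spec n U (\<lambda>i. exp (c i))"
proof (rule eq_matI)
  note c = unitary_matD(1)[OF U]
  fix i j assume "i < dim_row (spec n U (\<lambda>i. exp (c i)))" "j < dim_col (spec n U (\<lambda>i. exp (c i)))"
  then have ij: "i < n" "j < n" using c by auto
  have "(\<lambda>k. \<Sum>p<n. U $$ (i,p) * (c p ^ k /\<^sub>R fact k) * cnj (U $$ (j,p))) sums (\<Sum>p<n. U $$ (i,p) * exp (c p) * cnj (U $$ (j,p)))"
    by (intro sums_sum sums_mult sums_mult2 exp_converges)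
  moreover have "(\<Sum>p<n. U $$ (i,p) * (c p ^ k /\<^sub>R fact k) * cnj (U $$ (j,p))) = (spec n U c ^\<^sub>m k) $$ (i,j) / of_nat (fact k)" for k
    unfolding spec_power[OF U] spec_index[OF c ij] sum_divide_distrib
    by (intro sum.cong) (auto simp: scaleR_conv_of_real field_simps)
  ultimately show "mexp (spec n U c) $$ (i,j) = spec n U (\<lambda>i. exp (c i)) $$ (i,j)"
    using ij c by (simp add: mexp_def sums_iff spec_index[OF c ij])
qed (auto simp: mexp_def)

text \<open>The description in \<open>mlog\<close> needs uniqueness: any Hermitian logarithm can be
  diagonalised, exp is injective on the reals, and \<open>spec_eq_transfer\<close> compares the two
  eigenbases.\<close>

lemma mlog_spec:
  assumes U: "unitary_mat n U" and a: "\<And>i. i < n \<Longrightarrow> a i > 0"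
  shows "mlog (spec n U (\<lambda>i. complex_of_real (a i))) = spec n U (\<lambda>i. complex_of_real (ln (a i)))"
proof -
  let ?A = "spec n U (\<lambda>i. complex_of_real (a i))" and ?L = "spec n U (\<lambda>i. complex_of_real (ln (a i)))"
  note c = unitary_matD(1)[OF U]
  have dim: "dim_row ?A = n" using c by auto
  have eL: "mexp ?L = ?A"
    unfolding mexp_spec[OF U] by (rule spec_cong) (simp add: a exp_of_real)
  show ?thesis unfolding mlog_def dim
  proof (rule the_equality)
    show "?L \<in> carrier_mat n n \<and> hermitian_mat ?L \<and> mexp ?L = ?A"
      using spec_carrier[OF c] eL by (auto simp: hermitian_mat_def spec_adj[OF c])
  next
    fix L assume L: "L \<in> carrier_mat n n \<and> hermitian_mat L \<and> mexp L = ?A"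
    then obtain V l where V: "unitary_mat n V" "L = spec n V (\<lambda>i. complex_of_real (l i))"
      using hermitian_spectral[of L n] by (auto simp: hermitian_mat_def)
    have "spec n V (\<lambda>i. exp (complex_of_real (l i))) = ?A"
      using L V mexp_spec[OF V(1)] by simp
    then show "L = ?L" unfolding V(2)
    proof (rule spec_eq_transfer[OF V(1) U])
      fix i j assume "exp (complex_of_real (l i)) = complex_of_real (a j)"
      then have "exp (l i) = a j" by (metis exp_of_real of_real_eq_iff)
      then show "complex_of_real (l i) = complex_of_real (ln (a j))" by (metis ln_exp)
    qed
  qed
qed

lemma minv_spec:
  assumes U: "unitary_mat n U" and a: "\<And>i. i < n \<Longrightarrow> a i \<noteq> 0"
  shows "minv (spec n U a) = spec n U (\<lambda>i. 1 / a i)"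
proof -
  let ?A = "spec n U a" and ?B = "spec n U (\<lambda>i. 1 / a i)"
  note c = unitary_matD(1)[OF U]
  have A: "?A \<in> carrier_mat n n" and B: "?B \<in> carrier_mat n n" using spec_carrier[OF c] by auto
  then have dim: "dim_row ?A = n" by auto
  have AB: "?A * ?B = 1\<^sub>m n" "?B * ?A = 1\<^sub>m n"
    unfolding spec_mult[OF U] spec_one[OF U, symmetric] by (rule spec_cong, simp add: a)+
  show ?thesis unfolding minv_def dim
  proof (rule the_equality)
    show "?B \<in> carrier_mat n n \<and> ?A * ?B = 1\<^sub>m n \<and> ?B * ?A = 1\<^sub>m n" using B AB by blast
  next
    fix X assume "X \<in> carrier_mat n n \<and> ?A * X = 1\<^sub>m n \<and> X * ?A = 1\<^sub>m n"
    then have X: "X \<in> carrier_mat n n" "X * ?A = 1\<^sub>m n" by auto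
    then have "X = X * (?A * ?B)" unfolding AB(1) by (metis right_mult_one_mat)
    also have "\<dots> = (X * ?A) * ?B" by (rule assoc_mult_mat[OF X(1) A B, symmetric])
    also have "\<dots> = ?B" unfolding X(2) by (rule left_mult_one_mat[OF B])
    finally show "X = ?B" .
  qed
qed

text \<open>The quadratic form evaluated at column k of \<open>U\<close> is the eigenvalue
  \<open>a k\<close>.\<close>

lemma pos_def_spectral:
  assumes "A \<in> carrier_mat n n" "pos_def_mat A"
  obtains U a where "unitary_mat n U" "\<And>i. i < n \<Longrightarrow> a i > 0" "A = spec n U (\<lambda>i. complex_of_real (a i))"
proof -
  obtain U a where U: "unitary_mat n U" and A: "A = spec n U (\<lambda>i. complex_of_real (a i))"
    using hermitian_spectral[of A n] assms by (auto simp: pos_def_mat_def hermitian_mat_def)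
  note UD = unitary_matD[OF U]
  have "a k > 0" if k: "k < n" for k
  proof -
    define v where "v = col U k"
    have v: "v \<in> carrier_vec n" using UD(1) k by (simp add: v_def)
    have UU: "(\<Sum>l<n. cnj (U $$ (l,i)) * U $$ (l,j)) = (if i = j then 1 else 0)" if "i < n" "j < n" for i j
      using mult_index[OF madj_carrier[OF UD(1)] UD(1) that] UD that by simp
    have Av: "(A *\<^sub>v v) $ i = of_real (a k) * U $$ (i,k)" if i: "i < n" for i
    proof -
      have "(A *\<^sub>v v) $ i = (\<Sum>l<n. A $$ (i,l) * U $$ (l,k))"
        using assms(1) v i UD(1) k by (auto simp: scalar_prod_def lessThan_atLeast0 v_def intro!: sum.cong)
      also have "\<dots> = (\<Sum>l<n. \<Sum>p<n. U $$ (i,p) * of_real (a p) * (cnj (U $$ (l,p)) * U $$ (l,k)))"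
        using i by (intro sum.cong) (auto simp: A spec_index[OF UD(1)] sum_distrib_right mult.assoc)
      also have "\<dots> = (\<Sum>p<n. U $$ (i,p) * of_real (a p) * (if p = k then 1 else 0))"
        by (subst sum.swap) (auto simp: sum_distrib_left[symmetric] UU k intro!: sum.cong)
      also have "\<dots> = (\<Sum>p<n. if p = k then U $$ (i,k) * of_real (a k) else 0)"
        by (intro sum.cong) auto
      finally show ?thesis using k by simp
    qed
    have "v \<noteq> 0\<^sub>v n"
    proof
      assume "v = 0\<^sub>v n"
      then have "U $$ (l,k) = 0" if "l < n" for l
        using that k UD(1) by (metis carrier_matD index_col index_zero_vec(1) v_def)
      then show False using UU[OF k k] by simp
    qed
    then have "0 < map_vec cnj v \<bullet> (A *\<^sub>v v)"
      using assms v by (auto simp: pos_def_mat_def)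
    also have "map_vec cnj v \<bullet> (A *\<^sub>v v) = (\<Sum>l<n. cnj (U $$ (l,k)) * (of_real (a k) * U $$ (l,k)))"
      using assms(1) v UD(1) k by (auto simp: scalar_prod_def lessThan_atLeast0 Av[symmetric] v_def intro!: sum.cong)
    also have "\<dots> = of_real (a k)"
      using UU[OF k k] by (simp add: mult.left_commute sum_distrib_left[symmetric])
    finally show ?thesis by (simp add: less_complex_def)
  qed
  then show thesis using that U A by blast
qed

lemma mtrace_mult_comm:
  assumes "A \<in> carrier_mat m n" "B \<in> carrier_mat n m"
  shows "mtrace (A * B) = mtrace (B * A)"
proof -
  have "mtrace (A * B) = (\<Sum>i<m. \<Sum>j<n. A $$ (i,j) * B $$ (j,i))"
    using assms by (auto simp: mtrace_def mult_index[OF assms] simp del: index_mult_mat(1) intro!: sum.cong)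
  also have "\<dots> = (\<Sum>j<n. \<Sum>i<m. B $$ (j,i) * A $$ (i,j))"
    by (subst sum.swap) (simp add: mult.commute)
  also have "\<dots> = mtrace (B * A)"
    using assms by (auto simp: mtrace_def mult_index[OF assms(2,1)] simp del: index_mult_mat(1) intro!: sum.cong)
  finally show ?thesis .
qed

lemma mtrace_spec:
  assumes "unitary_mat n U"
  shows "mtrace (spec n U c) = (\<Sum>i<n. c i)"
proof -
  note U = unitary_matD[OF assms]
  have "mtrace (spec n U c) = mtrace (madj U * (U * diagm n c))"
    unfolding spec_def by (rule mtrace_mult_comm) (use U in auto)
  also have "madj U * (U * diagm n c) = (madj U * U) * diagm n c"
    using U(1) madj_carrier[OF U(1)] by (simp add: assoc_mult_mat[of _ n n _ n _ n])
  finally show ?thesis using U by (simp add: mtrace_def)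
qed

section \<open>The derivative of the logarithm as an average of complex powers\<close>

text \<open>In the eigenbasis the two outer factors multiply the entry (p, q) of W* Y W by c p * c'
  q. Both the resolvent integral and the complex powers thereby reduce to scalar statements about
  multipliers.\<close>

lemma spec_sandwich_index:
  assumes W: "W \<in> carrier_mat n n" and Y: "Y \<in> carrier_mat n n" and ij: "i < n" "j < n"
  shows "(spec n W c * Y * spec n W c') $$ (i,j) =
    (\<Sum>p<n. \<Sum>q<n. W $$ (i,p) * (madj W * Y * W) $$ (p,q) * cnj (W $$ (j,q)) * (c p * c' q))"
proof -
  note cs = W Y madj_carrier[OF W] diagm_carrier
  define K where "K = madj W * Y * W"
  have K: "K \<in> carrier_mat n n" unfolding K_def using cs by (simp add: mult_square_carrier)
  have "spec n W c * Y * spec n W c' = W * diagm n c * (K * diagm n c' * madj W)"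
    unfolding spec_def K_def using cs by (simp add: assoc_mult_mat[of _ n n _ n _ n] mult_square_carrier)
  also have "\<dots> $$ (i,j) = (\<Sum>p<n. (W * diagm n c) $$ (i,p) * (K * diagm n c' * madj W) $$ (p,j))"
    by (rule mult_index) (use cs K ij in auto)
  also have "\<dots> = (\<Sum>p<n. W $$ (i,p) * c p * (\<Sum>q<n. K $$ (p,q) * c' q * cnj (W $$ (j,q))))"
  proof (intro sum.cong refl arg_cong2[of _ _ _ _ "(*)"])
    have diag: "(X * diagm n x) $$ (k,l) = X $$ (k,l) * x l" if X: "X \<in> carrier_mat n n" "k < n" "l < n" for X x k l
    proof -
      have "(X * diagm n x) $$ (k,l) = (\<Sum>m<n. X $$ (k,m) * diagm n x $$ (m,l))"
        by (rule mult_index) (use that in auto)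
      also have "\<dots> = (\<Sum>m<n. if m = l then X $$ (k,l) * x l else 0)"
        using that by (intro sum.cong) auto
      finally show ?thesis using that by simp
    qed
    fix p assume "p \<in> {..<n}"
    then have p: "p < n" by simp
    show "(W * diagm n c) $$ (i,p) = W $$ (i,p) * c p" by (rule diag) (use W p ij in auto)
    have "(K * diagm n c' * madj W) $$ (p,j) = (\<Sum>q<n. (K * diagm n c') $$ (p,q) * madj W $$ (q,j))"
      by (rule mult_index) (use cs K ij p in auto)
    also have "\<dots> = (\<Sum>q<n. K $$ (p,q) * c' q * cnj (W $$ (j,q)))"
      using W ij p by (intro sum.cong) (auto simp: diag[OF K] simp del: index_mult_mat(1))
    finally show "(K * diagm n c' * madj W) $$ (p,j) = (\<Sum>q<n. K $$ (p,q) * c' q * cnj (W $$ (j,q)))" .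
  qed
  finally show ?thesis by (simp add: sum_distrib_left mult_ac K_def del: index_mult_mat(1))
qed

lemma mtrace_mult:
  assumes "P \<in> carrier_mat n n" "Z \<in> carrier_mat n n"
  shows "mtrace (P * Z) = (\<Sum>i<n. \<Sum>l<n. P $$ (i,l) * Z $$ (l,i))"
  using assms by (auto simp: mtrace_def mult_index[OF assms] simp del: index_mult_mat(1) intro!: sum.cong)

text \<open>Collects everything independent of the multiplier \<open>m\<close> into one coefficient
  per pair (p, q), so that two operators with different multipliers can be compared multiplier by
  multiplier.\<close>

lemma mtrace_mult_kernel:
  assumes P: "P \<in> carrier_mat n n" and Z: "Z \<in> carrier_mat n n"
    and idx: "\<And>i j. i < n \<Longrightarrow> j < n \<Longrightarrow> Z $$ (i,j) = (\<Sum>p<n. \<Sum>q<n. k i j p q * m p q)"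
  shows "mtrace (P * Z) = (\<Sum>p<n. \<Sum>q<n. (\<Sum>i<n. \<Sum>l<n. P $$ (i,l) * k l i p q) * m p q)"
proof -
  have "mtrace (P * Z) = (\<Sum>i<n. \<Sum>l<n. \<Sum>p<n. \<Sum>q<n. P $$ (i,l) * k l i p q * m p q)"
    unfolding mtrace_mult[OF P Z] by (intro sum.cong refl) (simp add: idx sum_distrib_left mult.assoc)
  also have "\<dots> = (\<Sum>i<n. \<Sum>p<n. \<Sum>l<n. \<Sum>q<n. P $$ (i,l) * k l i p q * m p q)"
    by (intro sum.cong refl sum.swap)
  also have "\<dots> = (\<Sum>p<n. \<Sum>i<n. \<Sum>l<n. \<Sum>q<n. P $$ (i,l) * k l i p q * m p q)"
    by (rule sum.swap)
  also have "\<dots> = (\<Sum>p<n. \<Sum>i<n. \<Sum>q<n. \<Sum>l<n. P $$ (i,l) * k l i p q * m p q)"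
    by (intro sum.cong refl sum.swap)
  also have "\<dots> = (\<Sum>p<n. \<Sum>q<n. \<Sum>i<n. \<Sum>l<n. P $$ (i,l) * k l i p q * m p q)"
    by (intro sum.cong refl sum.swap)
  finally show ?thesis by (simp add: sum_distrib_right)
qed

text \<open>The resolvents have the multiplier 1 / ((w p + \<tau>) (w q + \<tau>)), and the integral
  passes through the finite sums.\<close>

lemma Tder_spec_index:
  assumes W: "unitary_mat n W" and w: "\<And>i. i < n \<Longrightarrow> w i > 0" and Y: "Y \<in> carrier_mat n n"
    and ij: "i < n" "j < n"
  shows "Tder (spec n W (\<lambda>i. complex_of_real (w i))) Y $$ (i,j) =
    (\<Sum>p<n. \<Sum>q<n. W $$ (i,p) * (madj W * Y * W) $$ (p,q) * cnj (W $$ (j,q)) * of_real (log_mean_inv (w p) (w q)))"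
proof -
  note WD = unitary_matD[OF W]
  let ?X = "spec n W (\<lambda>i. complex_of_real (w i))"
  let ?k = "\<lambda>p q. W $$ (i,p) * (madj W * Y * W) $$ (p,q) * cnj (W $$ (j,q))"
  have shift: "minv (?X + of_real \<tau> \<cdot>\<^sub>m 1\<^sub>m n) = spec n W (\<lambda>i. complex_of_real (1 / (w i + \<tau>)))" if "\<tau> \<ge> 0" for \<tau>
  proof -
    have "?X + of_real \<tau> \<cdot>\<^sub>m 1\<^sub>m n = spec n W (\<lambda>i. complex_of_real (w i)) + of_real \<tau> \<cdot>\<^sub>m spec n W (\<lambda>_. 1)"
      by (simp add: spec_one[OF W])
    also have "\<dots> = spec n W (\<lambda>i. complex_of_real (w i + \<tau>))"
    proof (rule eq_matI)
      fix i j assume "i < dim_row (spec n W (\<lambda>i. complex_of_real (w i + \<tau>)))" "j < dim_col (spec n W (\<lambda>i. complex_of_real (w i + \<tau>)))"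
      then have ij: "i < n" "j < n" using WD(1) by auto
      have "(\<Sum>k<n. W $$ (i,k) * of_real (w k) * cnj (W $$ (j,k))) + of_real \<tau> * (\<Sum>k<n. W $$ (i,k) * 1 * cnj (W $$ (j,k)))
          = (\<Sum>k<n. W $$ (i,k) * of_real (w k + \<tau>) * cnj (W $$ (j,k)))"
        unfolding sum_distrib_left sum.distrib[symmetric] by (intro sum.cong refl) (simp add: algebra_simps)
      then show "(spec n W (\<lambda>i. complex_of_real (w i)) + complex_of_real \<tau> \<cdot>\<^sub>m spec n W (\<lambda>_. 1)) $$ (i,j)
          = spec n W (\<lambda>i. complex_of_real (w i + \<tau>)) $$ (i,j)"
        using ij WD(1) by (simp only: index_add_mat index_smult_mat spec_dim spec_index[OF WD(1) ij] carrier_matD)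
    qed (use WD(1) in auto)
    finally show ?thesis
      using minv_spec[OF W, of "\<lambda>i. complex_of_real (w i + \<tau>)"] w that
      by (simp add: add_pos_nonneg less_imp_neq[THEN not_sym] flip: of_real_add)
  qed
  have "((\<lambda>\<tau>. \<Sum>p<n. \<Sum>q<n. ?k p q * of_real (1 / ((w p + \<tau>) * (w q + \<tau>)))) has_integral
      (\<Sum>p<n. \<Sum>q<n. ?k p q * of_real (log_mean_inv (w p) (w q)))) {0..}"
    by (intro has_integral_sum has_integral_mult_right
        has_integral_linear[OF resolvent_integral bounded_linear_of_real, unfolded o_def])
       (auto simp: w)
  then have I: "integral {0..} (\<lambda>\<tau>. \<Sum>p<n. \<Sum>q<n. ?k p q * of_real (1 / ((w p + \<tau>) * (w q + \<tau>)))) =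
      (\<Sum>p<n. \<Sum>q<n. ?k p q * of_real (log_mean_inv (w p) (w q)))"
    by (rule integral_unique)
  have "Tder ?X Y $$ (i,j) = integral {0..} (\<lambda>\<tau>. (minv (?X + of_real \<tau> \<cdot>\<^sub>m 1\<^sub>m n) * Y * minv (?X + of_real \<tau> \<cdot>\<^sub>m 1\<^sub>m n)) $$ (i,j))"
    using ij WD(1) by (simp add: Tder_def del: index_mult_mat(1))
  also have "\<dots> = integral {0..} (\<lambda>\<tau>. \<Sum>p<n. \<Sum>q<n. ?k p q * of_real (1 / ((w p + \<tau>) * (w q + \<tau>))))"
    by (rule Henstock_Kurzweil_Integration.integral_cong)
       (simp add: shift spec_sandwich_index[OF WD(1) Y ij] del: index_mult_mat(1))
  finally show ?thesis unfolding I .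
qed

text \<open>Write a = exp (m - x) and b = exp (m + x) with m the mean of the logarithms; then b - a
  = 2 exp m sinh x and ln b - ln a = 2 x.\<close>

lemma log_mean_inv_eq:
  fixes a b :: real
  assumes "a > 0" "b > 0"
  defines "x \<equiv> (ln b - ln a) / 2"
  shows "exp (- (ln a + ln b) / 2) * (if x = 0 then 1 else x / sinh x) = log_mean_inv a b"
proof (cases "a = b")
  case True
  then show ?thesis using assms by (simp add: x_def log_mean_inv_def exp_minus field_simps)
next
  case False
  then have x: "x \<noteq> 0" using assms by (simp add: x_def)
  have x2: "2 * x = ln b - ln a" by (simp add: x_def)
  have e: "exp ((ln a + ln b) / 2) * (2 * sinh x) = b - a"
  proof -
    have "exp m * (2 * sinh x) = exp (m + x) - exp (m - x)" for m
      by (simp add: sinh_field_def exp_add exp_diff exp_minus field_simps)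
    from this[of "(ln a + ln b) / 2"]
    have "exp ((ln a + ln b) / 2) * (2 * sinh x) = exp ((ln a + ln b) / 2 + x) - exp ((ln a + ln b) / 2 - x)" .
    also have "(ln a + ln b) / 2 + x = ln b" by (simp add: x_def field_simps)
    also have "(ln a + ln b) / 2 - x = ln a" by (simp add: x_def field_simps)
    finally show ?thesis using assms by simp
  qed
  have "inverse E * (x / s) = 2 * x / (E * (2 * s))" for E s :: real
    by (simp add: field_simps)
  then have "exp (- (ln a + ln b) / 2) * (x / sinh x) = 2 * x / (exp ((ln a + ln b) / 2) * (2 * sinh x))"
    unfolding minus_divide_left[symmetric] exp_minus by blast
  also have "\<dots> = (ln b - ln a) / (b - a)" unfolding e x2 ..
  also have "\<dots> = log_mean_inv a b" using False minus_divide_divide[of "ln a - ln b" "a - b"] by (simp add: log_mean_inv_def)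
  finally show ?thesis using x by simp
qed

text \<open>\<open>M t\<close> is X to the power -(1 + i t)/2, where X is the matrix with
  eigenvalues \<open>w\<close>. Conjugating by it has the multiplier \<open>e p q\<close> * exp (i *
  \<open>x p q\<close> * t); averaging with \<open>\<beta>\<^sub>0_fourier\<close> turns this into
  \<open>log_mean_inv\<close>. Pairing with a fixed \<open>P\<close> makes every limit one of
  numbers.\<close>

lemma Tder_spec_limit:
  fixes w :: "nat \<Rightarrow> real"
  assumes W: "unitary_mat n W" and w: "\<And>i. i < n \<Longrightarrow> w i > 0"
    and Y: "Y \<in> carrier_mat n n" and P: "P \<in> carrier_mat n n"
  defines "M \<equiv> \<lambda>t::real. spec n W (\<lambda>i. exp (- (1 + \<i> * of_real t) / 2 * of_real (ln (w i))))"
  shows "((\<lambda>R. integral {-R..R} (\<lambda>t. mtrace (P * (M t * Y * madj (M t))) * of_real (\<beta>\<^sub>0 t))) \<longlongrightarrow>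
      mtrace (P * Tder (spec n W (\<lambda>i. complex_of_real (w i))) Y)) at_top"
proof -
  note WD = unitary_matD[OF W]
  define k where "k i j p q = W $$ (i,p) * (madj W * Y * W) $$ (p,q) * cnj (W $$ (j,q))" for i j p q
  define C where "C p q = (\<Sum>i<n. \<Sum>l<n. P $$ (i,l) * k l i p q)" for p q
  define x where "x p q = (ln (w q) - ln (w p)) / 2" for p q
  define e where "e p q = exp (- (ln (w p) + ln (w q)) / 2)" for p q
  have T: "mtrace (P * Tder (spec n W (\<lambda>i. complex_of_real (w i))) Y) = (\<Sum>p<n. \<Sum>q<n. C p q * of_real (log_mean_inv (w p) (w q)))"
    unfolding C_def
  proof (rule mtrace_mult_kernel[OF P])
    show "Tder (spec n W (\<lambda>i. complex_of_real (w i))) Y \<in> carrier_mat n n" using WD(1) by (simp add: Tder_def)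
    show "Tder (spec n W (\<lambda>i. complex_of_real (w i))) Y $$ (i,j) = (\<Sum>p<n. \<Sum>q<n. k i j p q * of_real (log_mean_inv (w p) (w q)))"
      if "i < n" "j < n" for i j
      using Tder_spec_index[OF W w Y that] by (simp only: k_def)
  qed
  have M: "mtrace (P * (M t * Y * madj (M t))) = (\<Sum>p<n. \<Sum>q<n. C p q * (of_real (e p q) * exp (\<i> * of_real (x p q * t))))" for t
    unfolding C_def
  proof (rule mtrace_mult_kernel[OF P])
    show "M t * Y * madj (M t) \<in> carrier_mat n n" using WD(1) Y by (auto simp: M_def)
    fix i j assume ij: "i < n" "j < n"
    have "exp (- (1 + \<i> * of_real t) / 2 * of_real (ln (w p))) * cnj (exp (- (1 + \<i> * of_real t) / 2 * of_real (ln (w q))))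
        = of_real (e p q) * exp (\<i> * of_real (x p q * t))" for p q
      unfolding e_def x_def exp_cnj exp_of_real[symmetric] exp_add[symmetric]
      by (rule arg_cong[of _ _ exp]) (simp add: complex_eq_iff field_simps)
    then show "(M t * Y * madj (M t)) $$ (i,j) = (\<Sum>p<n. \<Sum>q<n. k i j p q * (of_real (e p q) * exp (\<i> * of_real (x p q * t))))"
      unfolding M_def spec_adj[OF WD(1)] spec_sandwich_index[OF WD(1) Y ij] k_def by simp
  qed
  have ik: "(\<lambda>t. exp (\<i> * of_real (x p q * t)) * of_real (\<beta>\<^sub>0 t)) integrable_on {-R..R}" for p q R
    by (intro integrable_continuous_interval continuous_intros)
  have I: "integral {-R..R} (\<lambda>t. mtrace (P * (M t * Y * madj (M t))) * of_real (\<beta>\<^sub>0 t)) =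
     (\<Sum>p<n. \<Sum>q<n. (C p q * of_real (e p q)) * integral {-R..R} (\<lambda>t. exp (\<i> * of_real (x p q * t)) * of_real (\<beta>\<^sub>0 t)))" for R
  proof -
    have "integral {-R..R} (\<lambda>t. mtrace (P * (M t * Y * madj (M t))) * of_real (\<beta>\<^sub>0 t)) =
      integral {-R..R} (\<lambda>t. \<Sum>p<n. \<Sum>q<n. (C p q * of_real (e p q)) * (exp (\<i> * of_real (x p q * t)) * of_real (\<beta>\<^sub>0 t)))"
      unfolding M by (simp add: sum_distrib_right mult.assoc)
    also have "\<dots> = (\<Sum>p<n. \<Sum>q<n. (C p q * of_real (e p q)) * integral {-R..R} (\<lambda>t. exp (\<i> * of_real (x p q * t)) * of_real (\<beta>\<^sub>0 t)))"
      by (intro integral_unique has_integral_sum has_integral_mult_right integrable_integral ik) auto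
    finally show ?thesis .
  qed
  have "((\<lambda>R. \<Sum>p<n. \<Sum>q<n. (C p q * of_real (e p q)) * integral {-R..R} (\<lambda>t. exp (\<i> * of_real (x p q * t)) * of_real (\<beta>\<^sub>0 t)))
      \<longlongrightarrow> (\<Sum>p<n. \<Sum>q<n. (C p q * of_real (e p q)) * of_real (if x p q = 0 then 1 else x p q / sinh (x p q)))) at_top"
    by (intro tendsto_intros \<beta>\<^sub>0_fourier)
  also have "(\<Sum>p<n. \<Sum>q<n. (C p q * of_real (e p q)) * of_real (if x p q = 0 then 1 else x p q / sinh (x p q)))
      = (\<Sum>p<n. \<Sum>q<n. C p q * of_real (log_mean_inv (w p) (w q)))"
  proof (intro sum.cong refl)
    fix p q assume "p \<in> {..<n}" "q \<in> {..<n}"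
    then show "(C p q * of_real (e p q)) * of_real (if x p q = 0 then 1 else x p q / sinh (x p q)) = C p q * of_real (log_mean_inv (w p) (w q))"
      using log_mean_inv_eq[of "w p" "w q"] w unfolding e_def x_def mult.assoc of_real_mult[symmetric] by simp
  qed
  finally show ?thesis unfolding I T .
qed

section \<open>Multivariate Golden--Thompson inequality\<close>

text \<open>Closed under sums and products, so it passes from scalar exponentials to entries of
  matrix products and to traces.\<close>

definition strip_bounded :: "(complex \<Rightarrow> complex) \<Rightarrow> bool" where
  "strip_bounded f \<longleftrightarrow> f holomorphic_on UNIV \<and> (\<exists>C. \<forall>z. 0 \<le> Re z \<longrightarrow> Re z \<le> 1 \<longrightarrow> norm (f z) \<le> C)"

lemma strip_bounded_const: "strip_bounded (\<lambda>_. c)"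
  unfolding strip_bounded_def by (intro conjI holomorphic_intros exI[of _ "norm c"]) auto

lemma strip_bounded_add:
  assumes "strip_bounded f" "strip_bounded g"
  shows "strip_bounded (\<lambda>z. f z + g z)"
proof -
  obtain C D where "\<forall>z. 0 \<le> Re z \<longrightarrow> Re z \<le> 1 \<longrightarrow> norm (f z) \<le> C" "\<forall>z. 0 \<le> Re z \<longrightarrow> Re z \<le> 1 \<longrightarrow> norm (g z) \<le> D"
    using assms by (auto simp: strip_bounded_def)
  then have "\<forall>z. 0 \<le> Re z \<longrightarrow> Re z \<le> 1 \<longrightarrow> norm (f z + g z) \<le> C + D"
    by (meson norm_triangle_mono)
  then show ?thesis using assms unfolding strip_bounded_def by (intro conjI holomorphic_intros) auto
qed

lemma strip_bounded_mult:
  assumes "strip_bounded f" "strip_bounded g"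
  shows "strip_bounded (\<lambda>z. f z * g z)"
proof -
  obtain C D where "\<forall>z. 0 \<le> Re z \<longrightarrow> Re z \<le> 1 \<longrightarrow> norm (f z) \<le> C" "\<forall>z. 0 \<le> Re z \<longrightarrow> Re z \<le> 1 \<longrightarrow> norm (g z) \<le> D"
    using assms by (auto simp: strip_bounded_def)
  then have "\<forall>z. 0 \<le> Re z \<longrightarrow> Re z \<le> 1 \<longrightarrow> norm (f z * g z) \<le> C * D"
    unfolding norm_mult by (meson mult_mono norm_ge_zero order_trans)
  then show ?thesis using assms unfolding strip_bounded_def by (intro conjI holomorphic_intros) auto
qed

lemma strip_bounded_sum:
  "(\<And>i. i \<in> S \<Longrightarrow> strip_bounded (f i)) \<Longrightarrow> strip_bounded (\<lambda>z. \<Sum>i\<in>S. f i z)"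
  by (induction S rule: infinite_finite_induct) (auto intro: strip_bounded_const strip_bounded_add)

lemma strip_bounded_exp: "strip_bounded (\<lambda>z. exp (of_real a + of_real b * z))"
  unfolding strip_bounded_def
proof (intro conjI holomorphic_intros exI[of _ "exp (\<bar>a\<bar> + \<bar>b\<bar>)"] allI impI)
  fix z assume z: "0 \<le> Re z" "Re z \<le> 1"
  have "b * Re z \<le> \<bar>b\<bar> * Re z" using z by (intro mult_right_mono) auto
  also have "\<dots> \<le> \<bar>b\<bar>" using z by (intro mult_left_le) auto
  finally show "norm (exp (of_real a + of_real b * z)) \<le> exp (\<bar>a\<bar> + \<bar>b\<bar>)" by simp
qed

definition frob :: "complex mat \<Rightarrow> real" where
  "frob M = (\<Sum>i<dim_row M. \<Sum>j<dim_col M. (cmod (M $$ (i,j)))\<^sup>2)"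

lemma frob_mtrace:
  "complex_of_real (frob M) = mtrace (M * madj M)"
  unfolding mtrace_def frob_def
  by (simp add: mult_index[of M "dim_row M" "dim_col M" "madj M" "dim_row M"] complex_norm_square del: index_mult_mat(1) of_real_power)

lemma frob_unitary_left:
  assumes "unitary_mat n U" "M \<in> carrier_mat n n"
  shows "frob (U * M) = frob M"
proof -
  note U = unitary_matD[OF assms(1)]
  note c = U(1) madj_carrier[OF U(1)] assms(2) madj_carrier[OF assms(2)]
  have "complex_of_real (frob (U * M)) = mtrace (U * (M * madj M * madj U))"
    unfolding frob_mtrace madj_mult[OF U(1) assms(2)]
    using c by (simp add: assoc_mult_mat[of _ n n _ n _ n] mult_square_carrier)
  also have "\<dots> = mtrace (M * madj M * madj U * U)"
    by (rule mtrace_mult_comm[of _ n n]) (use c in auto)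
  also have "M * madj M * madj U * U = M * madj M * (madj U * U)"
    using c by (simp add: assoc_mult_mat[of _ n n _ n _ n] mult_square_carrier)
  also have "mtrace \<dots> = complex_of_real (frob M)" using c U by (simp add: frob_mtrace)
  finally show ?thesis by simp
qed

lemma frob_unitary_right:
  assumes "unitary_mat n U" "M \<in> carrier_mat n n"
  shows "frob (M * U) = frob M"
proof -
  note U = unitary_matD[OF assms(1)]
  note c = U(1) madj_carrier[OF U(1)] assms(2) madj_carrier[OF assms(2)]
  have "M * U * (madj U * madj M) = M * (U * madj U) * madj M"
    using c by (simp add: assoc_mult_mat[of _ n n _ n _ n] mult_square_carrier)
  also have "\<dots> = M * madj M" using c U by simp
  finally have "complex_of_real (frob (M * U)) = complex_of_real (frob M)"
    unfolding frob_mtrace madj_mult[OF assms(2) U(1)] by simp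
  then show ?thesis by simp
qed

lemma frob_spec:
  assumes "unitary_mat n U"
  shows "frob (spec n U c) = (\<Sum>i<n. (cmod (c i))\<^sup>2)"
proof -
  have "complex_of_real (frob (spec n U c)) = (\<Sum>i<n. complex_of_real ((cmod (c i))\<^sup>2))"
    unfolding frob_mtrace spec_adj[OF unitary_matD(1)[OF assms]] spec_mult[OF assms] mtrace_spec[OF assms]
    by (simp add: cnj_mult_self[symmetric] mult.commute del: of_real_power)
  then show ?thesis unfolding of_real_sum[symmetric] of_real_eq_iff .
qed

lemma mtrace_mult_frob:
  assumes "G \<in> carrier_mat n n" "K \<in> carrier_mat n n"
  shows "(cmod (mtrace (G * K)))\<^sup>2 \<le> frob G * frob K"
proof -
  let ?S = "{..<n} \<times> {..<n}"
  have "cmod (mtrace (G * K)) \<le> (\<Sum>(i,j)\<in>?S. cmod (G $$ (i,j)) * cmod (K $$ (j,i)))"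
    unfolding mtrace_def sum.cartesian_product[symmetric] using assms
    by (auto simp: mult_index[OF assms] norm_mult[symmetric] simp del: index_mult_mat(1)
        intro!: order_trans[OF norm_sum] sum_mono)
  then have "(cmod (mtrace (G * K)))\<^sup>2 \<le> (\<Sum>(i,j)\<in>?S. cmod (G $$ (i,j)) * cmod (K $$ (j,i)))\<^sup>2"
    by (rule power_mono) simp
  also have "\<dots> \<le> (\<Sum>(i,j)\<in>?S. (cmod (G $$ (i,j)))\<^sup>2) * (\<Sum>(i,j)\<in>?S. (cmod (K $$ (j,i)))\<^sup>2)"
    using Cauchy_Schwarz_ineq_sum[of "\<lambda>(i,j). cmod (G $$ (i,j))" "\<lambda>(i,j). cmod (K $$ (j,i))" ?S]
    by (simp add: case_prod_unfold)
  also have "(\<Sum>(i,j)\<in>?S. (cmod (G $$ (i,j)))\<^sup>2) = frob G"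
    using assms by (simp add: frob_def sum.cartesian_product)
  also have "(\<Sum>(i,j)\<in>?S. (cmod (K $$ (j,i)))\<^sup>2) = frob K"
    using assms unfolding frob_def sum.cartesian_product[symmetric] by (subst sum.swap) simp
  finally show ?thesis .
qed

lemma unitary_entry_le_1:
  assumes "unitary_mat n U" "i < n" "j < n"
  shows "cmod (U $$ (i,j)) \<le> 1"
proof -
  note U = unitary_matD[OF assms(1)]
  have "(\<Sum>l<n. complex_of_real ((cmod (U $$ (l,j)))\<^sup>2)) = (madj U * U) $$ (j,j)"
    using mult_index[OF madj_carrier[OF U(1)] U(1) assms(3,3)] U(1) assms
    by (simp add: cnj_mult_self del: index_mult_mat(1))
  then have "complex_of_real (\<Sum>l<n. (cmod (U $$ (l,j)))\<^sup>2) = 1" using U assms by simp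
  then have "(\<Sum>l<n. (cmod (U $$ (l,j)))\<^sup>2) = 1" by (metis of_real_eq_1_iff)
  moreover have "(cmod (U $$ (i,j)))\<^sup>2 \<le> (\<Sum>l<n. (cmod (U $$ (l,j)))\<^sup>2)"
    by (rule member_le_sum) (use assms in auto)
  ultimately show ?thesis by (simp add: power_le_one_iff abs_square_le_1)
qed

text \<open>In the basis \<open>V\<close> the trace is the sum of T_ii * c i with T unitary, and the
  entries of a unitary matrix have modulus at most 1.\<close>

lemma mtrace_unitary_spec_le:
  assumes "unitary_mat n U" "unitary_mat n V"
  shows "cmod (mtrace (U * spec n V c)) \<le> (\<Sum>i<n. cmod (c i))"
proof -
  note UD = unitary_matD[OF assms(1)] and VD = unitary_matD[OF assms(2)]
  note cs = UD(1) VD(1) madj_carrier[OF VD(1)]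
  define T where "T = madj V * U * V"
  have T: "unitary_mat n T" unfolding T_def by (intro unitary_mat_mult unitary_mat_adj assms)
  have "mtrace (U * spec n V c) = mtrace (U * V * diagm n c * madj V)"
    unfolding spec_def using cs by (simp add: assoc_mult_mat[of _ n n _ n _ n] mult_square_carrier)
  also have "\<dots> = mtrace (madj V * (U * V * diagm n c))"
    by (rule mtrace_mult_comm[of _ n n]) (use cs in auto)
  also have "madj V * (U * V * diagm n c) = T * diagm n c"
    unfolding T_def using cs by (simp add: assoc_mult_mat[of _ n n _ n _ n] mult_square_carrier)
  also have "mtrace (T * diagm n c) = (\<Sum>i<n. T $$ (i,i) * c i)"
    unfolding mtrace_mult[OF unitary_matD(1)[OF T] diagm_carrier]
  proof (rule sum.cong[OF refl])
    fix i assume i: "i \<in> {..<n}"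
    have "(\<Sum>l<n. T $$ (i,l) * diagm n c $$ (l,i)) = (\<Sum>l<n. if l = i then T $$ (i,i) * c i else 0)"
      using i by (intro sum.cong) auto
    then show "(\<Sum>l<n. T $$ (i,l) * diagm n c $$ (l,i)) = T $$ (i,i) * c i" using i by simp
  qed
  also have "cmod \<dots> \<le> (\<Sum>i<n. cmod (c i))"
    by (rule sum_norm_le)
       (use unitary_entry_le_1[OF T] in \<open>auto simp: norm_mult intro!: mult_left_le_one_le\<close>)
  finally show ?thesis .
qed

text \<open>A Hermitian matrix given by eigenvectors and eigenvalues. In \<open>exp_factor\<close>
  and \<open>log_sum\<close> the second component is the spectrum of a logarithm; in
  \<open>kron_list_spec\<close> it is the spectrum of a positive matrix.\<close>

type_synonym spectral = "complex mat \<times> (nat \<Rightarrow> real)"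

text \<open>The exponent is halved because squared norms are taken: at z = 1 the factor is the
  positive square root of the matrix whose logarithm is \<open>u\<close>.\<close>

definition exp_factor :: "nat \<Rightarrow> complex \<Rightarrow> spectral \<Rightarrow> complex mat" where
  "exp_factor d z u = spec d (fst u) (\<lambda>i. exp (z * of_real (snd u i / 2)))"

definition exp_product :: "nat \<Rightarrow> spectral list \<Rightarrow> complex \<Rightarrow> complex mat" where
  "exp_product d us z = foldr (\<lambda>u M. exp_factor d z u * M) us (1\<^sub>m d)"

lemma exp_product_simps [simp]:
  "exp_product d [] z = 1\<^sub>m d"
  "exp_product d (u # us) z = exp_factor d z u * exp_product d us z"
  by (simp_all add: exp_product_def)

lemma exp_product_carrier:
  assumes "\<And>u. u \<in> set us \<Longrightarrow> unitary_mat d (fst u)"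
  shows "exp_product d us z \<in> carrier_mat d d"
  using assms
proof (induction us)
  case (Cons u us)
  then have "exp_factor d z u \<in> carrier_mat d d"
    unfolding exp_factor_def by (intro spec_carrier unitary_matD(1)) simp
  with Cons show ?case by (auto intro: mult_square_carrier)
qed simp

lemma exp_product_append:
  assumes "\<And>u. u \<in> set us \<Longrightarrow> unitary_mat d (fst u)" "\<And>u. u \<in> set vs \<Longrightarrow> unitary_mat d (fst u)"
  shows "exp_product d (us @ vs) z = exp_product d us z * exp_product d vs z"
  using assms(1)
proof (induction us)
  case Nil
  show ?case using left_mult_one_mat[OF exp_product_carrier[of vs d z]] assms(2) by simp
next
  case (Cons u us)
  then have "exp_factor d z u \<in> carrier_mat d d"
    unfolding exp_factor_def by (intro spec_carrier unitary_matD(1)) simp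
  with Cons exp_product_carrier[of us d z] exp_product_carrier[OF assms(2)] show ?case
    by (simp add: assoc_mult_mat[of _ d d _ d _ d])
qed

lemma exp_product_strip:
  assumes "\<And>u. u \<in> set us \<Longrightarrow> unitary_mat d (fst u)"
  shows "i < d \<Longrightarrow> j < d \<Longrightarrow> strip_bounded (\<lambda>z. exp_product d us z $$ (i,j))"
  using assms
proof (induction us arbitrary: i j)
  case Nil
  then show ?case by (simp add: strip_bounded_const)
next
  case (Cons u us)
  have u: "fst u \<in> carrier_mat d d" using Cons.prems unitary_matD(1)[of d "fst u"] by simp
  have e: "strip_bounded (\<lambda>z. exp_factor d z u $$ (k,l))" if "k < d" "l < d" for k l
  proof -
    have "strip_bounded (\<lambda>z. exp (z * of_real (snd u p / 2)))" for p
      using strip_bounded_exp[of 0 "snd u p / 2"] by (simp add: mult.commute)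
    then show ?thesis unfolding exp_factor_def spec_index[OF u that]
      by (intro strip_bounded_sum strip_bounded_mult strip_bounded_const)
  qed
  have m: "exp_product d (u # us) z $$ (i,j) = (\<Sum>l<d. exp_factor d z u $$ (i,l) * exp_product d us z $$ (l,j))" for z
    unfolding exp_product_simps
    by (rule mult_index[of _ d d _ d]) (use Cons.prems exp_product_carrier[of us d z] u in \<open>auto simp: exp_factor_def\<close>)
  show ?case unfolding m
    by (intro strip_bounded_sum strip_bounded_mult e Cons.IH) (use Cons.prems in auto)
qed

lemma exp_product_0:
  assumes "\<And>u. u \<in> set us \<Longrightarrow> unitary_mat d (fst u)"
  shows "exp_product d us 0 = 1\<^sub>m d"
  using assms by (induction us) (auto simp: exp_factor_def spec_one)

lemma exp_product_unitary:
  assumes "\<And>u. u \<in> set us \<Longrightarrow> unitary_mat d (fst u)"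
  shows "unitary_mat d (exp_product d us (\<i> * of_real t))"
  using assms
proof (induction us)
  case (Cons u us)
  have "unitary_mat d (exp_factor d (\<i> * of_real t) u)"
    unfolding exp_factor_def
    by (rule spec_unitary) (use Cons.prems in \<open>simp_all add: norm_exp_i_times flip: of_real_mult mult.assoc\<close>)
  with Cons show ?case by (simp add: unitary_mat_mult)
qed simp

definition log_sum :: "nat \<Rightarrow> spectral list \<Rightarrow> complex mat" where
  "log_sum d us = msum_list d (map (\<lambda>u. spec d (fst u) (\<lambda>i. of_real (snd u i))) us)"

lemma log_sum_simps [simp]:
  "log_sum d [] = 0\<^sub>m d d"
  "log_sum d (u # us) = spec d (fst u) (\<lambda>i. of_real (snd u i)) + log_sum d us"
  by (simp_all add: log_sum_def msum_list_def)

lemma log_sum_carrier: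
  assumes "\<And>u. u \<in> set us \<Longrightarrow> unitary_mat d (fst u)"
  shows "log_sum d us \<in> carrier_mat d d"
  using assms unitary_matD(1) by (induction us) auto

text \<open>By the product rule: every factor is the identity at 0, so the logarithms simply add up
  and the order of the factors is forgotten.\<close>

lemma exp_product_deriv:
  assumes "\<And>u. u \<in> set us \<Longrightarrow> unitary_mat d (fst u)"
  shows "i < d \<Longrightarrow> j < d \<Longrightarrow>
    ((\<lambda>z. exp_product d us z $$ (i,j)) has_field_derivative log_sum d us $$ (i,j) / 2) (at 0)"
  using assms
proof (induction us arbitrary: i j)
  case Nil
  then show ?case by simp
next
  case (Cons u us)
  have u: "unitary_mat d (fst u)" "fst u \<in> carrier_mat d d" using Cons.prems unitary_matD(1)[of d "fst u"] by simp_all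
  let ?L = "spec d (fst u) (\<lambda>i. of_real (snd u i))"
  have e: "((\<lambda>z. exp_factor d z u $$ (k,l)) has_field_derivative ?L $$ (k,l) / 2) (at 0)" if "k < d" "l < d" for k l
    unfolding exp_factor_def spec_index[OF u(2) that] sum_divide_distrib
    by (auto intro!: derivative_eq_intros sum.cong)
  have m: "exp_product d (u # us) z $$ (i,j) = (\<Sum>l<d. exp_factor d z u $$ (i,l) * exp_product d us z $$ (l,j))" for z
    unfolding exp_product_simps
    by (rule mult_index[of _ d d _ d]) (use Cons.prems exp_product_carrier[of us d z] u in \<open>auto simp: exp_factor_def\<close>)
  have "((\<lambda>z. exp_product d (u # us) z $$ (i,j)) has_field_derivative
      (\<Sum>l<d. ?L $$ (i,l) / 2 * exp_product d us 0 $$ (l,j) + log_sum d us $$ (l,j) / 2 * exp_factor d 0 u $$ (i,l))) (at 0)"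
    unfolding m by (intro DERIV_sum DERIV_mult e Cons.IH) (use Cons.prems in auto)
  also have "(\<Sum>l<d. ?L $$ (i,l) / 2 * exp_product d us 0 $$ (l,j) + log_sum d us $$ (l,j) / 2 * exp_factor d 0 u $$ (i,l))
     = (\<Sum>l<d. if l = j then ?L $$ (i,j) / 2 else 0) + (\<Sum>l<d. if l = i then log_sum d us $$ (i,j) / 2 else 0)"
    unfolding sum.distrib[symmetric]
    by (intro sum.cong refl) (use Cons.prems exp_product_0[of us d] u in \<open>auto simp: exp_factor_def spec_one\<close>)
  also have "\<dots> = log_sum d (u # us) $$ (i,j) / 2"
    using Cons.prems log_sum_carrier[of us d] by (simp add: add_divide_distrib)
  finally show ?case .
qed

lemma deriv_mtrace_mult:
  fixes G K :: "complex \<Rightarrow> complex mat"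
  assumes "\<And>z. G z \<in> carrier_mat n n" "\<And>z. K z \<in> carrier_mat n n" "G' \<in> carrier_mat n n" "K' \<in> carrier_mat n n"
    and "\<And>i j. i < n \<Longrightarrow> j < n \<Longrightarrow> ((\<lambda>z. G z $$ (i,j)) has_field_derivative G' $$ (i,j)) (at x)"
    and "\<And>i j. i < n \<Longrightarrow> j < n \<Longrightarrow> ((\<lambda>z. K z $$ (i,j)) has_field_derivative K' $$ (i,j)) (at x)"
  shows "((\<lambda>z. mtrace (G z * K z)) has_field_derivative (mtrace (G' * K x) + mtrace (G x * K'))) (at x)"
proof -
  have "((\<lambda>z. \<Sum>i<n. \<Sum>l<n. G z $$ (i,l) * K z $$ (l,i)) has_field_derivative
     (\<Sum>i<n. \<Sum>l<n. G' $$ (i,l) * K x $$ (l,i) + K' $$ (l,i) * G x $$ (i,l))) (at x)"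
    by (intro DERIV_sum DERIV_mult assms) auto
  then show ?thesis
    unfolding mtrace_mult[OF assms(1,2)] mtrace_mult[OF assms(3,2)] mtrace_mult[OF assms(1,4)]
    by (simp add: sum.distrib mult.commute)
qed

lemma continuous_on_frob_exp_product:
  assumes "\<And>u. u \<in> set us \<Longrightarrow> unitary_mat d (fst u)"
  shows "continuous_on S (\<lambda>t::real. frob (exp_product d us (1 + \<i> * of_real t)))"
proof -
  have "continuous_on S (\<lambda>t. exp_product d us (1 + \<i> * of_real t) $$ (i,j))" if "i < d" "j < d" for i j
    using exp_product_strip[OF assms that] unfolding strip_bounded_def
    by (intro continuous_on_compose2[OF holomorphic_on_imp_continuous_on[of "\<lambda>z. exp_product d us z $$ (i,j)" UNIV]])
       (auto intro!: continuous_intros)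
  moreover have "frob (exp_product d us z) = (\<Sum>i<d. \<Sum>j<d. (cmod (exp_product d us z $$ (i,j)))\<^sup>2)" for z
    using exp_product_carrier[OF assms, of us z] by (simp add: frob_def)
  ultimately show ?thesis by (auto intro!: continuous_intros)
qed

text \<open>Three-lines interpolation, differentiated at the left edge of the strip,
  between the unitary matrices \<open>exp_product d us (\<i> t)\<close> and the Frobenius norms at \<open>1 + \<i> t\<close>.
  The test matrix \<open>K z = (e\<^sup>S / Z) powr (1 - z/2)\<close> is the one that makes the interpolation tight.\<close>

theorem trace_exp_log_sum_le:
  assumes us: "\<And>u. u \<in> set us \<Longrightarrow> unitary_mat d (fst u)"
    and V: "unitary_mat d V" and S: "log_sum d us = spec d V (\<lambda>i. complex_of_real (s i))" and d: "d \<ge> 1"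
    and lim: "((\<lambda>R. integral {-R..R} (\<lambda>t. frob (exp_product d us (1 + \<i> * of_real t)) * \<beta>\<^sub>0 t)) \<longlongrightarrow> r) at_top"
  shows "(\<Sum>i<d. exp (s i)) \<le> r"
proof -
  define Z where "Z = (\<Sum>i<d. exp (s i))"
  have Z: "Z > 0" unfolding Z_def by (rule sum_pos) (use d in \<open>auto simp: lessThan_empty_iff\<close>)
  define p where "p i = exp (s i) / Z" for i
  have p: "(\<Sum>i<d. p i) = 1" using Z unfolding p_def by (simp add: sum_divide_distrib[symmetric] Z_def)
  \<comment> \<open>The eigenvalues of the logarithm of the density matrix e^S / Z, whose
    eigenvalues are the \<open>p i\<close>.\<close>
  define \<mu> where "\<mu> i = s i - ln Z" for i
  have pl: "p i = exp (\<mu> i)" for i using Z by (simp add: p_def \<mu>_def exp_diff)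
  define K where "K z = spec d V (\<lambda>i. exp ((1 - z / 2) * of_real (\<mu> i)))" for z
  define G where "G = exp_product d us"
  define f where "f z = mtrace (G z * K z)" for z
  note VD = unitary_matD[OF V]
  have Gc: "G z \<in> carrier_mat d d" for z unfolding G_def by (rule exp_product_carrier[OF us])
  have Kc: "K z \<in> carrier_mat d d" for z unfolding K_def using VD(1) by auto
  have Sc: "log_sum d us \<in> carrier_mat d d" by (rule log_sum_carrier[OF us])
  have Gs: "strip_bounded (\<lambda>z. G z $$ (i,j))" if "i < d" "j < d" for i j
    unfolding G_def by (rule exp_product_strip[OF us that])
  have Ks: "strip_bounded (\<lambda>z. K z $$ (i,j))" if "i < d" "j < d" for i j
  proof -
    have "(1 - z / 2) * of_real (\<mu> k) = of_real (\<mu> k) + of_real (- \<mu> k / 2) * z" for k :: nat and z :: complex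
      by (simp add: field_simps)
    then show ?thesis unfolding K_def spec_index[OF VD(1) that]
      by (simp only: ) (intro strip_bounded_sum strip_bounded_mult strip_bounded_const strip_bounded_exp)
  qed
  have fs: "strip_bounded f"
    unfolding f_def mtrace_mult[OF Gc Kc] by (intro strip_bounded_sum strip_bounded_mult Gs Ks) auto
  have G0: "G 0 = 1\<^sub>m d" unfolding G_def by (rule exp_product_0[OF us])
  have K0: "K 0 = spec d V (\<lambda>i. of_real (p i))"
    unfolding K_def by (rule spec_cong) (simp add: pl exp_of_real)
  have f0: "f 0 = 1" 
    unfolding f_def G0 left_mult_one_mat[OF Kc] unfolding K0 mtrace_spec[OF V] of_real_sum[symmetric] p by simp
  define K' where "K' = spec d V (\<lambda>i. of_real (- \<mu> i / 2 * p i))"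
  define G' where "G' = spec d V (\<lambda>i. complex_of_real (s i / 2))"
  have K'c: "K' \<in> carrier_mat d d" and G'c: "G' \<in> carrier_mat d d" unfolding K'_def G'_def using VD(1) by auto
  have "(f has_field_derivative (mtrace (G' * K 0) + mtrace (G 0 * K'))) (at 0)"
    unfolding f_def
  proof (rule deriv_mtrace_mult[OF Gc Kc G'c K'c])
    fix i j assume ij: "i < d" "j < d"
    have e: "G' $$ (i,j) = log_sum d us $$ (i,j) / 2"
      unfolding G'_def S spec_index[OF VD(1) ij] by (simp add: sum_divide_distrib)
    show "((\<lambda>z. G z $$ (i,j)) has_field_derivative G' $$ (i,j)) (at 0)"
      unfolding G_def e by (rule exp_product_deriv[OF us ij])
    show "((\<lambda>z. K z $$ (i,j)) has_field_derivative K' $$ (i,j)) (at 0)"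
      unfolding K_def K'_def spec_index[OF VD(1) ij] pl
      by (auto intro!: derivative_eq_intros sum.cong simp: exp_of_real)
  qed
  moreover have "mtrace (G' * K 0) = of_real (\<Sum>i<d. s i / 2 * p i)"
    unfolding K0 G'_def spec_mult[OF V] mtrace_spec[OF V] by simp
  moreover have "mtrace (G 0 * K') = of_real (\<Sum>i<d. - \<mu> i / 2 * p i)"
    unfolding G0 left_mult_one_mat[OF K'c] unfolding K'_def mtrace_spec[OF V] by simp
  \<comment> \<open>The derivatives of \<open>G\<close> and \<open>K\<close> contribute S/2 and -(S
    - ln Z)/2, both averaged over the probabilities \<open>p\<close>; S cancels.\<close>
  moreover have "(\<Sum>i<d. s i / 2 * p i) + (\<Sum>i<d. - \<mu> i / 2 * p i) = ln Z / 2"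
  proof -
    have "(\<Sum>i<d. s i / 2 * p i) + (\<Sum>i<d. - \<mu> i / 2 * p i) = (\<Sum>i<d. ln Z / 2 * p i)"
      unfolding sum.distrib[symmetric] by (intro sum.cong refl) (simp add: \<mu>_def field_simps)
    also have "\<dots> = ln Z / 2" unfolding sum_distrib_left[symmetric] p by simp
    finally show ?thesis .
  qed
  ultimately have df: "(f has_field_derivative of_real (ln Z / 2)) (at 0)" by (simp only: of_real_add[symmetric])
  \<comment> \<open>The square matches the squared norm in Cauchy-Schwarz and doubles the derivative
    ln Z / 2 at 0, which the factor Z powr (- z) then cancels.\<close>
  define g where "g z = (f z * f z) * exp (of_real 0 + of_real (- ln Z) * z)" for z
  have gs: "strip_bounded g" unfolding g_def by (intro strip_bounded_mult fs strip_bounded_exp)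
  then obtain B where B: "\<And>z. 0 \<le> Re z \<Longrightarrow> Re z \<le> 1 \<Longrightarrow> norm (g z) \<le> B"
    unfolding strip_bounded_def by blast
  have g0: "g 0 = 1" by (simp add: g_def f0)
  have "(g has_field_derivative 0) (at 0)"
    unfolding g_def by (rule derivative_eq_intros df refl)+ (simp add: f0)
  then have g1: "deriv g 0 = 0" by (rule DERIV_imp_deriv)
  \<comment> \<open>On the left edge \<open>G\<close> is unitary and the eigenvalues of
    \<open>K\<close> have moduli \<open>p i\<close>, with sum 1.\<close>
  have fl: "norm (f (\<i> * of_real t)) \<le> 1" for t
  proof -
    have "norm (f (\<i> * of_real t)) \<le> (\<Sum>i<d. norm (exp ((1 - \<i> * of_real t / 2) * of_real (\<mu> i))))"
      unfolding f_def K_def G_def by (rule mtrace_unitary_spec_le[OF exp_product_unitary[OF us] V])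
    also have "\<dots> = 1" by (simp add: pl[symmetric] p)
    finally show ?thesis .
  qed
  \<comment> \<open>On the right edge the eigenvalues of \<open>K\<close> have squared moduli
    \<open>p i\<close>, so its Frobenius norm is 1.\<close>
  have fr: "(norm (f (1 + \<i> * of_real t)))\<^sup>2 \<le> frob (G (1 + \<i> * of_real t))" for t
  proof -
    have "frob (K (1 + \<i> * of_real t)) = (\<Sum>i<d. p i)"
      unfolding K_def frob_spec[OF V] by (intro sum.cong refl) (simp add: pl power2_eq_square flip: exp_add)
    then show ?thesis using mtrace_mult_frob[OF Gc[of "1 + \<i> * of_real t"] Kc[of "1 + \<i> * of_real t"]] p by (simp add: f_def)
  qed
  have gl: "norm (g (\<i> * of_real t)) \<le> 1" for t
    using fl[of t] by (simp add: g_def norm_mult mult_le_one)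
  have gr: "norm (g (1 + \<i> * of_real t)) \<le> frob (G (1 + \<i> * of_real t)) / Z" for t
  proof -
    have "norm (g (1 + \<i> * of_real t)) = (norm (f (1 + \<i> * of_real t)))\<^sup>2 / Z"
      unfolding g_def norm_mult norm_exp_eq_Re using Z by (simp add: power2_eq_square exp_minus divide_inverse)
    then show ?thesis using fr[of t] Z by (simp add: divide_right_mono)
  qed
  have cont: "continuous_on UNIV (\<lambda>t. frob (G (1 + \<i> * of_real t)) / Z)"
    unfolding G_def using Z by (intro continuous_on_divide continuous_on_const continuous_on_frob_exp_product us) auto
  have "((\<lambda>R. integral {-R..R} (\<lambda>t. frob (G (1 + \<i> * of_real t)) / Z * \<beta>\<^sub>0 t)) \<longlongrightarrow> r / Z) at_top"
    using tendsto_divide[OF lim tendsto_const[of Z]] Z by (simp add: G_def)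
  from strip_average_ge_1[OF _ g0 g1 B gl gr cont this] gs
  have "1 \<le> r / Z" by (simp add: strip_bounded_def)
  then show ?thesis using Z by (simp add: Z_def)
qed

section \<open>Kronecker products\<close>

text \<open>Splits the big-endian index l = a * q + b of a product basis.\<close>

lemma sum_div_mod:
  fixes f :: "nat \<Rightarrow> nat \<Rightarrow> 'a :: comm_monoid_add"
  shows "(\<Sum>l<k * q. f (l div q) (l mod q)) = (\<Sum>a<k. \<Sum>b<q. f a b)"
proof (cases "q = 0")
  case False
  have "(\<Sum>l<k * q. f (l div q) (l mod q)) = (\<Sum>a<k. \<Sum>l = a * q..<a * q + q. f (l div q) (l mod q))"
    by (rule sum.nat_group[symmetric])
  also have "\<dots> = (\<Sum>a<k. \<Sum>b<q. f a b)"
  proof (rule sum.cong[OF refl])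
    fix a
    have "(\<Sum>l = 0 + a * q..<q + a * q. f (l div q) (l mod q)) = (\<Sum>b = 0..<q. f ((b + a * q) div q) ((b + a * q) mod q))"
      by (rule sum.shift_bounds_nat_ivl)
    also have "\<dots> = (\<Sum>b<q. f a b)" using False by (intro sum.cong) auto
    finally show "(\<Sum>l = a * q..<a * q + q. f (l div q) (l mod q)) = (\<Sum>b<q. f a b)" by (simp add: add.commute)
  qed
  finally show ?thesis .
qed simp

lemma kron_dim [simp]:
  "dim_row (kron A B) = dim_row A * dim_row B" "dim_col (kron A B) = dim_col A * dim_col B"
  by (simp_all add: kron_def)

lemma kron_carrier [intro]:
  "A \<in> carrier_mat m n \<Longrightarrow> B \<in> carrier_mat p q \<Longrightarrow> kron A B \<in> carrier_mat (m * p) (n * q)"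
  by auto

lemma kron_index [simp]:
  "i < dim_row A * dim_row B \<Longrightarrow> j < dim_col A * dim_col B \<Longrightarrow>
    kron A B $$ (i,j) = A $$ (i div dim_row B, j div dim_col B) * B $$ (i mod dim_row B, j mod dim_col B)"
  by (simp add: kron_def)

lemma div_mod_less:
  assumes "(i::nat) < a * b"
  shows "i div b < a" "i mod b < b"
  using assms by (auto simp: less_mult_imp_div_less intro!: mod_less_divisor gr0I)

lemma kron_mult:
  assumes "dim_col A = dim_row B" "dim_col C = dim_row D"
  shows "kron A C * kron B D = kron (A * B) (C * D)"
proof (rule eq_matI)
  let ?k = "dim_row B" and ?q = "dim_row D"
  fix i j assume "i < dim_row (kron (A * B) (C * D))" "j < dim_col (kron (A * B) (C * D))"
  then have i: "i < dim_row A * dim_row C" and j: "j < dim_col B * dim_col D" by auto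
  note i' = div_mod_less[OF i] and j' = div_mod_less[OF j]
  let ?a = "i div dim_row C" and ?c = "i mod dim_row C" and ?b = "j div dim_col D" and ?d = "j mod dim_col D"
  have "(kron A C * kron B D) $$ (i,j) = (\<Sum>l<?k * ?q. kron A C $$ (i,l) * kron B D $$ (l,j))"
    by (rule mult_index[of _ "dim_row A * dim_row C"]) (use assms i j in auto)
  also have "\<dots> = (\<Sum>l<?k * ?q. (A $$ (?a, l div ?q) * C $$ (?c, l mod ?q)) * (B $$ (l div ?q, ?b) * D $$ (l mod ?q, ?d)))"
    using assms i j by (intro sum.cong) auto
  also have "\<dots> = (\<Sum>x<?k. \<Sum>y<?q. (A $$ (?a, x) * C $$ (?c, y)) * (B $$ (x, ?b) * D $$ (y, ?d)))"
    by (rule sum_div_mod[of "\<lambda>x y. (A $$ (?a, x) * C $$ (?c, y)) * (B $$ (x, ?b) * D $$ (y, ?d))"])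
  also have "\<dots> = (\<Sum>x<?k. A $$ (?a, x) * B $$ (x, ?b)) * (\<Sum>y<?q. C $$ (?c, y) * D $$ (y, ?d))"
    unfolding sum_product by (intro sum.cong refl) (simp only: mult_ac)
  also have "(\<Sum>x<?k. A $$ (?a, x) * B $$ (x, ?b)) = (A * B) $$ (?a, ?b)"
    by (rule mult_index[symmetric, of _ "dim_row A" _ _ "dim_col B"]) (use assms i' j' in auto)
  also have "(\<Sum>y<?q. C $$ (?c, y) * D $$ (y, ?d)) = (C * D) $$ (?c, ?d)"
    by (rule mult_index[symmetric, of _ "dim_row C" _ _ "dim_col D"]) (use assms i' j' in auto)
  finally show "(kron A C * kron B D) $$ (i,j) = kron (A * B) (C * D) $$ (i,j)"
    using i j by (simp del: index_mult_mat(1))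
qed auto

lemma mod_mult_div_eq:
  "(i::nat) mod (b * c) div c = i div c mod b" "i mod (b * c) mod c = i mod c"
  by (cases "c = 0"; simp add: mod_mult2_eq mult.commute[of b c])+

lemma kron_assoc: "kron (kron A B) C = kron A (kron B C)"
proof (rule eq_matI)
  fix i j assume "i < dim_row (kron A (kron B C))" "j < dim_col (kron A (kron B C))"
  then have i: "i < dim_row A * dim_row B * dim_row C" and j: "j < dim_col A * dim_col B * dim_col C"
    by (auto simp: mult.assoc)
  have p: "dim_row B * dim_row C > 0" "dim_col B * dim_col C > 0" using i j by (auto intro!: gr0I)
  show "kron (kron A B) C $$ (i,j) = kron A (kron B C) $$ (i,j)"
    using i j div_mod_less[OF i] div_mod_less[OF j] p
    by (simp add: mult.assoc mod_mult_div_eq div_mult2_eq[symmetric] mult.commute[of "dim_row C"] mult.commute[of "dim_col C"])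
qed (auto simp: mult.assoc)

lemma kron_one_right [simp]: "kron A (1\<^sub>m 1) = A"
  by (rule eq_matI) auto

lemma kron_one_left [simp]: "kron (1\<^sub>m 1) A = A"
  by (rule eq_matI) auto

lemma kron_one_one: "kron (1\<^sub>m m) (1\<^sub>m n) = 1\<^sub>m (m * n)"
proof (rule eq_matI)
  fix i j assume "i < dim_row (1\<^sub>m (m * n) :: complex mat)" "j < dim_col (1\<^sub>m (m * n) :: complex mat)"
  then have i: "i < m * n" and j: "j < m * n" by auto
  have "i = j \<longleftrightarrow> i div n = j div n \<and> i mod n = j mod n"
    by (metis div_mult_mod_eq)
  then show "kron (1\<^sub>m m) (1\<^sub>m n) $$ (i,j) = 1\<^sub>m (m * n) $$ (i,j)"
    using i j div_mod_less[OF i] div_mod_less[OF j] by auto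
qed auto

lemma madj_kron: "madj (kron A B) = kron (madj A) (madj B)"
  by (rule eq_matI) (auto simp: div_mod_less)

lemma transpose_kron: "transpose_mat (kron A B) = kron (transpose_mat A) (transpose_mat B)"
  by (rule eq_matI) (auto simp: div_mod_less)

lemma kron_list_append: "kron_list (xs @ ys) = kron (kron_list xs) (kron_list ys)"
  by (induction xs) (auto simp: kron_assoc simp flip: One_nat_def)

lemma kron_list_carrier:
  "(\<And>X. X \<in> set Xs \<Longrightarrow> X \<in> carrier_mat d d) \<Longrightarrow> kron_list Xs \<in> carrier_mat (d ^ length Xs) (d ^ length Xs)"
  by (induction Xs) auto

lemma transpose_kron_list: "transpose_mat (kron_list Xs) = kron_list (map transpose_mat Xs)"
  by (induction Xs) (auto simp: transpose_kron)

lemma kron_list_mult: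
  assumes "list_all2 (\<lambda>X Y. dim_col X = dim_row Y) Xs Ys"
  shows "kron_list Xs * kron_list Ys = kron_list (map2 (*) Xs Ys) \<and> dim_col (kron_list Xs) = dim_row (kron_list Ys)"
  using assms by (induction rule: list_all2_induct) (auto simp: kron_mult)

lemma unitary_kron:
  assumes "unitary_mat m U" "unitary_mat n V"
  shows "unitary_mat (m * n) (kron U V)"
  using assms unfolding unitary_mat_def by (auto simp: madj_kron kron_mult kron_one_one)

lemma spec_kron:
  assumes U: "U \<in> carrier_mat m m" and V: "V \<in> carrier_mat n n"
  shows "kron (spec m U a) (spec n V b) = spec (m * n) (kron U V) (\<lambda>i. a (i div n) * b (i mod n))"
proof -
  have D: "kron (diagm m a) (diagm n b) = diagm (m * n) (\<lambda>i. a (i div n) * b (i mod n))"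
  proof (rule eq_matI)
    fix i j assume "i < dim_row (diagm (m * n) (\<lambda>i. a (i div n) * b (i mod n)))" "j < dim_col (diagm (m * n) (\<lambda>i. a (i div n) * b (i mod n)))"
    then have i: "i < m * n" and j: "j < m * n" by auto
    have "i = j \<longleftrightarrow> i div n = j div n \<and> i mod n = j mod n"
      by (metis div_mult_mod_eq)
    then show "kron (diagm m a) (diagm n b) $$ (i,j) = diagm (m * n) (\<lambda>i. a (i div n) * b (i mod n)) $$ (i,j)"
      using i j div_mod_less[OF i] div_mod_less[OF j] by auto
  qed auto
  show ?thesis unfolding spec_def using U V by (simp add: D[symmetric] madj_kron kron_mult)
qed

text \<open>The eigenvalues of a tensor product are products of eigenvalues, so a multiplicative
  \<phi> may be applied factorwise; \<phi> 1 = 1 covers the empty product. One eigenbasis has to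
  serve all \<phi> at once: it is used for the inclusion of the reals, giving \<open>\<A>\<close>,
  and for complex powers, giving the powers of \<open>\<A>\<close>.\<close>

lemma kron_list_spec:
  fixes us :: "spectral list"
  assumes "\<And>u. u \<in> set us \<Longrightarrow> unitary_mat d (fst u)" "\<And>u i. u \<in> set us \<Longrightarrow> i < d \<Longrightarrow> snd u i > 0"
  shows "\<exists>W w. unitary_mat (d ^ length us) W \<and> (\<forall>i < d ^ length us. w i > 0) \<and>
    (\<forall>\<phi>::real \<Rightarrow> complex. (\<forall>x y. x > 0 \<longrightarrow> y > 0 \<longrightarrow> \<phi> (x * y) = \<phi> x * \<phi> y) \<longrightarrow> \<phi> 1 = 1 \<longrightarrow>
       kron_list (map (\<lambda>u. spec d (fst u) (\<lambda>i. \<phi> (snd u i))) us) = spec (d ^ length us) W (\<lambda>i. \<phi> (w i)))"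
  using assms
proof (induction us)
  case Nil
  have "spec 1 (1\<^sub>m 1) (\<lambda>_. \<phi> 1) = 1\<^sub>m 1" if "\<phi> 1 = 1" for \<phi> :: "real \<Rightarrow> complex"
    unfolding that by (rule spec_one) simp
  then show ?case by (intro exI[of _ "1\<^sub>m 1"] exI[of _ "\<lambda>_. 1"]) (simp del: One_nat_def)
next
  case (Cons u us)
  let ?N = "d ^ length us"
  obtain W w where W: "unitary_mat ?N W" and w: "\<And>i. i < ?N \<Longrightarrow> w i > 0"
    and eq: "\<And>\<phi>::real \<Rightarrow> complex. (\<forall>x y. x > 0 \<longrightarrow> y > 0 \<longrightarrow> \<phi> (x * y) = \<phi> x * \<phi> y) \<Longrightarrow> \<phi> 1 = 1 \<Longrightarrow>
       kron_list (map (\<lambda>u. spec d (fst u) (\<lambda>i. \<phi> (snd u i))) us) = spec ?N W (\<lambda>i. \<phi> (w i))"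
  proof -
    have "\<exists>W w. unitary_mat ?N W \<and> (\<forall>i < ?N. w i > 0) \<and>
      (\<forall>\<phi>::real \<Rightarrow> complex. (\<forall>x y. x > 0 \<longrightarrow> y > 0 \<longrightarrow> \<phi> (x * y) = \<phi> x * \<phi> y) \<longrightarrow> \<phi> 1 = 1 \<longrightarrow>
         kron_list (map (\<lambda>u. spec d (fst u) (\<lambda>i. \<phi> (snd u i))) us) = spec ?N W (\<lambda>i. \<phi> (w i)))"
      by (rule Cons.IH) (use Cons.prems in auto)
    then show thesis using that by blast
  qed
  have u: "unitary_mat d (fst u)" and a: "\<And>i. i < d \<Longrightarrow> snd u i > 0" using Cons.prems by auto
  define w' where "w' i = snd u (i div ?N) * w (i mod ?N)" for i
  have "kron_list (map (\<lambda>u. spec d (fst u) (\<lambda>i. \<phi> (snd u i))) (u # us)) = spec (d * ?N) (kron (fst u) W) (\<lambda>i. \<phi> (w' i))"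
    if \<phi>: "\<forall>x y. x > 0 \<longrightarrow> y > 0 \<longrightarrow> \<phi> (x * y) = \<phi> x * \<phi> y" "\<phi> 1 = 1" for \<phi> :: "real \<Rightarrow> complex"
  proof -
    have "kron_list (map (\<lambda>u. spec d (fst u) (\<lambda>i. \<phi> (snd u i))) (u # us)) =
       spec (d * ?N) (kron (fst u) W) (\<lambda>i. \<phi> (snd u (i div ?N)) * \<phi> (w (i mod ?N)))"
      using spec_kron[OF unitary_matD(1)[OF u] unitary_matD(1)[OF W]] eq[OF \<phi>] by simp
    also have "\<dots> = spec (d * ?N) (kron (fst u) W) (\<lambda>i. \<phi> (w' i))"
      by (rule spec_cong) (use \<phi> a w div_mod_less[of _ d ?N] in \<open>auto simp: w'_def\<close>)
    finally show ?thesis .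
  qed
  moreover have "w' i > 0" if "i < d * ?N" for i
    using a w div_mod_less[OF that] by (simp add: w'_def)
  ultimately show ?case using unitary_kron[OF u W]
    by (intro exI[of _ "kron (fst u) W"] exI[of _ w']) simp
qed

section \<open>Contraction with maximally entangled vectors\<close>

text \<open>The vector as a one-column matrix, so that matrix products, adjoints and
  \<open>kron\<close> apply to it.\<close>

definition Omega_col :: "nat \<Rightarrow> nat \<Rightarrow> complex mat" where
  "Omega_col d m = mat (d ^ (2 * m)) 1 (\<lambda>(i,j). Omega_vec d m $ i)"

lemma Omega_col_carrier [simp, intro]: "Omega_col d m \<in> carrier_mat (d ^ (2 * m)) 1"
  by (simp add: Omega_col_def)

lemma Omega_col_dim [simp]: "dim_row (Omega_col d m) = d ^ (2 * m)" "dim_col (Omega_col d m) = 1"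
  by (simp_all add: Omega_col_def)

lemma Omega_col_index: "i < d ^ (2 * m) \<Longrightarrow> Omega_col d m $$ (i,0) = (if i div d ^ m = i mod d ^ m then 1 else 0)"
  by (simp add: Omega_col_def Omega_vec_def)

lemma madj_Omega_col: "madj (Omega_col d m) = transpose_mat (Omega_col d m)"
  by (rule eq_matI) (auto simp: Omega_col_index)

lemma Pproj_eq: "Pproj d m = Omega_col d m * madj (Omega_col d m)"
proof (rule eq_matI)
  fix i j assume "i < dim_row (Omega_col d m * madj (Omega_col d m))" "j < dim_col (Omega_col d m * madj (Omega_col d m))"
  then have ij: "i < d ^ (2 * m)" "j < d ^ (2 * m)" by auto
  have "(Omega_col d m * madj (Omega_col d m)) $$ (i,j) = (\<Sum>l<1. Omega_col d m $$ (i,l) * madj (Omega_col d m) $$ (l,j))"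
    by (rule mult_index) (use ij in auto)
  then show "Pproj d m $$ (i,j) = (Omega_col d m * madj (Omega_col d m)) $$ (i,j)"
    using ij by (simp add: Pproj_def Omega_col_def del: index_mult_mat(1))
qed (auto simp: Pproj_def)

lemma Omega_kron_index:
  assumes X: "X \<in> carrier_mat (d ^ m) c" and Y: "Y \<in> carrier_mat (d ^ m) e" and j: "j < c * e"
  shows "(transpose_mat (Omega_col d m) * kron X Y) $$ (0,j) = (\<Sum>a<d ^ m. X $$ (a, j div e) * Y $$ (a, j mod e))"
proof -
  let ?D = "d ^ m"
  note j' = div_mod_less[OF j]
  have D: "d ^ (2 * m) = ?D * ?D" by (simp add: power_add[symmetric] mult_2)
  have "(transpose_mat (Omega_col d m) * kron X Y) $$ (0,j) = (\<Sum>l<?D * ?D. transpose_mat (Omega_col d m) $$ (0,l) * kron X Y $$ (l,j))"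
    by (rule mult_index[of _ 1]) (use X Y j D in auto)
  also have "\<dots> = (\<Sum>l<?D * ?D. (if l div ?D = l mod ?D then X $$ (l div ?D, j div e) * Y $$ (l mod ?D, j mod e) else 0))"
    using X Y j by (intro sum.cong) (auto simp: D[symmetric] Omega_col_index) 
  also have "\<dots> = (\<Sum>a<?D. \<Sum>b<?D. if a = b then X $$ (a, j div e) * Y $$ (b, j mod e) else 0)"
    by (rule sum_div_mod[of "\<lambda>a b. if a = b then X $$ (a, j div e) * Y $$ (b, j mod e) else 0"])
  finally show ?thesis by simp
qed

text \<open>Pairing with the maximally entangled vector identifies the two halves, which turns the
  second tensor factor into a transposed row acting on the first. This is the source of all
  transposes in the network.\<close>

lemma Omega_kron_col:
  assumes X: "X \<in> carrier_mat (d ^ m) c" and y: "y \<in> carrier_mat (d ^ m) 1"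
  shows "transpose_mat (Omega_col d m) * kron X y = transpose_mat y * X"
proof (rule eq_matI)
  fix i j assume "i < dim_row (transpose_mat y * X)" "j < dim_col (transpose_mat y * X)"
  then have i: "i = 0" and j: "j < c" using X y by auto
  have "(transpose_mat y * X) $$ (0,j) = (\<Sum>a<d ^ m. transpose_mat y $$ (0,a) * X $$ (a,j))"
    by (rule mult_index[of _ 1]) (use X y j in auto)
  also have "\<dots> = (\<Sum>a<d ^ m. X $$ (a,j) * y $$ (a,0))"
    using y by (intro sum.cong) auto
  finally show "(transpose_mat (Omega_col d m) * kron X y) $$ (i,j) = (transpose_mat y * X) $$ (i,j)"
    using Omega_kron_index[OF X y, of j] i j by (simp del: index_mult_mat(1))
qed (use X y in auto)

text \<open>The row on the left lists the entries of Y^T X column by column, so both sides add the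
  same squares.\<close>

lemma frob_Omega_kron:
  assumes X: "X \<in> carrier_mat d d" and Y: "Y \<in> carrier_mat d d"
  shows "frob (transpose_mat (Omega_col d 1) * kron X Y) = frob (transpose_mat Y * X)"
proof -
  have X': "X \<in> carrier_mat (d ^ 1) d" and Y': "Y \<in> carrier_mat (d ^ 1) d" using X Y by auto
  have "(transpose_mat Y * X) $$ (i,j) = (\<Sum>a<d. X $$ (a,j) * Y $$ (a,i))" if "i < d" "j < d" for i j
  proof -
    have "(transpose_mat Y * X) $$ (i,j) = (\<Sum>a<d. transpose_mat Y $$ (i,a) * X $$ (a,j))"
      by (rule mult_index) (use X Y that in auto)
    then show ?thesis using Y that by (simp add: mult.commute)
  qed
  then have "frob (transpose_mat Y * X) = (\<Sum>i<d. \<Sum>j<d. (cmod (\<Sum>a<d. X $$ (a,j) * Y $$ (a,i)))\<^sup>2)"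
    using X Y by (simp add: frob_def del: index_mult_mat(1))
  also have "\<dots> = (\<Sum>j<d. \<Sum>i<d. (cmod (\<Sum>a<d. X $$ (a,j) * Y $$ (a,i)))\<^sup>2)"
    by (rule sum.swap)
  also have "\<dots> = (\<Sum>l<d * d. (cmod (\<Sum>a<d. X $$ (a,l div d) * Y $$ (a,l mod d)))\<^sup>2)"
    by (rule sum_div_mod[symmetric])
  also have "\<dots> = frob (transpose_mat (Omega_col d 1) * kron X Y)"
    using Omega_kron_index[OF X' Y'] X Y by (simp add: frob_def del: index_mult_mat(1))
  finally show ?thesis by simp
qed

text \<open>A square root of the argument of T: if S S* and T T* are its first two factors, then
  this matrix times its adjoint is the whole argument
  (\<open>Omega_input_mult_madj\<close>).\<close>

definition Omega_input :: "nat \<Rightarrow> complex mat \<Rightarrow> complex mat \<Rightarrow> nat \<Rightarrow> complex mat" where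
  "Omega_input d S T m = kron (kron S T) (kron_list (map (\<lambda>j. Omega_col d (2 ^ j)) [0..<m]))"

lemma Omega_input_simps:
  "Omega_input d S T 0 = kron S T"
  "Omega_input d S T (Suc m) = kron (Omega_input d S T m) (Omega_col d (2 ^ m))"
  by (simp_all add: Omega_input_def kron_list_append kron_assoc flip: One_nat_def)

lemma Omega_input_carrier:
  assumes "S \<in> carrier_mat d d" "T \<in> carrier_mat d d"
  shows "Omega_input d S T m \<in> carrier_mat (d ^ 2 ^ Suc m) (d * d)"
proof (induction m)
  case 0
  then show ?case using kron_carrier[OF assms] by (simp add: Omega_input_simps power2_eq_square)
next
  case (Suc m)
  have "d ^ 2 ^ Suc m * d ^ (2 * 2 ^ m) = d ^ 2 ^ Suc (Suc m)"
    by (simp add: power_add[symmetric] mult_2)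
  then show ?case using kron_carrier[OF Suc Omega_col_carrier[of d "2 ^ m"]]
    by (simp add: Omega_input_simps)
qed

text \<open>A row of length d^2, for a list \<open>Bs\<close> of 2^(m+1) factors. With the factors
  of a complex power of \<open>\<A>\<close> for \<open>Bs\<close>, its \<open>frob\<close> is the
  trace under the average.\<close>

definition Omega_row :: "nat \<Rightarrow> complex mat \<Rightarrow> complex mat \<Rightarrow> nat \<Rightarrow> complex mat list \<Rightarrow> complex mat" where
  "Omega_row d S T m Bs = transpose_mat (Omega_col d (2 ^ m)) * (kron_list Bs * Omega_input d S T m)"

text \<open>The right half of the factors meets exactly the last entangled vector \<Omega> of the
  input. The outer vector turns (L Q) \<otimes> (R \<Omega>) into (R \<Omega>)^T L Q = \<Omega>^T
  (R^T L) Q, so \<Omega> becomes the outer vector of the same network at half the size.\<close>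

lemma Omega_row_fold:
  assumes S: "S \<in> carrier_mat d d" and T: "T \<in> carrier_mat d d"
    and L: "length Ls = 2 ^ Suc m" "\<And>X. X \<in> set Ls \<Longrightarrow> X \<in> carrier_mat d d"
    and R: "length Rs = 2 ^ Suc m" "\<And>X. X \<in> set Rs \<Longrightarrow> X \<in> carrier_mat d d"
  shows "Omega_row d S T (Suc m) (Ls @ Rs) = Omega_row d S T m (map2 (\<lambda>X Y. transpose_mat Y * X) Ls Rs)"
proof -
  let ?D = "d ^ 2 ^ Suc m" and ?Q = "Omega_input d S T m" and ?O = "Omega_col d (2 ^ m)"
  have Lc: "kron_list Ls \<in> carrier_mat ?D ?D" using kron_list_carrier[of Ls d, OF L(2)] L(1) by simp
  have Rc: "kron_list Rs \<in> carrier_mat ?D ?D" using kron_list_carrier[of Rs d, OF R(2)] R(1) by simp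
  have Qc: "?Q \<in> carrier_mat ?D (d * d)" by (rule Omega_input_carrier[OF S T])
  have Oc: "?O \<in> carrier_mat ?D 1" using Omega_col_carrier[of d "2 ^ m"] by simp
  have "Omega_row d S T (Suc m) (Ls @ Rs) =
      transpose_mat (Omega_col d (2 ^ Suc m)) * (kron (kron_list Ls) (kron_list Rs) * kron ?Q ?O)"
    by (simp add: Omega_row_def Omega_input_simps kron_list_append)
  also have "kron (kron_list Ls) (kron_list Rs) * kron ?Q ?O = kron (kron_list Ls * ?Q) (kron_list Rs * ?O)"
    by (rule kron_mult) (use Lc Rc Qc Oc in auto)
  also have "transpose_mat (Omega_col d (2 ^ Suc m)) * \<dots> = transpose_mat (kron_list Rs * ?O) * (kron_list Ls * ?Q)"
    by (rule Omega_kron_col) (use Lc Rc Qc Oc in auto)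
  also have "\<dots> = transpose_mat ?O * (transpose_mat (kron_list Rs) * kron_list Ls * ?Q)"
    using Lc Rc Qc Oc
    by (simp add: transpose_mult[OF Rc Oc] assoc_mult_mat[of _ 1 ?D _ ?D _ "d * d"] assoc_mult_mat[of _ ?D ?D _ ?D _ "d * d"])
  also have "transpose_mat (kron_list Rs) * kron_list Ls = kron_list (map2 (\<lambda>X Y. transpose_mat Y * X) Ls Rs)"
  proof -
    have "list_all2 (\<lambda>X Y. dim_col X = dim_row Y) (map transpose_mat Rs) Ls"
      using L R by (auto simp: list_all2_conv_all_nth) (metis carrier_matD(1) nth_mem)
    then have "transpose_mat (kron_list Rs) * kron_list Ls = kron_list (map2 (*) (map transpose_mat Rs) Ls)"
      unfolding transpose_kron_list using kron_list_mult by blast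
    also have "map2 (*) (map transpose_mat Rs) Ls = map2 (\<lambda>X Y. transpose_mat Y * X) Ls Rs"
      by (rule nth_equalityI) (use L R in auto)
    finally show ?thesis .
  qed
  finally show ?thesis by (simp add: Omega_row_def)
qed

section \<open>Thue-Morse bits and the collapse of the network\<close>

lemma tm_beta_rec: "tm_beta q = (if even q then tm_beta (q div 2) else 1 - tm_beta (q div 2))"
  by (cases q) (simp, simp only: tm_beta.simps)

declare tm_beta.simps(2) [simp del]

lemma tm_beta_1 [simp]: "tm_beta (Suc 0) = 1"
  by (subst tm_beta_rec) simp

lemma tm_beta_le_1: "tm_beta q \<le> 1"
proof (induction q rule: less_induct)
  case (less q)
  show ?case
  proof (cases "q = 0")
    case False
    then have "tm_beta (q div 2) \<le> 1" by (intro less) simp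
    then show ?thesis by (subst tm_beta_rec) simp
  qed simp
qed

text \<open>The sequence is the parity of the binary digit sum, and 2^m adds one digit above those
  of q. As subtraction on naturals truncates, flipping twice relies on
  \<open>tm_beta_le_1\<close>.\<close>

lemma tm_beta_add_power: "q < 2 ^ m \<Longrightarrow> tm_beta (q + 2 ^ m) = 1 - tm_beta q"
proof (induction m arbitrary: q)
  case 0
  then show ?case by simp
next
  case (Suc m)
  have "q div 2 < 2 ^ m" using Suc.prems by auto
  then have IH: "tm_beta (q div 2 + 2 ^ m) = 1 - tm_beta (q div 2)" by (rule Suc.IH)
  have "(q + 2 ^ Suc m) div 2 = q div 2 + 2 ^ m" by simp
  moreover have "even (q + 2 ^ Suc m) \<longleftrightarrow> even q" by simp
  ultimately show ?case using IH tm_beta_le_1[of "q div 2"]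
    unfolding tm_beta_rec[of "q + 2 ^ Suc m"] tm_beta_rec[of q] by (cases "even q") (simp_all only: if_True if_False)
qed

text \<open>A transpose rather than a conjugate: a Hermitian A has conjugate A^T, so a complex power
  of the conjugate of A is the transpose of that power of A. Conjugating the power would also flip
  the sign of t.\<close>

definition tm_twist :: "nat \<Rightarrow> complex mat \<Rightarrow> complex mat" where
  "tm_twist q X = (if tm_beta q = 1 then transpose_mat X else X)"

lemma tm_twist_carrier: "X \<in> carrier_mat d d \<Longrightarrow> tm_twist q X \<in> carrier_mat d d"
  by (simp add: tm_twist_def)

lemma sum_lessThan_add:
  fixes f :: "nat \<Rightarrow> 'a :: comm_monoid_add"
  shows "(\<Sum>q<a + b. f q) = (\<Sum>q<a. f q) + (\<Sum>q<b. f (q + a))"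
  by (induction b) (simp_all add: add.assoc, simp add: add.commute)

text \<open>Each contraction with a maximally entangled vector halves the number of tensor factors; since
  positions \<open>q\<close> and \<open>q + 2\<^sup>m\<close> carry opposite Thue--Morse bits, the transposes turn the contraction of the two
  factors into an honest matrix product that again carries the bit of \<open>q\<close>.\<close>

lemma Omega_row_exp_product:
  assumes S: "S \<in> carrier_mat d d" and T: "T \<in> carrier_mat d d"
    and l: "\<And>q u. u \<in> set (l q) \<Longrightarrow> unitary_mat d (fst u)"
  shows "\<exists>L. mset L = (\<Sum>q<2 ^ Suc m. mset (l q)) \<and>
    (\<forall>z. frob (Omega_row d S T m (map (\<lambda>q. tm_twist q (exp_product d (l q) z)) [0..<2 ^ Suc m]))
       = frob (transpose_mat T * (exp_product d L z * S)))"
  using l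
proof (induction m arbitrary: l)
  case 0
  have E: "exp_product d (l q) z \<in> carrier_mat d d" for q z by (rule exp_product_carrier) (rule 0)
  have b: "tm_beta 0 = 0" "tm_beta 1 = 1" by simp_all
  have "frob (Omega_row d S T 0 (map (\<lambda>q. tm_twist q (exp_product d (l q) z)) [0..<2 ^ Suc 0]))
       = frob (transpose_mat T * (exp_product d (l 1 @ l 0) z * S))" for z
  proof -
    let ?Z0 = "exp_product d (l 0) z" and ?Z1 = "exp_product d (l 1) z"
    have "[0..<2 ^ Suc 0] = [0, 1]" by (simp add: upt_rec)
    then have "Omega_row d S T 0 (map (\<lambda>q. tm_twist q (exp_product d (l q) z)) [0..<2 ^ Suc 0])
       = transpose_mat (Omega_col d 1) * (kron ?Z0 (transpose_mat ?Z1) * kron S T)"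
      by (simp add: Omega_row_def Omega_input_simps tm_twist_def b flip: One_nat_def)
    also have "kron ?Z0 (transpose_mat ?Z1) * kron S T = kron (?Z0 * S) (transpose_mat ?Z1 * T)"
      by (rule kron_mult) (use E[of 0 z] E[of 1 z] S T in auto)
    also have "frob (transpose_mat (Omega_col d 1) * \<dots>) = frob (transpose_mat (transpose_mat ?Z1 * T) * (?Z0 * S))"
      by (rule frob_Omega_kron) (use E[of 0 z] E[of 1 z] S T in auto)
    also have "transpose_mat (transpose_mat ?Z1 * T) * (?Z0 * S) = transpose_mat T * (?Z1 * ?Z0 * S)"
      using E[of 0 z] E[of 1 z] S T
      by (simp add: transpose_mult[of _ d d _ d] assoc_mult_mat[of _ d d _ d _ d] mult_square_carrier)
    also have "?Z1 * ?Z0 = exp_product d (l 1 @ l 0) z"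
      by (rule exp_product_append[symmetric]) (use 0 in auto)
    finally show ?thesis .
  qed
  moreover have "mset (l 1 @ l 0) = (\<Sum>q<2 ^ Suc 0. mset (l q))"
    by (simp add: numeral_2_eq_2 add.commute)
  ultimately show ?case by blast
next
  case (Suc m)
  let ?M = "2 ^ Suc m :: nat"
  \<comment> \<open>The contraction forms Y^T X from X at q and Y at q + 2^(m+1). With bit 0 at q
    only Y is a transpose, and the later factors come first; with bit 1 only X is, and Y^T X is the
    transpose of the product in the order q, q + 2^(m+1).\<close>
  define l' where "l' q = (if tm_beta q = 1 then l q @ l (q + ?M) else l (q + ?M) @ l q)" for q
  have l': "unitary_mat d (fst u)" if "u \<in> set (l' q)" for u q
    using that unfolding l'_def by (cases "tm_beta q = 1") (auto intro: Suc.prems simp del: split_paired_All)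
  have E: "exp_product d (l q) z \<in> carrier_mat d d" for q z by (rule exp_product_carrier) (rule Suc.prems)
  have fold: "Omega_row d S T (Suc m) (map (\<lambda>q. tm_twist q (exp_product d (l q) z)) [0..<2 ^ Suc (Suc m)])
      = Omega_row d S T m (map (\<lambda>q. tm_twist q (exp_product d (l' q) z)) [0..<?M])" for z
  proof -
    let ?f = "\<lambda>q. tm_twist q (exp_product d (l q) z)"
    have "[0..<?M + ?M] = [0..<?M] @ [?M..<?M + ?M]" by (rule upt_add_eq_append) simp
    also have "[?M..<?M + ?M] = map (\<lambda>q. q + ?M) [0..<?M]" by (simp only: map_add_upt add_0)
    also have "?M + ?M = 2 ^ Suc (Suc m)" by simp
    finally have "[0..<2 ^ Suc (Suc m)] = [0..<?M] @ map (\<lambda>q. q + ?M) [0..<?M]" .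
    then have "map ?f [0..<2 ^ Suc (Suc m)] = map ?f [0..<?M] @ map (\<lambda>q. ?f (q + ?M)) [0..<?M]"
      by (simp only: map_append map_map o_def)
    then have "Omega_row d S T (Suc m) (map ?f [0..<2 ^ Suc (Suc m)])
       = Omega_row d S T m (map2 (\<lambda>X Y. transpose_mat Y * X) (map ?f [0..<?M]) (map (\<lambda>q. ?f (q + ?M)) [0..<?M]))"
      by (simp only:) (rule Omega_row_fold[OF S T], use E in \<open>auto intro!: tm_twist_carrier\<close>)
    also have "map2 (\<lambda>X Y. transpose_mat Y * X) (map ?f [0..<?M]) (map (\<lambda>q. ?f (q + ?M)) [0..<?M])
       = map (\<lambda>q. transpose_mat (?f (q + ?M)) * ?f q) [0..<?M]"
      by (rule nth_equalityI) auto
    also have "\<dots> = map (\<lambda>q. tm_twist q (exp_product d (l' q) z)) [0..<?M]"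
    proof (rule map_cong[OF refl])
      fix q assume "q \<in> set [0..<?M]"
      then have b: "tm_beta (q + ?M) = 1 - tm_beta q" by (intro tm_beta_add_power) auto
      have a: "exp_product d (l' q) z = (if tm_beta q = 1 then exp_product d (l q) z * exp_product d (l (q + ?M)) z
          else exp_product d (l (q + ?M)) z * exp_product d (l q) z)"
        unfolding l'_def using exp_product_append Suc.prems by auto
      show "transpose_mat (?f (q + ?M)) * ?f q = tm_twist q (exp_product d (l' q) z)"
        using tm_beta_le_1[of q] E[of q z] E[of "q + ?M" z] unfolding tm_twist_def a b
        by (auto simp: transpose_mult[of _ d d _ d] le_Suc_eq)
    qed
    finally show ?thesis .
  qed
  obtain L where L: "mset L = (\<Sum>q<?M. mset (l' q))"
    "\<And>z. frob (Omega_row d S T m (map (\<lambda>q. tm_twist q (exp_product d (l' q) z)) [0..<?M]))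
       = frob (transpose_mat T * (exp_product d L z * S))"
    using Suc.IH[of l'] l' by blast
  have "(\<Sum>q<2 ^ Suc (Suc m). mset (l q)) = (\<Sum>q<?M + ?M. mset (l q))" by simp
  also have "\<dots> = (\<Sum>q<?M. mset (l q)) + (\<Sum>q<?M. mset (l (q + ?M)))"
    by (rule sum_lessThan_add)
  also have "\<dots> = mset L"
    unfolding L(1) sum.distrib[symmetric] by (intro sum.cong refl) (simp add: l'_def)
  finally show ?case using L(2) fold by (intro exI[of _ L]) simp
qed

section \<open>The trace inequality\<close>

lemma log_sum_index:
  assumes "\<And>u. u \<in> set us \<Longrightarrow> unitary_mat d (fst u)" "i < d" "j < d"
  shows "log_sum d us $$ (i,j) = (\<Sum>u\<leftarrow>us. spec d (fst u) (\<lambda>i. of_real (snd u i)) $$ (i,j))"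
  using assms(1)
proof (induction us)
  case (Cons u us)
  then have "log_sum d us \<in> carrier_mat d d" by (intro log_sum_carrier) simp
  with Cons assms show ?case by simp
qed (use assms in simp)

lemma log_sum_perm:
  assumes us: "\<And>u. u \<in> set us \<Longrightarrow> unitary_mat d (fst u)" and eq: "mset us = mset vs"
  shows "log_sum d us = log_sum d vs"
proof (rule eq_matI)
  have vs: "unitary_mat d (fst u)" if "u \<in> set vs" for u
    using us that mset_eq_setD[OF eq] by blast
  have c: "log_sum d us \<in> carrier_mat d d" "log_sum d vs \<in> carrier_mat d d"
    using log_sum_carrier[of us d] log_sum_carrier[of vs d] us vs by blast+
  show "dim_row (log_sum d us) = dim_row (log_sum d vs)" "dim_col (log_sum d us) = dim_col (log_sum d vs)"
    using c by auto
  fix i j assume "i < dim_row (log_sum d vs)" "j < dim_col (log_sum d vs)"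
  then have ij: "i < d" "j < d" using c by auto
  have "(\<Sum>u\<leftarrow>us. f u) = (\<Sum>u\<leftarrow>vs. f u)" for f :: "spectral \<Rightarrow> complex"
    unfolding sum_mset_sum_list[symmetric] mset_map eq ..
  then show "log_sum d us $$ (i,j) = log_sum d vs $$ (i,j)"
    using log_sum_index[of us d, OF us ij] log_sum_index[of vs d, OF vs ij] by simp
qed

lemma madj_log_sum:
  assumes "\<And>u. u \<in> set us \<Longrightarrow> unitary_mat d (fst u)"
  shows "madj (log_sum d us) = log_sum d us"
  using assms
proof (induction us)
  case Nil
  show ?case by (rule eq_matI) auto
next
  case (Cons u us)
  then have c: "log_sum d us \<in> carrier_mat d d" "fst u \<in> carrier_mat d d"
    using log_sum_carrier[of us d] unitary_matD(1)[of d "fst u"] by simp_all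
  let ?L = "spec d (fst u) (\<lambda>i. complex_of_real (snd u i))"
  have add: "madj (X + Y) = madj X + madj Y" if "X \<in> carrier_mat d d" "Y \<in> carrier_mat d d" for X Y
    by (rule eq_matI) (use that in auto)
  have "madj (log_sum d (u # us)) = madj ?L + madj (log_sum d us)"
    using c by (simp add: add)
  then show ?case using Cons by (simp add: spec_adj[OF c(2)])
qed

text \<open>Makes the subtraction defining \<rho> a genuine one, so that the n - 2 matrices and the
  \<rho> identities fill all tensor positions exactly.\<close>

lemma two_power_pceil_ge:
  assumes "n \<ge> 3"
  shows "n - 2 \<le> 2 ^ pceil (log 2 (real n - 2))"
proof -
  let ?x = "log 2 (real n - 2)"
  have "real (n - 2) = 2 powr ?x" using assms by (simp add: of_nat_diff)
  also have "\<dots> \<le> 2 powr real (pceil ?x)"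
  proof (rule powr_mono)
    have "?x \<le> real (nat \<lceil>?x\<rceil>)" by (rule real_nat_ceiling_ge)
    also have "\<dots> \<le> real (pceil ?x)" by (simp add: pceil_def)
    finally show "?x \<le> real (pceil ?x)" .
  qed simp
  also have "\<dots> = real (2 ^ pceil ?x)" by (simp add: powr_realpow)
  finally show ?thesis by (simp only: of_nat_le_iff)
qed

section \<open>Conjugation, transposition and the outer matrices\<close>

lemma mconj_spec:
  assumes "U \<in> carrier_mat d d"
  shows "mconj (spec d U (\<lambda>i. complex_of_real (a i))) = spec d (mconj U) (\<lambda>i. complex_of_real (a i))"
    (is "mconj ?X = ?Y")
proof (rule eq_matI)
  fix i j assume "i < dim_row ?Y" "j < dim_col ?Y"
  then have ij: "i < d" "j < d" using assms by auto
  show "mconj ?X $$ (i,j) = ?Y $$ (i,j)"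
    using ij assms spec_index[OF assms ij] spec_index[OF mconj_carrier[OF assms] ij] by simp
qed (use assms in auto)

text \<open>Transposition conjugates the eigenvectors and leaves even complex eigenvalues alone.
  With \<open>mconj_spec\<close> for real spectra this justifies \<open>tm_twist\<close>.\<close>

lemma transpose_spec:
  assumes "U \<in> carrier_mat d d"
  shows "transpose_mat (spec d U c) = spec d (mconj U) c" (is "transpose_mat ?X = ?Y")
proof (rule eq_matI)
  fix i j assume "i < dim_row ?Y" "j < dim_col ?Y"
  then have ij: "i < d" "j < d" using assms by auto
  show "transpose_mat ?X $$ (i,j) = ?Y $$ (i,j)"
    using ij assms spec_index[OF assms ij(2,1)] spec_index[OF mconj_carrier[OF assms] ij]
    by (simp add: mult_ac)
qed (use assms in auto)

lemma unitary_mconj: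
  assumes "unitary_mat d U"
  shows "unitary_mat d (mconj U)"
proof -
  note U = unitary_matD[OF assms]
  have "madj (mconj U) * mconj U = mconj (madj U * U)" (is "?X = ?Y")
  proof (rule eq_matI)
    fix i j assume "i < dim_row ?Y" "j < dim_col ?Y"
    then have ij: "i < d" "j < d" using U(1) by auto
    have "?X $$ (i,j) = (\<Sum>l<d. madj (mconj U) $$ (i,l) * mconj U $$ (l,j))"
      by (rule mult_index) (use U(1) ij in auto)
    also have "\<dots> = cnj ((madj U * U) $$ (i,j))"
      unfolding mult_index[OF madj_carrier[OF U(1)] U(1) ij] cnj_sum
      by (intro sum.cong refl) (use U(1) ij in auto)
    finally show "?X $$ (i,j) = ?Y $$ (i,j)" using U(1) ij by (simp del: index_mult_mat(1))
  qed (use U(1) in auto)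
  also have "\<dots> = 1\<^sub>m d" unfolding U(2) by (rule eq_matI) auto
  finally show ?thesis using U(1) by (simp add: unitary_mat_def)
qed

lemma madj_mconj: "madj (mconj X) = mconj (madj X)"
  by (rule eq_matI) auto

lemma mconj_mult:
  assumes "X \<in> carrier_mat d d" "Y \<in> carrier_mat d d"
  shows "mconj (X * Y) = mconj X * mconj Y"
proof (rule eq_matI)
  fix i j assume "i < dim_row (mconj X * mconj Y)" "j < dim_col (mconj X * mconj Y)"
  then have ij: "i < d" "j < d" using assms by auto
  have "(mconj X * mconj Y) $$ (i,j) = (\<Sum>l<d. mconj X $$ (i,l) * mconj Y $$ (l,j))"
    by (rule mult_index) (use assms ij in auto)
  also have "\<dots> = cnj ((X * Y) $$ (i,j))"
    unfolding mult_index[OF assms ij] cnj_sum by (intro sum.cong refl) (use assms ij in auto)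
  finally show "mconj (X * Y) $$ (i,j) = (mconj X * mconj Y) $$ (i,j)"
    using assms ij by (simp del: index_mult_mat(1))
qed (use assms in auto)

lemma kron_list_mult_madj:
  "kron_list (map (\<lambda>X. X * madj X) Xs) = kron_list Xs * madj (kron_list Xs)"
  by (induction Xs) (simp_all add: madj_kron kron_mult)

lemma Omega_input_mult_madj:
  assumes "S \<in> carrier_mat d d" "T \<in> carrier_mat d d"
  shows "Omega_input d S T m * madj (Omega_input d S T m) =
    kron (kron (S * madj S) (T * madj T)) (kron_list (map (\<lambda>j. Pproj d (2 ^ j)) [0..<m]))"
proof -
  have "kron_list (map (\<lambda>j. Pproj d (2 ^ j)) [0..<m]) = kron_list (map (\<lambda>X. X * madj X) (map (\<lambda>j. Omega_col d (2 ^ j)) [0..<m]))"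
    by (simp add: Pproj_eq o_def)
  then show ?thesis unfolding Omega_input_def kron_list_mult_madj
    using assms by (simp add: madj_kron kron_mult)
qed

text \<open>The operator \<open>Pproj\<close> has rank one, so cyclicity of the trace leaves r r*
  for the single row r = \<Omega>* M Q.\<close>

lemma mtrace_Pproj_sandwich:
  assumes M: "M \<in> carrier_mat (d ^ (2 * m)) (d ^ (2 * m))" and Q: "Q \<in> carrier_mat (d ^ (2 * m)) c"
  shows "mtrace (Pproj d m * (M * (Q * madj Q) * madj M)) = of_real (frob (transpose_mat (Omega_col d m) * (M * Q)))"
proof -
  let ?D = "d ^ (2 * m)" and ?O = "Omega_col d m"
  let ?r = "madj ?O * (M * Q)"
  note O = Omega_col_carrier[of d m] and O' = madj_carrier[OF Omega_col_carrier[of d m]]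
  note M' = madj_carrier[OF M] and Q' = madj_carrier[OF Q]
  have MQ: "M * Q \<in> carrier_mat ?D c" and MQ': "madj (M * Q) \<in> carrier_mat c ?D" using M Q by auto
  have r: "?r \<in> carrier_mat 1 c" using MQ O' by auto
  have "M * (Q * madj Q) * madj M = M * Q * madj (M * Q)"
    unfolding madj_mult[OF M Q] assoc_mult_mat[OF M Q Q', symmetric] by (rule assoc_mult_mat[OF MQ Q' M'])
  then have "Pproj d m * (M * (Q * madj Q) * madj M) = ?O * (?r * madj (M * Q))"
    unfolding Pproj_eq using O O' MQ MQ'
    by (simp add: assoc_mult_mat[of _ ?D 1 _ ?D _ ?D] assoc_mult_mat[of _ 1 ?D _ c _ ?D])
  also have "mtrace \<dots> = mtrace (?r * madj (M * Q) * ?O)"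
    by (rule mtrace_mult_comm) (use O r MQ' in auto)
  also have "?r * madj (M * Q) * ?O = ?r * madj ?r"
    unfolding madj_mult[OF O' MQ] madj_madj using r MQ' O by (rule assoc_mult_mat)
  also have "mtrace \<dots> = of_real (frob (transpose_mat ?O * (M * Q)))"
    by (simp add: frob_mtrace madj_Omega_col)
  finally show ?thesis .
qed

lemma exp_factor_split:
  assumes "unitary_mat d (fst u)"
  shows "exp_factor d (1 + \<i> * of_real t) u = exp_factor d (\<i> * of_real t) u * exp_factor d 1 u"
    "exp_factor d (1 + \<i> * of_real t) u = exp_factor d 1 u * exp_factor d (\<i> * of_real t) u"
    "unitary_mat d (exp_factor d (\<i> * of_real t) u)"
    "madj (exp_factor d 1 u) = exp_factor d 1 u"
    "exp_factor d 1 u \<in> carrier_mat d d"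
proof -
  note U = unitary_matD[OF assms]
  show "exp_factor d (1 + \<i> * of_real t) u = exp_factor d (\<i> * of_real t) u * exp_factor d 1 u"
    "exp_factor d (1 + \<i> * of_real t) u = exp_factor d 1 u * exp_factor d (\<i> * of_real t) u"
    unfolding exp_factor_def spec_mult[OF assms]
    by (rule spec_cong, simp add: exp_add[symmetric] algebra_simps add_divide_distrib)+
  show "unitary_mat d (exp_factor d (\<i> * of_real t) u)"
    using exp_product_unitary[of "[u]" d t] assms U(1) by (simp add: exp_factor_def)
  show "madj (exp_factor d 1 u) = exp_factor d 1 u"
    unfolding exp_factor_def spec_adj[OF U(1)] by (simp add: exp_cnj)
  show "exp_factor d 1 u \<in> carrier_mat d d" unfolding exp_factor_def using U(1) by auto
qed

text \<open>The outermost matrices enter the network only through their positive square roots. The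
  missing imaginary powers are unitary and would stand at the two ends of the product, where the
  Frobenius norm does not see them.\<close>

lemma frob_exp_product_ends:
  assumes L: "\<And>w. w \<in> set L \<Longrightarrow> unitary_mat d (fst w)" and u: "unitary_mat d (fst u)" and v: "unitary_mat d (fst v)"
  shows "frob (exp_factor d 1 v * (exp_product d L (1 + \<i> * of_real t) * exp_factor d 1 u)) =
    frob (exp_product d (v # L @ [u]) (1 + \<i> * of_real t))"
proof -
  let ?z = "1 + \<i> * complex_of_real t"
  let ?V = "exp_factor d 1 v" and ?U = "exp_factor d 1 u"
  let ?V' = "exp_factor d (\<i> * of_real t) v" and ?U' = "exp_factor d (\<i> * of_real t) u"
  let ?P = "exp_product d L ?z"
  note su = exp_factor_split[OF u] and sv = exp_factor_split[OF v]
  have P: "?P \<in> carrier_mat d d" by (rule exp_product_carrier) (rule L)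
  note cs = P su(5) sv(5) unitary_matD(1)[OF su(3)] unitary_matD(1)[OF sv(3)]
  have "exp_product d (v # L @ [u]) ?z = exp_factor d ?z v * (?P * exp_factor d ?z u)"
  proof -
    have "exp_factor d ?z u * 1\<^sub>m d = exp_factor d ?z u"
      by (rule right_mult_one_mat) (use unitary_matD(1)[OF u] in \<open>auto simp: exp_factor_def\<close>)
    then show ?thesis using exp_product_append[of L d "[u]" ?z] L u by simp
  qed
  also have "\<dots> = (?V' * (?V * (?P * ?U))) * ?U'"
    unfolding sv(1) su(2) using cs by (simp add: assoc_mult_mat[of _ d d _ d _ d] mult_square_carrier)
  finally have "frob (exp_product d (v # L @ [u]) ?z) = frob ((?V' * (?V * (?P * ?U))) * ?U')" by simp
  also have "\<dots> = frob (?V' * (?V * (?P * ?U)))"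
    by (rule frob_unitary_right[OF su(3)]) (use cs in \<open>auto intro!: mult_square_carrier\<close>)
  also have "\<dots> = frob (?V * (?P * ?U))"
    by (rule frob_unitary_left[OF sv(3)]) (use cs in \<open>auto intro!: mult_square_carrier\<close>)
  finally show ?thesis by simp
qed

lemma exp_factor_1_square:
  assumes "unitary_mat d (fst u)"
  shows "exp_factor d 1 u * exp_factor d 1 u = spec d (fst u) (\<lambda>i. of_real (exp (snd u i)))"
  unfolding exp_factor_def spec_mult[OF assms]
  by (rule spec_cong) (simp add: exp_of_real[symmetric] exp_add[symmetric])

lemma sum_singleton_mset: "(\<Sum>q<k. {#f q#}) = mset (map f [0..<k])"
  by (induction k) simp_all

theorem theorem1:
  fixes n d :: nat and A :: "nat \<Rightarrow> complex mat"
  assumes "n \<ge> 3" and "d \<ge> 1"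
    and "\<And>k. k \<in> {1..n} \<Longrightarrow> A k \<in> carrier_mat d d"
    and "\<And>k. k \<in> {1..n} \<Longrightarrow> pos_def_mat (A k)"
  shows "let n' = pceil (log 2 (real n - 2));
             \<rho> = 2 ^ n' - (n - 2);
             \<A> = kron (kron_list (map (\<lambda>k. Calpha (tm_alpha k) (minv (A k))) [2..<n]))
                      (kron_list (replicate \<rho> (1\<^sub>m d)));
             Y = kron (kron (A 1) (mconj (A n)))
                      (kron_list (map (\<lambda>j. Pproj d (2 ^ j)) [0..<n' - 1]))
         in mtrace (mexp (msum_list d (map (\<lambda>k. mlog (A k)) [1..<n+1])))
              \<le> mtrace (Pproj d (2 ^ (n' - 1)) * Tder \<A> Y)"
proof -
  \<comment> \<open>Since \<open>pceil\<close> is at least 1, n' is the successor of m; for n = 3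
    and n = 4 one gets m = 0 and an empty list of projections.\<close>
  define m where "m = pceil (log 2 (real n - 2)) - 1"
  have n': "pceil (log 2 (real n - 2)) = Suc m" by (simp add: m_def pceil_def)
  let ?N = "2 ^ Suc m :: nat"
  let ?D = "d ^ ?N"
  have nN: "n - 2 \<le> ?N" using two_power_pceil_ge[OF assms(1)] by (simp only: n')
  have "\<forall>k. \<exists>p. k \<in> {1..n} \<longrightarrow> unitary_mat d (fst p) \<and> (\<forall>i<d. snd p i > 0) \<and>
      A k = spec d (fst p) (\<lambda>i. complex_of_real (snd p i))"
  proof
    fix k
    show "\<exists>p. k \<in> {1..n} \<longrightarrow> unitary_mat d (fst p) \<and> (\<forall>i<d. snd p i > 0) \<and>
      A k = spec d (fst p) (\<lambda>i. complex_of_real (snd p i))"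
    proof (cases "k \<in> {1..n}")
      case True
      obtain U a where "unitary_mat d U" "\<And>i. i < d \<Longrightarrow> a i > 0" "A k = spec d U (\<lambda>i. complex_of_real (a i))"
        using pos_def_spectral[OF assms(3,4)[OF True]] by blast
      then show ?thesis by (intro exI[of _ "(U, a)"]) simp
    next
      case False
      then show ?thesis by blast
    qed
  qed
  from choice[OF this] obtain p :: "nat \<Rightarrow> spectral" where
    pU: "\<And>k. k \<in> {1..n} \<Longrightarrow> unitary_mat d (fst (p k))" and
    pa: "\<And>k i. k \<in> {1..n} \<Longrightarrow> i < d \<Longrightarrow> snd (p k) i > 0" and
    pA: "\<And>k. k \<in> {1..n} \<Longrightarrow> A k = spec d (fst (p k)) (\<lambda>i. complex_of_real (snd (p k) i))"
    by blast
  \<comment> \<open>\<open>p k\<close> holds the eigenvalues of \<open>A k\<close>,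
    \<open>u k\<close> their logarithms, with the same eigenvectors.\<close>
  define u :: "nat \<Rightarrow> spectral" where "u k = (fst (p k), \<lambda>i. ln (snd (p k) i))" for k
  have uU: "unitary_mat d (fst (u k))" if "k \<in> {1..n}" for k using pU[OF that] by (simp add: u_def)
  have k1: "1 \<in> {1..n}" and kn: "n \<in> {1..n}" using assms(1) by auto
  have kq: "q + 2 \<in> {1..n}" if "q < n - 2" for q using that by auto
  \<comment> \<open>Tensor position q belongs to \<open>A (q + 2)\<close>; a padding position gets
    the empty list, whose product is the identity for every z.\<close>
  define l where "l q = (if q < n - 2 then [u (q + 2)] else [])" for q
  have lU: "unitary_mat d (fst v)" if "v \<in> set (l q)" for q v
    using that uU[OF kq] by (cases "q < n - 2") (auto simp: l_def)

  define S where "S = exp_factor d 1 (u 1)"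
  \<comment> \<open>The conjugate of the square root of \<open>A n\<close>: T T* is the conjugated
    matrix in the argument, while the transpose left over by the last contraction is the square root
    itself.\<close>
  define T where "T = mconj (exp_factor d 1 (u n))"
  note s1 = exp_factor_split[OF uU[OF k1]] and sn = exp_factor_split[OF uU[OF kn]]
  have Sc: "S \<in> carrier_mat d d" and Tc: "T \<in> carrier_mat d d" using s1(5) sn(5) by (auto simp: S_def T_def)
  have TT: "transpose_mat T = exp_factor d 1 (u n)" using sn(4) by (simp add: T_def madj_def)
  have sq: "exp_factor d 1 (u k) * exp_factor d 1 (u k) = A k" if "k \<in> {1..n}" for k
    unfolding exp_factor_1_square[OF uU[OF that]] pA[OF that]
    by (simp add: u_def) (rule spec_cong, simp add: pa[OF that])
  have SS: "S * madj S = A 1" using sq[OF k1] s1(4) by (simp add: S_def)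
  have TTn: "T * madj T = mconj (A n)"
    using sq[OF kn] sn(4) mconj_mult[OF sn(5) sn(5)] by (simp add: T_def madj_mconj)
  define Q where "Q = Omega_input d S T m"
  have Qc: "Q \<in> carrier_mat ?D (d * d)" unfolding Q_def by (rule Omega_input_carrier[OF Sc Tc])
  have Y: "kron (kron (A 1) (mconj (A n))) (kron_list (map (\<lambda>j. Pproj d (2 ^ j)) [0..<m])) = Q * madj Q"
    unfolding Q_def Omega_input_mult_madj[OF Sc Tc] SS TTn ..

  \<comment> \<open>Spectral data of the factors of \<open>\<A>\<close>: the eigenvalues are
    inverted, and the Thue-Morse conjugation touches only the eigenvectors.\<close>
  define w :: "nat \<Rightarrow> spectral" where
    "w q = (if q < n - 2 then (if tm_beta q = 1 then mconj (fst (p (q + 2))) else fst (p (q + 2)), \<lambda>i. 1 / snd (p (q + 2)) i)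
       else (1\<^sub>m d, \<lambda>_. 1))" for q
  have wU: "unitary_mat d (fst (w q))" for q
    using pU[OF kq] unitary_mconj[OF pU[OF kq]] by (simp add: w_def)
  have wpos: "snd (w q) i > 0" if "i < d" for q i
    using pa[OF kq that] by (simp add: w_def)
  let ?us = "map w [0..<?N]"
  have us: "unitary_mat d (fst v)" "i < d \<Longrightarrow> snd v i > 0" if "v \<in> set ?us" for v i
    using that wU wpos by auto
  from kron_list_spec[of ?us d, OF us]
  obtain W a where W: "unitary_mat ?D W" and a: "\<And>i. i < ?D \<Longrightarrow> a i > 0"
    and Weq: "\<And>\<phi>::real \<Rightarrow> complex. (\<forall>x y. x > 0 \<longrightarrow> y > 0 \<longrightarrow> \<phi> (x * y) = \<phi> x * \<phi> y) \<Longrightarrow> \<phi> 1 = 1 \<Longrightarrow>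
       kron_list (map (\<lambda>q. spec d (fst (w q)) (\<lambda>i. \<phi> (snd (w q) i))) [0..<?N]) = spec ?D W (\<lambda>i. \<phi> (a i))"
    by (auto simp: o_def)
  have calA: "kron (kron_list (map (\<lambda>k. Calpha (tm_alpha k) (minv (A k))) [2..<n]))
       (kron_list (replicate (?N - (n - 2)) (1\<^sub>m d))) = spec ?D W (\<lambda>i. complex_of_real (a i))"
  proof -
    have "map (\<lambda>k. Calpha (tm_alpha k) (minv (A k))) [2..<n] @ replicate (?N - (n - 2)) (1\<^sub>m d)
        = map (\<lambda>q. spec d (fst (w q)) (\<lambda>i. complex_of_real (snd (w q) i))) [0..<?N]" (is "?xs = ?ys")
    proof (rule nth_equalityI)
      show "length ?xs = length ?ys" using nN by simp
      fix q assume "q < length ?xs"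
      then have q: "q < ?N" using nN by simp
      show "?xs ! q = ?ys ! q"
      proof (cases "q < n - 2")
        case True
        note k = kq[OF True]
        have "minv (A (q + 2)) = spec d (fst (p (q + 2))) (\<lambda>i. complex_of_real (1 / snd (p (q + 2)) i))"
          unfolding pA[OF k] by (subst minv_spec[OF pU[OF k]]) (use pa[OF k] in force, simp)
        then have "Calpha (tm_beta q) (minv (A (q + 2))) = spec d (fst (w q)) (\<lambda>i. complex_of_real (snd (w q) i))"
          using True mconj_spec[OF unitary_matD(1)[OF pU[OF k]]] by (simp add: Calpha_def w_def del: of_real_divide)
        then show ?thesis using True q by (simp add: nth_append tm_alpha_def add.commute)
      next
        case False
        then have "spec d (fst (w q)) (\<lambda>i. complex_of_real (snd (w q) i)) = 1\<^sub>m d"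
          by (simp add: w_def spec_one)
        then show ?thesis using False q by (simp add: nth_append)
      qed
    qed
    then show ?thesis using Weq[of complex_of_real] by (simp flip: kron_list_append)
  qed

  \<comment> \<open>The power -(1 + i t)/2 of \<open>\<A>\<close>. As \<open>\<A>\<close> consists
    of inverses, its factors are the powers (1 + i t)/2 of the \<open>A k\<close>, up to
    transposition.\<close>
  define M where "M t = spec ?D W (\<lambda>i. exp (- (1 + \<i> * of_real t) / 2 * of_real (ln (a i))))" for t :: real
  have Mc: "M t \<in> carrier_mat ?D ?D" for t unfolding M_def using unitary_matD(1)[OF W] by auto
  have Meq: "M t = kron_list (map (\<lambda>q. tm_twist q (exp_product d (l q) (1 + \<i> * of_real t))) [0..<?N])" for t
  proof -
    define \<phi> where "\<phi> x = exp (- (1 + \<i> * of_real t) / 2 * complex_of_real (ln x))" for x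
    have "spec d (fst (w q)) (\<lambda>i. \<phi> (snd (w q) i)) = tm_twist q (exp_product d (l q) (1 + \<i> * of_real t))" for q
    proof (cases "q < n - 2")
      case True
      note k = kq[OF True]
      note Uc = unitary_matD(1)[OF pU[OF k]]
      let ?f = "\<lambda>i. exp ((1 + \<i> * of_real t) * complex_of_real (ln (snd (p (q + 2)) i) / 2))"
      have "spec d X (\<lambda>i. \<phi> (1 / snd (p (q + 2)) i)) = spec d X ?f" for X
      proof (rule spec_cong)
        fix i assume "i < d"
        then have "ln (1 / snd (p (q + 2)) i) = - ln (snd (p (q + 2)) i)"
          using pa[OF k] by (simp add: ln_div)
        then show "\<phi> (1 / snd (p (q + 2)) i) = ?f i"
          unfolding \<phi>_def by (simp only:) (rule arg_cong[of _ _ exp], simp add: complex_eq_iff field_simps)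
      qed
      moreover have "exp_product d (l q) (1 + \<i> * of_real t) = spec d (fst (p (q + 2))) ?f"
        using True right_mult_one_mat[OF spec_carrier[OF Uc, of ?f]] by (simp add: l_def exp_factor_def u_def)
      ultimately show ?thesis using True transpose_spec[OF Uc, of ?f] by (simp add: w_def tm_twist_def)
    next
      case False
      have "\<phi> 1 = 1" by (simp add: \<phi>_def)
      then show ?thesis using False by (simp add: w_def l_def tm_twist_def spec_one)
    qed
    moreover have "kron_list (map (\<lambda>q. spec d (fst (w q)) (\<lambda>i. \<phi> (snd (w q) i))) [0..<?N]) = spec ?D W (\<lambda>i. \<phi> (a i))"
      by (rule Weq) (auto simp: \<phi>_def ln_mult_pos ring_distribs exp_add[symmetric] diff_divide_distrib add_divide_distrib)
    ultimately show ?thesis by (simp add: M_def \<phi>_def)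
  qed

  obtain L where L: "mset L = (\<Sum>q<?N. mset (l q))"
    and Leq: "\<And>z. frob (Omega_row d S T m (map (\<lambda>q. tm_twist q (exp_product d (l q) z)) [0..<?N]))
       = frob (transpose_mat T * (exp_product d L z * S))"
    using Omega_row_exp_product[OF Sc Tc, of l m] lU by blast
  define vs where "vs = u n # L @ [u 1]"
  have Lset: "\<exists>q. v \<in> set (l q)" if "v \<in> set L" for v
  proof -
    have "v \<in># (\<Sum>q<?N. mset (l q))" using that L by (metis in_multiset_in_set)
    then show ?thesis by (auto simp: set_mset_sum)
  qed
  have LU: "unitary_mat d (fst v)" if "v \<in> set L" for v using Lset[OF that] lU by blast
  have vsU: "unitary_mat d (fst v)" if "v \<in> set vs" for v
  proof -
    have "v = u n \<or> v \<in> set L \<or> v = u 1" using that by (simp add: vs_def) blast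
    then show ?thesis using LU uU[OF k1] uU[OF kn] by blast
  qed
  have perm: "mset vs = mset (map u [1..<n+1])"
  proof -
    have "mset L = (\<Sum>q<n - 2. mset (l q))"
      unfolding L by (rule sum.mono_neutral_right) (use nN in \<open>auto simp: l_def\<close>)
    also have "\<dots> = (\<Sum>q<n - 2. {#u (q + 2)#})" by (intro sum.cong) (auto simp: l_def)
    also have "\<dots> = mset (map (\<lambda>q. u (q + 2)) [0..<n - 2])" by (rule sum_singleton_mset)
    also have "map (\<lambda>q. u (q + 2)) [0..<n - 2] = map u (map (\<lambda>q. q + 2) [0..<n - 2])" by simp
    also have "map (\<lambda>q. q + 2) [0..<n - 2] = [2..<n]"
    proof -
      have "n - 2 + 2 = n" using assms(1) by simp
      then show ?thesis by (simp only: map_add_upt)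
    qed
    finally have "mset L = mset (map u [2..<n])" .
    moreover have "[1..<n + 1] = 1 # [2..<n] @ [n]"
      using assms(1) by (simp add: upt_conv_Cons numeral_2_eq_2)
    ultimately show ?thesis by (simp add: vs_def)
  qed

  define P where "P = Pproj d (2 ^ m)"
  have P: "P \<in> carrier_mat ?D ?D" by (simp add: P_def Pproj_def)
  have QQ: "Q * madj Q \<in> carrier_mat ?D ?D" using Qc by auto
  define rhs where "rhs = mtrace (P * Tder (spec ?D W (\<lambda>i. complex_of_real (a i))) (Q * madj Q))"
  have tr: "mtrace (P * (M t * (Q * madj Q) * madj (M t))) = of_real (frob (exp_product d vs (1 + \<i> * of_real t)))" for t
  proof -
    have "mtrace (P * (M t * (Q * madj Q) * madj (M t))) = of_real (frob (transpose_mat (Omega_col d (2 ^ m)) * (M t * Q)))"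
      unfolding P_def by (rule mtrace_Pproj_sandwich) (use Mc[of t] Qc in simp_all)
    also have "transpose_mat (Omega_col d (2 ^ m)) * (M t * Q) = Omega_row d S T m (map (\<lambda>q. tm_twist q (exp_product d (l q) (1 + \<i> * of_real t))) [0..<?N])"
      unfolding Meq Omega_row_def Q_def ..
    also have "frob \<dots> = frob (exp_product d vs (1 + \<i> * of_real t))"
      unfolding Leq TT unfolding S_def vs_def by (rule frob_exp_product_ends[OF LU uU[OF k1] uU[OF kn]])
    finally show ?thesis .
  qed
  let ?I = "\<lambda>R. integral {-R..R} (\<lambda>t. frob (exp_product d vs (1 + \<i> * of_real t)) * \<beta>\<^sub>0 t)"
  have "((\<lambda>R. integral {-R..R} (\<lambda>t. mtrace (P * (M t * (Q * madj Q) * madj (M t))) * of_real (\<beta>\<^sub>0 t))) \<longlongrightarrow> rhs) at_top"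
    unfolding rhs_def M_def by (rule Tder_spec_limit[OF W a QQ P])
  moreover have "integral {-R..R} (\<lambda>t. mtrace (P * (M t * (Q * madj Q) * madj (M t))) * of_real (\<beta>\<^sub>0 t)) = complex_of_real (?I R)" for R
  proof -
    have "(\<lambda>t. frob (exp_product d vs (1 + \<i> * of_real t)) * \<beta>\<^sub>0 t) integrable_on {-R..R}"
      by (intro integrable_continuous_interval continuous_intros continuous_on_frob_exp_product vsU)
    from has_integral_linear[OF integrable_integral[OF this] bounded_linear_of_real[where ?'a = complex]]
    show ?thesis unfolding tr by (intro integral_unique) (simp add: o_def)
  qed
  ultimately have lim: "((\<lambda>R. complex_of_real (?I R)) \<longlongrightarrow> rhs) at_top" by simp
  have limR: "(?I \<longlongrightarrow> Re rhs) at_top" using tendsto_Re[OF lim] by simp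
  \<comment> \<open>The order on complex numbers compares only numbers with equal imaginary parts,
    so the right side has to be known to be real; it is a limit of real integrals.\<close>
  have Im: "Im rhs = 0" using tendsto_Im[OF lim] by (simp add: tendsto_const_iff)

  have "log_sum d vs \<in> carrier_mat d d" "madj (log_sum d vs) = log_sum d vs"
    using log_sum_carrier[of vs d] madj_log_sum[of vs d] vsU by blast+
  then obtain V s where V: "unitary_mat d V" and s: "log_sum d vs = spec d V (\<lambda>i. complex_of_real (s i))"
    by (rule hermitian_spectral)
  have main: "(\<Sum>i<d. exp (s i)) \<le> Re rhs"
    by (rule trace_exp_log_sum_le[OF vsU V s assms(2) limR])
  have "map (\<lambda>k. mlog (A k)) [1..<n+1] = map (\<lambda>v. spec d (fst v) (\<lambda>i. of_real (snd v i))) (map u [1..<n+1])"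
    using mlog_spec[OF pU pa] by (auto simp: pA u_def)
  then have "msum_list d (map (\<lambda>k. mlog (A k)) [1..<n+1]) = log_sum d (map u [1..<n+1])"
    by (simp only: log_sum_def)
  also have "\<dots> = log_sum d vs" by (rule log_sum_perm[symmetric, OF vsU perm])
  finally have "mtrace (mexp (msum_list d (map (\<lambda>k. mlog (A k)) [1..<n+1]))) = of_real (\<Sum>i<d. exp (s i))"
    by (simp add: s mexp_spec[OF V] mtrace_spec[OF V] exp_of_real)
  then have "mtrace (mexp (msum_list d (map (\<lambda>k. mlog (A k)) [1..<n+1]))) \<le> rhs"
    using main Im by (simp add: less_eq_complex_def)
  then show ?thesis
    unfolding Let_def n' diff_Suc_1 calA Y rhs_def P_def .
qed

end
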